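(* Let $K$ be a field, $N\geq 1$, and let $R$ be a quadric $K$-algebra of solvable type with respect to $x=(x_1,\dots,x_N)$ and a monomial ordering $\leq$ of $\mathbb{N}^N$. Suppose that $\leq$ is degree-compatible. Let $d\in\mathbb{N}$. Then the reduced Gröbner basis of every left ideal of $R$ generated by elements of degree at most $d$ consists of elements of degree at most $$D(N,d)=2\left(\frac{d^2}{2}+d\right)^{2^{N-1}}.$$
   Context: Here $\mathbb{N}=\{0,1,2,\dots\}$ and $|\alpha|=\alpha_1+\cdots+\alpha_N$ for $\alpha\in\mathbb{N}^N$. A monomial ordering of $\mathbb{N}^N$ is a total ordering compatible with addition whose smallest element is $0$; it is degree-compatible if $|\alpha|<|\beta|$ implies $\alpha\leq\beta$. $K$-algebras are associative with unit. For a $K$-algebra $R$ and $x=(x_1,\dots,x_N)\in R^N$ put $x^\alpha:=x_1^{\alpha_1}\cdots x_N^{\alpha_N}$; these are the monomials. $R$ is of solvable type with respect to $x$ and $\leq$ if $\{x^\alpha\}_{\alpha\in\mathbb{N}^N}$ is a $K$-basis of $R$ and for $1\leq i<j\leq N$ there are $0\neq c_{ij}\in K$ and $p_{ij}\in R$ with $x_jx_i=c_{ij}x_ix_j+p_{ij}$ and $\operatorname{lm}(p_{ij})<x_ix_j$. Here monomials are ordered by $x^\alpha\leq x^\beta\iff\alpha\leq\beta$, $\operatorname{lm}(f)$ is the $\leq$-largest monomial occurring in $f\neq 0$, $\operatorname{lc}(f)$ is its coefficient, and $\operatorname{lm}(0):=0$ is smaller than every monomial. $R$ is quadric if each $p_{ij}$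 is a $K$-linear combination of monomials $x^\alpha$ with $|\alpha|\leq 2$. The degree of a nonzero $f\in R$ is the smallest $e$ such that $f$ is a $K$-linear combination of products (words) of at most $e$ of the generators $x_1,\dots,x_N$; for quadric $R$ this equals the maximum of $|\alpha|$ over the monomials $x^\alpha$ occurring in $f$. A monomial $x^\alpha$ divides $x^\beta$ if $\alpha_i\leq\beta_i$ for all $i$. A Gröbner basis of a left ideal $I$ of $R$ is a finite set $G\subseteq I$ generating $I$ as a left ideal such that for every nonzero $f\in I$ there is a nonzero $g\in G$ with $\operatorname{lm}(g)\mid\operatorname{lm}(f)$. It is reduced if for each $g\in G$, $\operatorname{lc}(g)=1$ and no monomial occurring in $g$ is divisible by $\operatorname{lm}(g')$ for any nonzero $g'\in G\setminus\{g\}$. Every left ideal of $R$ has a unique reduced Gröbner basis. *)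

theory Defs
  imports Complex_Main
begin

(* N^N: exponent vectors are functions on nat vanishing outside the index range {1..N}. *)
definition exps :: "nat \<Rightarrow> (nat \<Rightarrow> nat) set" where
  "exps N = {\<alpha>. \<forall>i. i \<notin> {1..N} \<longrightarrow> \<alpha> i = 0}"

definition total_deg :: "nat \<Rightarrow> (nat \<Rightarrow> nat) \<Rightarrow> nat" where
  "total_deg N \<alpha> = (\<Sum>i = 1..N. \<alpha> i)"

(* An ordering is the set of pairs (alpha, beta) with alpha \<le> beta. *)
definition monomial_ordering :: "nat \<Rightarrow> ((nat \<Rightarrow> nat) \<times> (nat \<Rightarrow> nat)) set \<Rightarrow> bool" where
  "monomial_ordering N ord \<longleftrightarrow>
     linear_order_on (exps N) ord \<and>
     (\<forall>\<alpha>\<in>exps N. \<forall>\<beta>\<in>exps N. \<forall>\<gamma>\<in>exps N.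
        (\<alpha>, \<beta>) \<in> ord \<longrightarrow> ((\<lambda>i. \<alpha> i + \<gamma> i), (\<lambda>i. \<beta> i + \<gamma> i)) \<in> ord) \<and>
     (\<forall>\<alpha>\<in>exps N. ((\<lambda>i. 0), \<alpha>) \<in> ord)"

definition degree_compatible :: "nat \<Rightarrow> ((nat \<Rightarrow> nat) \<times> (nat \<Rightarrow> nat)) set \<Rightarrow> bool" where
  "degree_compatible N ord \<longleftrightarrow>
     (\<forall>\<alpha>\<in>exps N. \<forall>\<beta>\<in>exps N. total_deg N \<alpha> < total_deg N \<beta> \<longrightarrow> (\<alpha>, \<beta>) \<in> ord)"

definition left_ideal :: "'r::ring_1 set \<Rightarrow> bool" where
  "left_ideal I \<longleftrightarrow> 0 \<in> I \<and> (\<forall>a\<in>I. \<forall>b\<in>I. a + b \<in> I) \<and> (\<forall>r. \<forall>a\<in>I. r * a \<in> I)"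

locale K_algebra = vector_space scale
  for scale :: "'k::field \<Rightarrow> 'r::ring_1 \<Rightarrow> 'r"  (infixr \<open>*s\<close> 75) +
  assumes scale_mult_left: "(a *s u) * v = a *s (u * v)"
    and scale_mult_right: "u * (a *s v) = a *s (u * v)"

locale K_algebra_tuple = K_algebra scale
  for scale :: "'k::field \<Rightarrow> 'r::ring_1 \<Rightarrow> 'r"  (infixr \<open>*s\<close> 75) +
  fixes N :: nat
    and x :: "nat \<Rightarrow> 'r"
    and ord :: "((nat \<Rightarrow> nat) \<times> (nat \<Rightarrow> nat)) set"
begin

definition monom :: "(nat \<Rightarrow> nat) \<Rightarrow> 'r" where
  "monom \<alpha> = prod_list (map (\<lambda>i. x i ^ \<alpha> i) [1..<Suc N])"

definition monomial_basis :: bool where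
  "monomial_basis \<longleftrightarrow>
     inj_on monom (exps N) \<and> independent (monom ` exps N) \<and> span (monom ` exps N) = UNIV"

definition coeff :: "'r \<Rightarrow> (nat \<Rightarrow> nat) \<Rightarrow> 'k" where
  "coeff f \<alpha> = representation (monom ` exps N) f (monom \<alpha>)"

definition supp :: "'r \<Rightarrow> (nat \<Rightarrow> nat) set" where
  "supp f = {\<alpha> \<in> exps N. coeff f \<alpha> \<noteq> 0}"

(* The leading monomial is represented by its exponent vector. This is meaningful only for
   f \<noteq> 0; the case lm 0 = 0 is treated explicitly wherever it can arise. *)
definition lm :: "'r \<Rightarrow> (nat \<Rightarrow> nat)" where
  "lm f = (THE \<alpha>. \<alpha> \<in> supp f \<and> (\<forall>\<beta>\<in>supp f. (\<beta>, \<alpha>) \<in> ord))"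

definition lc :: "'r \<Rightarrow> 'k" where
  "lc f = coeff f (lm f)"

(* lm f < x^alpha, where lm 0 = 0 lies below every monomial. *)
definition lm_less :: "'r \<Rightarrow> (nat \<Rightarrow> nat) \<Rightarrow> bool" where
  "lm_less f \<alpha> \<longleftrightarrow> f = 0 \<or> ((lm f, \<alpha>) \<in> ord \<and> lm f \<noteq> \<alpha>)"

definition commutation :: "nat \<Rightarrow> nat \<Rightarrow> 'k \<Rightarrow> 'r \<Rightarrow> bool" where
  "commutation i j c p \<longleftrightarrow>
     c \<noteq> 0 \<and> x j * x i = c *s (x i * x j) + p \<and>
     lm_less p (\<lambda>k. if k = i \<or> k = j then 1 else 0)"

definition solvable_type :: bool where
  "solvable_type \<longleftrightarrow>
     monomial_basis \<and>
     (\<forall>i j. 1 \<le> i \<and> i < j \<and> j \<le> N \<longrightarrow> (\<exists>c p. commutation i j c p))"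

(* In an algebra of solvable type, commutation i j c p determines c and p,
   so the p below is the element p_ij of the definition of solvable type. *)
definition quadric :: bool where
  "quadric \<longleftrightarrow>
     (\<forall>i j c p. 1 \<le> i \<and> i < j \<and> j \<le> N \<and> commutation i j c p \<longrightarrow>
        p \<in> span {monom \<alpha> |\<alpha>. \<alpha> \<in> exps N \<and> total_deg N \<alpha> \<le> 2})"

(* For f = 0 this gives 0, as the set of words of length 0 already spans 0. *)
definition deg :: "'r \<Rightarrow> nat" where
  "deg f = (LEAST e. f \<in> span {prod_list (map x w) |w. set w \<subseteq> {1..N} \<and> length w \<le> e})"

definition groebner_basis :: "'r set \<Rightarrow> 'r set \<Rightarrow> bool" where
  "groebner_basis I G \<longleftrightarrow>
     finite G \<and> G \<subseteq> I \<and> left_ideal hull G = I \<and>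
     (\<forall>f\<in>I. f \<noteq> 0 \<longrightarrow> (\<exists>g\<in>G. g \<noteq> 0 \<and> (\<forall>i\<in>{1..N}. lm g i \<le> lm f i)))"

definition reduced_groebner_basis :: "'r set \<Rightarrow> 'r set \<Rightarrow> bool" where
  "reduced_groebner_basis I G \<longleftrightarrow>
     groebner_basis I G \<and>
     (\<forall>g\<in>G. lc g = 1 \<and>
        (\<forall>g'\<in>G - {g}. g' \<noteq> 0 \<longrightarrow>
           (\<forall>\<alpha>\<in>supp g. \<not> (\<forall>i\<in>{1..N}. lm g' i \<le> \<alpha> i))))"

end

locale quadric_solvable_algebra = K_algebra_tuple +
  assumes monomial_ordering: "monomial_ordering N ord"
    and solvable_type: "solvable_type"
    and quadric: "quadric"

end

theory Submission
  imports Defs "HOL-Library.Multiset" "HOL-Computational_Algebra.Polynomial"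
begin

text \<open>
  The bound is obtained by Dube's method of cone decompositions. Let \<open>W e\<close> be the span of
  the products \<open>r * f\<close> with \<open>f\<close> a generator and \<open>deg r \<le> e - d\<close>. The family \<open>W\<close> behaves like a
  homogeneous ideal in \<open>N + 1\<close> variables, the additional variable (index 0) recording
  \<open>e - deg f\<close>, so that its leading monomials form a monomial ideal \<open>M\<close> of \<open>\<nat>\<^sup>N\<^sup>+\<^sup>1\<close>. Counting leading
  monomials turns a chain of colon ideals into an identity of Hilbert functions: in degree
  \<open>z + d\<close>, all monomials are accounted for by the monomials of degree \<open>z\<close> (the multiples of one
  generator), by cones describing the other generators, and by cones describing the complement
  of \<open>M\<close>. Both families of cones can be rearranged so that the cones of positive dimension have
  distinct degrees; their Hilbert polynomials are then given by sequences \<open>a\<close> and \<open>b\<close> of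
  Macaulay constants. Comparing Hilbert polynomials, evaluated at 0 after taking differences,
  bounds \<open>a j + b j\<close> recursively, comparing Hilbert functions shows that the cones of
  dimension 0 have degree below \<open>max (a 1) (b 1)\<close>, and a minimal generator of \<open>M\<close> has degree
  at most one more than some cone of its complement.
\<close>

text \<open>The elements of degree at most \<open>e\<close> in the ideal are out of reach for
  counting: cancellation of leading terms puts there elements that arise only from combinations of
  higher degree. The spaces \<open>W e\<close> may be smaller, but their dimensions can be computed
  exactly, one generator at a time, and every element of the ideal lies in some \<open>W e\<close>.
  A minimal generator of \<open>M\<close> still gives a leading monomial of the ideal once index 0
  is forgotten, so a bound for \<open>M\<close> is enough. Noncommutativity is absorbed by one fact:
  leading exponents add under multiplication, up to unknown nonzero scalars. From there on only
  monomials are counted, and no homogenized algebra has to be built. All generators are placed in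
  degree \<open>d\<close>, whatever their own degree, so that the cone families of different
  generators start in the same degree and may be united. The double exponential comes from the
  quadratic term in the recursion for \<open>a j + b j\<close>: the recursion starts with
  \<open>2 * d\<close> at \<open>j = N\<close>, and each step down squares the base of the
  bound.\<close>

section \<open>Cones and Macaulay constants\<close>

text \<open>A multiset of pairs \<open>(a, k)\<close> stands for a family of disjoint cones with apex of degree \<open>a\<close> and
  \<open>k\<close> free variables; such a cone has \<open>cone_card k a z\<close> monomials of degree \<open>z\<close>.\<close>

definition cone_card :: "nat \<Rightarrow> nat \<Rightarrow> nat \<Rightarrow> nat" where
  "cone_card k a z =
     (if z < a then 0 else if k = 0 then of_bool (z = a) else (z - a + k - 1) choose (k - 1))"

text \<open>Single out one free variable: either its exponent is that of the apex, or the apex may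
  be raised by one in it. Arithmetically this is Pascal's rule.\<close>

lemma cone_card_Suc: "cone_card (Suc k) a z = cone_card k a z + cone_card (Suc k) (Suc a) z"
proof (cases "z \<le> a")
  case True
  then show ?thesis by (auto simp: cone_card_def)
next
  case False
  then obtain m where m: "z = a + Suc m" using less_iff_Suc_add[of a z] by auto
  show ?thesis by (cases k) (auto simp: cone_card_def m)
qed

definition hilb :: "(nat \<times> nat) multiset \<Rightarrow> nat \<Rightarrow> nat" where
  "hilb P z = (\<Sum>(a, k)\<in>#P. cone_card k a z)"

lemma hilb_simps [simp]:
  "hilb {#} z = 0" "hilb (add_mset (a, k) P) z = cone_card k a z + hilb P z"
  "hilb (P + Q) z = hilb P z + hilb Q z"
  by (auto simp: hilb_def)

text \<open>Dube's \<open>q\<close>-standard cone decompositions, reduced to degrees and dimensions.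
  Below a cone of positive dimension no degree from \<open>q\<close> on is skipped, so a cone of top
  dimension also occurs in degree \<open>q\<close> itself. Cones of dimension 0 are exempt: they do
  not affect the Hilbert polynomial and are bounded separately.\<close>

definition standard :: "nat \<Rightarrow> (nat \<times> nat) multiset \<Rightarrow> bool" where
  "standard q P \<longleftrightarrow> (\<forall>(a, k)\<in>#P. k > 0 \<longrightarrow>
     q \<le> a \<and> (\<forall>e. q \<le> e \<and> e \<le> a \<longrightarrow> (\<exists>k'\<ge>k. (e, k') \<in># P)))"

lemma standardD:
  assumes "standard q P" "(a, k) \<in># P" "k > 0"
  shows "q \<le> a" "q \<le> e \<Longrightarrow> e \<le> a \<Longrightarrow> \<exists>k'\<ge>k. (e, k') \<in># P"
  using assms unfolding standard_def by auto

lemma standard_union: "standard q P \<Longrightarrow> standard q Q \<Longrightarrow> standard q (P + Q)"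
  unfolding standard_def Ball_def by (simp split: prod.splits) metis

text \<open>A cone is the disjoint union of its apex and of one cone of each dimension from 1 to its own,
  with apex one degree higher.\<close>

fun fan :: "nat \<times> nat \<Rightarrow> (nat \<times> nat) multiset" where
  "fan (a, k) = add_mset (a, 0) (image_mset (\<lambda>j. (Suc a, j)) (mset_set {1..k}))"

lemma hilb_fan: "hilb (fan (a, k)) z = cone_card k a z"
proof (induction k)
  case 0
  then show ?case by simp
next
  case (Suc k)
  have "{1..Suc k} = insert (Suc k) {1..k}" by auto
  then show ?case using Suc cone_card_Suc[of k a z] by simp
qed

lemma hilb_fans: "hilb (\<Sum>t\<in>#A. fan t) z = hilb A z"
proof (induction A)
  case empty
  then show ?case by simp
next
  case (add t A)
  then show ?case by (cases t) (simp add: hilb_fan del: fan.simps)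
qed

lemma in_fan_iff: "(b, j) \<in># fan (a, k) \<longleftrightarrow> (b = a \<and> j = 0) \<or> (b = Suc a \<and> 1 \<le> j \<and> j \<le> k)"
  by auto

lemma in_fans_iff:
  "(b, j) \<in># (\<Sum>t\<in>#A. fan t) \<longleftrightarrow>
     (\<exists>k. (b, k) \<in># A \<and> j = 0) \<or> (\<exists>a k. (a, k) \<in># A \<and> b = Suc a \<and> 1 \<le> j \<and> j \<le> k)"
proof -
  have "(b, j) \<in># (\<Sum>t\<in>#A. fan t) \<longleftrightarrow> (\<exists>a k. (a, k) \<in># A \<and> (b, j) \<in># fan (a, k))"
    by (auto simp: in_Union_mset_iff simp del: fan.simps)
  then show ?thesis unfolding in_fan_iff by blast
qed

definition num_dim :: "nat \<Rightarrow> (nat \<times> nat) multiset \<Rightarrow> nat" where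
  "num_dim K P = size (filter_mset (\<lambda>t. snd t = K) P)"

lemma num_dim_simps [simp]:
  "num_dim K {#} = 0" "num_dim K (add_mset t P) = of_bool (snd t = K) + num_dim K P"
  "num_dim K (P + Q) = num_dim K P + num_dim K Q"
  by (auto simp: num_dim_def)

lemma num_dim_fan:
  assumes "k \<le> K" "K > 0"
  shows "num_dim K (fan (a, k)) = of_bool (k = K)"
proof -
  have "filter_mset (\<lambda>j. j = K) (mset_set {1..k}) = mset_set {j\<in>{1..k}. j = K}"
    by (rule filter_mset_mset_set) simp
  also have "{j\<in>{1..k}. j = K} = (if k = K then {K} else {})" using assms by (auto simp: Suc_le_eq)
  finally have *: "filter_mset (\<lambda>j. j = K) (mset_set {1..k}) = (if k = K then {#K#} else {#})" by simp
  have "size (filter_mset (\<lambda>t. snd t = K) (image_mset (\<lambda>j. (Suc a, j)) (mset_set {1..k}))) =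
      size (filter_mset (\<lambda>j. j = K) (mset_set {1..k}))"
    unfolding filter_mset_image_mset by simp
  also have "\<dots> = of_bool (k = K)" unfolding * by simp
  finally have "size (filter_mset (\<lambda>t. snd t = K) (image_mset (\<lambda>j. (Suc a, j)) (mset_set {1..k}))) = of_bool (k = K)" .
  then show ?thesis using assms by (auto simp: num_dim_def)
qed

text \<open>Exactly one piece of a fanned cone of positive dimension keeps the full dimension. The
  number of cones of top dimension, which measures the inner induction of
  \<open>macaulay_constants\<close>, is thus unaffected by fanning.\<close>

lemma num_dim_fans:
  assumes "\<forall>t\<in>#A. snd t \<le> K" "K > 0"
  shows "num_dim K (\<Sum>t\<in>#A. fan t) = num_dim K A"
  using assms
proof (induction A)
  case empty
  then show ?case by simp
next
  case (add t A)
  then show ?case by (cases t) (simp add: num_dim_fan del: fan.simps)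
qed

lemma decreasing_chain:
  fixes b :: "nat \<Rightarrow> nat"
  assumes b: "\<And>j. 1 \<le> j \<Longrightarrow> j \<le> n \<Longrightarrow> b (Suc j) \<le> b j"
    and "i \<le> j" "1 \<le> i" "j \<le> Suc n"
  shows "b j \<le> b i"
  using assms(2,4)
proof (induction j rule: dec_induct)
  case base
  then show ?case by simp
next
  case (step j)
  then have "b (Suc j) \<le> b j" using b[of j] assms(3) by simp
  then show ?case using step by simp
qed

text \<open>In each degree, starting from \<open>q\<close>, one cone of maximal dimension is kept and all others are
  fanned out into the next degree. In the result, \<open>b j\<close> is one more than the largest degree of a
  cone of dimension at least \<open>j\<close>, and \<open>Z z\<close> counts the cones of dimension 0 and degree \<open>z\<close>.\<close>

lemma macaulay_constants:
  assumes "standard q P" "\<forall>t\<in>#P. snd t \<le> K"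
  shows "\<exists>b Z. b (Suc K) = q \<and> (\<forall>j. 1 \<le> j \<and> j \<le> K \<longrightarrow> b (Suc j) \<le> b j) \<and> finite {z. Z z \<noteq> 0} \<and>
     (\<forall>z. hilb P z = Z z + (\<Sum>j=1..K. \<Sum>c=b (Suc j)..<b j. cone_card j c z)) \<and>
     (\<forall>t\<in>#P. fst t < b 1 \<or> (\<exists>a'\<ge>fst t. Z a' > (0::nat)))"
    (is "\<exists>b Z. ?Q q P K b Z")
  using assms
proof (induction K arbitrary: q P)
  case 0
  have "finite {z. hilb P z \<noteq> 0} \<and> (\<forall>t\<in>#P. hilb P (fst t) > 0)"
    using "0.prems"(2)
  proof (induction P)
    case empty
    then show ?case by simp
  next
    case (add t P)
    obtain a where t: "t = (a, 0)" using add.prems by (cases t) auto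
    have "{z. hilb (add_mset t P) z \<noteq> 0} \<subseteq> insert a {z. hilb P z \<noteq> 0}"
      by (auto simp: t cone_card_def)
    then have "finite {z. hilb (add_mset t P) z \<noteq> 0}"
      by (rule finite_subset) (use add in simp)
    then show ?case using add by (auto simp: t cone_card_def)
  qed
  then have "?Q q P 0 (\<lambda>_. q) (hilb P)" by auto
  then show ?case by (intro exI[of _ "\<lambda>_. q"] exI[of _ "hilb P"]) simp
next
  case (Suc K)
  \<comment> \<open>Each round sets one cone of dimension \<open>Suc K\<close> aside and moves the
    start degree from \<open>q\<close> to \<open>q + 1\<close>; the number of such cones still to be
    treated drops by one.\<close>
  from Suc.prems show ?case
  proof (induction "num_dim (Suc K) P" arbitrary: q P)
    case 0
    have "\<forall>t\<in>#P. snd t \<le> K"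
    proof
      fix t assume t: "t \<in># P"
      then have "snd t \<noteq> Suc K" using 0(1) by (auto simp: num_dim_def filter_mset_eq_conv)
      then show "snd t \<le> K" using "0.prems"(2) t by (auto simp: le_Suc_eq)
    qed
    \<comment> \<open>Without cones of dimension \<open>Suc K\<close> the interval of degrees for
      that dimension is empty: both of its ends are \<open>q\<close>.\<close>
    from Suc.IH[OF "0.prems"(1) this] obtain b Z where bZ: "?Q q P K b Z" by blast
    have e: "(\<Sum>j=1..K. \<Sum>c=(b(Suc (Suc K) := q)) (Suc j)..<(b(Suc (Suc K) := q)) j. cone_card j c z)
      = (\<Sum>j=1..K. \<Sum>c=b (Suc j)..<b j. cone_card j c z)" for z
      by (rule sum.cong) auto
    have "?Q q P (Suc K) (b(Suc (Suc K) := q)) Z"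
      using bZ e by (auto simp: le_Suc_eq)
    then show ?case by (rule exI[of _ "b(Suc (Suc K) := q)", OF exI[of _ Z]])
  next
    case (Suc m)
    have "filter_mset (\<lambda>t. snd t = Suc K) P \<noteq> {#}"
      using Suc(2) unfolding num_dim_def by (metis size_empty nat.distinct(1))
    then obtain t where "t \<in># filter_mset (\<lambda>t. snd t = Suc K) P" by (rule multiset_nonemptyE)
    then obtain a where a: "(a, Suc K) \<in># P" by (cases t) auto
    \<comment> \<open>Standardness at the lower end \<open>q\<close> supplies a cone of top
      dimension in degree \<open>q\<close>; this is the one to keep.\<close>
    have "q \<le> a" using standardD(1)[OF Suc.prems(1) a] by simp
    then obtain k' where k': "k' \<ge> Suc K" "(q, k') \<in># P"
      using standardD(2)[OF Suc.prems(1) a, of q] by auto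
    then have "k' = Suc K" using Suc.prems(2) by force
    with k' obtain P1 where P1: "P = add_mset (q, Suc K) P1" by (metis multi_member_split)
    define A where "A = filter_mset (\<lambda>t. fst t = q) P1"
    define B where "B = filter_mset (\<lambda>t. fst t \<noteq> q) P1"
    have AB: "P1 = A + B" unfolding A_def B_def by (rule multiset_partition)
    \<comment> \<open>Only the other cones of degree \<open>q\<close> are fanned. Their pieces of
      positive dimension land in degree \<open>q + 1\<close>; their apices stay in degree
      \<open>q\<close> but have dimension 0, which \<open>standard\<close> does not
      constrain.\<close>
    define P' where "P' = (\<Sum>t\<in>#A. fan t) + B"
    have dA: "\<forall>t\<in>#A. snd t \<le> Suc K" and dB: "\<forall>t\<in>#B. snd t \<le> Suc K"
      using Suc.prems(2) by (auto simp: P1 AB)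
    have "num_dim (Suc K) P' = num_dim (Suc K) P1"
      by (simp add: P'_def AB num_dim_fans dA)
    then have m: "m = num_dim (Suc K) P'" using Suc(2) by (simp add: P1)
    have h: "hilb P z = cone_card (Suc K) q z + hilb P' z" for z
      by (simp add: P1 AB P'_def hilb_fans)
    have memA: "(a, k) \<in># A \<longleftrightarrow> (a, k) \<in># P1 \<and> a = q" for a k by (auto simp: A_def)
    have memB: "(a, k) \<in># B \<longleftrightarrow> (a, k) \<in># P1 \<and> a \<noteq> q" for a k by (auto simp: B_def)
    have mem: "(a, k) \<in># P' \<longleftrightarrow> ((a, k) \<in># P1 \<and> a \<noteq> q) \<or> (\<exists>j. (a, j) \<in># P1 \<and> a = q \<and> k = 0) \<or>
       (\<exists>j. (q, j) \<in># P1 \<and> a = Suc q \<and> 1 \<le> k \<and> k \<le> j)" for a k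
      unfolding P'_def union_iff in_fans_iff by (auto simp: memA memB)
    have dims: "\<forall>t\<in>#P'. snd t \<le> Suc K"
    proof
      fix t assume "t \<in># P'"
      then show "snd t \<le> Suc K" using Suc.prems(2) by (cases t) (fastforce simp: mem P1)
    qed
    have std: "standard (Suc q) P'"
      unfolding standard_def
    proof (clarify)
      fix a k :: nat assume ak: "(a, k) \<in># P'" "k > 0"
      from ak(1)[unfolded mem] ak(2)
      consider "(a, k) \<in># P1" "a \<noteq> q" | j where "(q, j) \<in># P1" "a = Suc q" "1 \<le> k" "k \<le> j" by blast
      then show "Suc q \<le> a \<and> (\<forall>e. Suc q \<le> e \<and> e \<le> a \<longrightarrow> (\<exists>k'\<ge>k. (e, k') \<in># P'))"
      proof cases
        case 1
        then have P: "(a, k) \<in># P" by (simp add: P1)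
        have "q \<le> a" using standardD(1)[OF Suc.prems(1) P ak(2)] .
        moreover have "\<exists>k'\<ge>k. (e, k') \<in># P'" if e: "Suc q \<le> e" "e \<le> a" for e
        proof -
          from standardD(2)[OF Suc.prems(1) P ak(2), of e] e
          obtain k' where "k' \<ge> k" "(e, k') \<in># P" by auto
          then show ?thesis using e by (auto simp: mem P1)
        qed
        ultimately show ?thesis using 1 by auto
      next
        case 2
        have "\<exists>k'\<ge>k. (e, k') \<in># P'" if e: "Suc q \<le> e" "e \<le> a" for e
          using e 2 ak by (metis le_antisym order_refl)
        then show ?thesis using 2 by auto
      qed
    qed
    from Suc(1)[OF m std dims] obtain b Z where bZ: "?Q (Suc q) P' (Suc K) b Z" by blast
    \<comment> \<open>Lowering the start value from \<open>q + 1\<close> to \<open>q\<close> adds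
      just \<open>c = q\<close> to the interval of dimension \<open>Suc K\<close>, which accounts
      for the kept cone.\<close>
    define b' where "b' = b(Suc (Suc K) := q)"
    have b'K: "b' (Suc (Suc K)) = q" by (simp add: b'_def)
    have b'j: "b' j = b j" if "j \<le> Suc K" for j using that by (simp add: b'_def)
    have bq: "Suc q \<le> b (Suc K)" using bZ by auto
    have mono: "b (Suc K) \<le> b j" if "1 \<le> j" "j \<le> Suc K" for j
      using decreasing_chain[of "Suc K" b j "Suc K"] bZ that by simp
    have S: "(\<Sum>j=1..Suc K. \<Sum>c=b' (Suc j)..<b' j. cone_card j c z) =
       cone_card (Suc K) q z + (\<Sum>j=1..Suc K. \<Sum>c=b (Suc j)..<b j. cone_card j c z)" for z
    proof -
      have "{q..<b (Suc K)} = insert q {Suc q..<b (Suc K)}" using bq by auto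
      then have "(\<Sum>c=q..<b (Suc K). cone_card (Suc K) c z) =
        cone_card (Suc K) q z + (\<Sum>c=Suc q..<b (Suc K). cone_card (Suc K) c z)" by simp
      moreover have "(\<Sum>j=1..K. \<Sum>c=b' (Suc j)..<b' j. cone_card j c z) =
         (\<Sum>j=1..K. \<Sum>c=b (Suc j)..<b j. cone_card j c z)"
        by (rule sum.cong) (auto simp: b'j)
      ultimately show ?thesis using bZ by (simp add: b'K b'j)
    qed
    have top: "fst t < b' 1 \<or> (\<exists>a'\<ge>fst t. Z a' > 0)" if t: "t \<in># P" for t
    proof (cases t)
      case (Pair a k)
      show ?thesis
      proof (cases "a = q")
        case True
        have "q < b 1" using mono[of 1] bq by simp
        then show ?thesis using True Pair by (auto simp: b'j)
      next
        case False
        then have "(a, k) \<in># P'" using t by (auto simp: mem Pair P1)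
        then show ?thesis using bZ b'j[of 1] by (fastforce simp: Pair)
      qed
    qed
    have mono': "b' (Suc j) \<le> b' j" if "1 \<le> j" "j \<le> Suc K" for j
      using that bZ bq by (cases "j = Suc K") (auto simp: b'_def)
    have "?Q q P (Suc K) b' Z"
      using b'K mono' bZ h S top by (simp del: sum.cl_ivl_Suc)
    then show ?case by (rule exI[of _ b', OF exI[of _ Z]])
  qed
qed

section \<open>Comparison of Hilbert polynomials\<close>

definition polynomial_fun :: "(real \<Rightarrow> real) \<Rightarrow> bool" where
  "polynomial_fun f \<longleftrightarrow> (\<exists>p. \<forall>y. f y = poly p y)"

lemma polynomial_fun_const: "polynomial_fun (\<lambda>_. c)"
  unfolding polynomial_fun_def by (rule exI[of _ "[:c:]"]) simp

lemma polynomial_fun_shift: "polynomial_fun (\<lambda>y. y + c)"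
  unfolding polynomial_fun_def by (rule exI[of _ "[:c, 1:]"]) simp

lemma polynomial_fun_add:
  "polynomial_fun f \<Longrightarrow> polynomial_fun g \<Longrightarrow> polynomial_fun (\<lambda>y. f y + g y)"
  unfolding polynomial_fun_def by (metis poly_add)

lemma polynomial_fun_diff:
  "polynomial_fun f \<Longrightarrow> polynomial_fun g \<Longrightarrow> polynomial_fun (\<lambda>y. f y - g y)"
  unfolding polynomial_fun_def by (metis poly_diff)

lemma polynomial_fun_mult:
  "polynomial_fun f \<Longrightarrow> polynomial_fun g \<Longrightarrow> polynomial_fun (\<lambda>y. f y * g y)"
  unfolding polynomial_fun_def by (metis poly_mult)

lemma polynomial_fun_sum:
  "(\<And>i. i \<in> A \<Longrightarrow> polynomial_fun (f i)) \<Longrightarrow> polynomial_fun (\<lambda>y. \<Sum>i\<in>A. f i y)"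
  by (induction A rule: infinite_finite_induct) (simp_all add: polynomial_fun_const polynomial_fun_add)

lemma polynomial_fun_prod:
  "(\<And>i. i \<in> A \<Longrightarrow> polynomial_fun (f i)) \<Longrightarrow> polynomial_fun (\<lambda>y. \<Prod>i\<in>A. f i y)"
  by (induction A rule: infinite_finite_induct) (simp_all add: polynomial_fun_const polynomial_fun_mult)

lemma polynomial_fun_gbinomial: "polynomial_fun (\<lambda>y. (y + c) gchoose k)"
proof -
  have "polynomial_fun (\<lambda>y. (\<Prod>i = 0..<k. (y + c) - of_nat i) * (1 / fact k))"
    by (intro polynomial_fun_mult polynomial_fun_prod polynomial_fun_const polynomial_fun_diff
        polynomial_fun_shift)
  then show ?thesis by (simp add: gbinomial_prod_rev)
qed

text \<open>Hilbert functions are polynomial only for large arguments. Since a nonzero polynomial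
  has finitely many roots, agreement there suffices for evaluation at 0, far below the range in
  which the counts are valid.\<close>

lemma polynomial_fun_eqI:
  assumes "polynomial_fun f" "polynomial_fun g" "\<And>z::nat. z \<ge> z0 \<Longrightarrow> f (real z) = g (real z)"
  shows "f y = g y"
proof -
  obtain p where p: "\<And>y. f y - g y = poly p y"
    using polynomial_fun_diff[OF assms(1,2)] unfolding polynomial_fun_def by auto
  have "p = 0"
  proof (rule ccontr)
    assume "p \<noteq> 0"
    then have "finite {y. poly p y = 0}" by (rule poly_roots_finite)
    moreover have "real ` {z0..} \<subseteq> {y. poly p y = 0}" using assms(3) by (auto simp flip: p)
    ultimately have "finite (real ` {z0..})" by (rule rev_finite_subset)
    then have "finite {z0..}" by (rule finite_imageD) simp
    then show False using infinite_Ici by blast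
  qed
  then show ?thesis using p[of y] by simp
qed

section \<open>Hilbert polynomials in terms of Macaulay constants\<close>

lemma gbinomial_telescope:
  fixes y :: real
  assumes "p \<le> q"
  shows "(\<Sum>c=p..<q. (y - real c + real i) gchoose i) =
    ((y - real p + real i + 1) gchoose Suc i) - ((y - real q + real i + 1) gchoose Suc i)"
  using assms
proof (induction q rule: dec_induct)
  case base
  then show ?case by simp
next
  case (step q)
  have "((y - real q + real i + 1) gchoose Suc i) =
      ((y - real q + real i) gchoose i) + ((y - real q + real i) gchoose Suc i)"
    using gbinomial_Suc_Suc[of "y - real q + real i" i] by (simp add: add_ac)
  moreover have "y - real (Suc q) + real i + 1 = y - real q + real i" by simp
  moreover have "(\<Sum>c=p..<Suc q. (y - real c + real i) gchoose i) =
      (\<Sum>c=p..<q. (y - real c + real i) gchoose i) + ((y - real q + real i) gchoose i)"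
    using step.hyps by simp
  ultimately show ?case using step.IH by (simp only:)
qed

text \<open>For \<open>j = 1\<close> this is the part of the Hilbert polynomial that contains the
  constants \<open>b 1\<close>, ..., \<open>b n\<close>, up to sign. For larger \<open>j\<close> it
  is, up to an additive constant, the \<open>(j - 1)\<close>-fold backward difference of that
  part.\<close>

definition tail :: "(nat \<Rightarrow> nat) \<Rightarrow> nat \<Rightarrow> nat \<Rightarrow> real \<Rightarrow> real" where
  "tail b j n y = (\<Sum>i=j..n. (y - real (b i) + real (i - j)) gchoose Suc (i - j))"

lemma polynomial_fun_tail: "polynomial_fun (tail b j n)"
proof -
  have "polynomial_fun (\<lambda>y. \<Sum>i=j..n. (y + (real (i - j) - real (b i))) gchoose Suc (i - j))"
    by (intro polynomial_fun_sum polynomial_fun_gbinomial)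
  moreover have "tail b j n = (\<lambda>y. \<Sum>i=j..n. (y + (real (i - j) - real (b i))) gchoose Suc (i - j))"
    by (simp add: tail_def algebra_simps fun_eq_iff)
  ultimately show ?thesis by simp
qed

text \<open>Pascal's rule lowers every lower index by one. The term \<open>i = j\<close> degenerates
  to the constant 1, so a difference eliminates \<open>b j\<close> and preserves the shape of the
  rest.\<close>

lemma tail_diff:
  assumes "j \<le> n"
  shows "tail b j n y - tail b j n (y - 1) = 1 + tail b (Suc j) n y"
proof -
  have "tail b j n y - tail b j n (y - 1) =
    (\<Sum>i=j..n. ((y - real (b i) + real (i - j)) gchoose Suc (i - j)) -
      ((y - 1 - real (b i) + real (i - j)) gchoose Suc (i - j)))"
    by (simp add: tail_def sum_subtractf)
  also have "\<dots> = (\<Sum>i=j..n. (y - 1 - real (b i) + real (i - j)) gchoose (i - j))"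
  proof (rule sum.cong)
    fix i
    show "((y - real (b i) + real (i - j)) gchoose Suc (i - j)) -
      ((y - 1 - real (b i) + real (i - j)) gchoose Suc (i - j)) =
      ((y - 1 - real (b i) + real (i - j)) gchoose (i - j))"
      using gbinomial_Suc_Suc[of "y - 1 - real (b i) + real (i - j)" "i - j"] by (simp add: algebra_simps)
  qed simp
  also have "\<dots> = 1 + (\<Sum>i=Suc j..n. (y - 1 - real (b i) + real (i - j)) gchoose (i - j))"
    using assms by (simp add: sum.atLeast_Suc_atMost)
  also have "(\<Sum>i=Suc j..n. (y - 1 - real (b i) + real (i - j)) gchoose (i - j)) = tail b (Suc j) n y"
    unfolding tail_def
  proof (rule sum.cong)
    fix i assume "i \<in> {Suc j..n}"
    then obtain t where "i = Suc (j + t)" using le_iff_add[of "Suc j" i] by auto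
    moreover from this have "y - 1 - real (b i) + real (i - j) = y - real (b i) + real (i - Suc j)"
      by simp
    ultimately show "((y - 1 - real (b i) + real (i - j)) gchoose (i - j)) =
       ((y - real (b i) + real (i - Suc j)) gchoose Suc (i - Suc j))"
      by (metis Suc_diff_Suc diff_Suc_Suc less_add_Suc1)
  qed simp
  finally show ?thesis .
qed

text \<open>The hockey-stick identity evaluates each inner sum. Pascal's rule splits the boundary
  term at \<open>b j\<close>: one part cancels against the sum for smaller dimensions, the other
  becomes a term of \<open>tail\<close>.\<close>

lemma hilbert_polynomial:
  assumes "\<And>j. 1 \<le> j \<Longrightarrow> j \<le> n \<Longrightarrow> b (Suc j) \<le> b j"
  shows "(\<Sum>j=1..n. \<Sum>c=b (Suc j)..<b j. (y - real c + real (j - 1)) gchoose (j - 1)) =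
     ((y - real (b (Suc n)) + real n) gchoose n) - 1 - tail b 1 n y"
  using assms
proof (induction n)
  case 0
  then show ?case by (simp add: tail_def)
next
  case (Suc n)
  have "b (Suc (Suc n)) \<le> b (Suc n)" using Suc.prems[of "Suc n"] by simp
  from gbinomial_telescope[OF this, of y n]
  have 1: "(\<Sum>c=b (Suc (Suc n))..<b (Suc n). (y - real c + real n) gchoose n) =
    ((y - real (b (Suc (Suc n))) + real n + 1) gchoose Suc n) -
    ((y - real (b (Suc n)) + real n + 1) gchoose Suc n)" .
  have 2: "((y - real (b (Suc n)) + real n + 1) gchoose Suc n) =
     ((y - real (b (Suc n)) + real n) gchoose n) + ((y - real (b (Suc n)) + real n) gchoose Suc n)"
    by (rule gbinomial_Suc_Suc)
  have 3: "tail b 1 (Suc n) y = tail b 1 n y + ((y - real (b (Suc n)) + real n) gchoose Suc n)"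
    by (simp add: tail_def)
  have "(\<Sum>j=1..n. \<Sum>c=b (Suc j)..<b j. (y - real c + real (j - 1)) gchoose (j - 1)) =
     ((y - real (b (Suc n)) + real n) gchoose n) - 1 - tail b 1 n y"
    by (rule Suc.IH) (use Suc.prems in simp)
  with 1 2 3 show ?case by (simp add: algebra_simps)
qed

text \<open>Repeated backward differences, with Pascal's rule on the right. The summand
  \<open>- 2\<close> is lost by differencing and restored by the two constants 1 from
  \<open>tail_diff\<close>.\<close>

lemma tail_sum_identity:
  assumes "\<And>y. tail a 1 n y + tail b 1 n y =
      ((y - real d + real n) gchoose n) + ((y - real d + real (n - 1)) gchoose (n - 1)) +
      ((y + real (n - 1)) gchoose n) - 2"
    and "j + m = n" "j \<ge> 1"
  shows "tail a j n y + tail b j n y =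
      ((y - real d + real m + 1) gchoose Suc m) + ((y - real d + real m) gchoose m) +
      ((y + real m) gchoose Suc m) - 2"
  using assms(3,2)
proof (induction j arbitrary: m y rule: dec_induct)
  case base
  then show ?case using assms(1)[of y] by (cases n) (auto simp: add_ac)
next
  case (step j)
  have p: "((x + 1) gchoose Suc k) - (x gchoose Suc k) = (x gchoose k)" for x :: real and k
    by (simp add: gbinomial_Suc_Suc)
  have e1: "y - real d + real (Suc m) + 1 = (y - real d + real m + 1) + 1"
    "y - 1 - real d + real (Suc m) + 1 = y - real d + real m + 1"
    "y - real d + real (Suc m) = (y - real d + real m) + 1"
    "y - 1 - real d + real (Suc m) = y - real d + real m"
    "y + real (Suc m) = (y + real m) + 1" "y - 1 + real (Suc m) = y + real m" by simp_all
  have "(1 + tail a (Suc j) n y) + (1 + tail b (Suc j) n y) =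
     (tail a j n y + tail b j n y) - (tail a j n (y - 1) + tail b j n (y - 1))"
    using step.prems by (simp flip: tail_diff)
  also have "tail a j n y + tail b j n y =
    (((y - real d + real m + 1) + 1) gchoose Suc (Suc m)) + (((y - real d + real m) + 1) gchoose Suc m) +
    (((y + real m) + 1) gchoose Suc (Suc m)) - 2"
    using step.IH[of "Suc m" y] step.prems unfolding e1 by simp
  also have "tail a j n (y - 1) + tail b j n (y - 1) =
    ((y - real d + real m + 1) gchoose Suc (Suc m)) + ((y - real d + real m) gchoose Suc m) +
    ((y + real m) gchoose Suc (Suc m)) - 2"
    using step.IH[of "Suc m" "y - 1"] step.prems unfolding e1 by simp
  finally show ?case using p[of "y - real d + real m + 1" "Suc m"] p[of "y - real d + real m" m]
      p[of "y + real m" "Suc m"] by linarith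
qed

lemma tail_zero:
  "tail a j n 0 = (\<Sum>i=j..n. (- 1) ^ Suc (i - j) * real (a i choose Suc (i - j)))"
  unfolding tail_def
proof (rule sum.cong)
  fix i
  show "((0 - real (a i) + real (i - j)) gchoose Suc (i - j)) = (- 1) ^ Suc (i - j) * real (a i choose Suc (i - j))"
    using gbinomial_negated_upper[of "0 - real (a i) + real (i - j)" "Suc (i - j)"]
    by (simp add: binomial_gbinomial)
qed simp

text \<open>Comparison at \<open>y = 0\<close>. Index \<open>Suc N\<close> is settled first: the two
  top constants add up to \<open>d\<close>, and \<open>d \<le> a (Suc N)\<close> forces them to be
  \<open>d\<close> and 0. Their contributions move to the right side, where Pascal's rule and upper
  negation leave a binomial coefficient in \<open>d - 1\<close>.\<close>

lemma alternating_identity: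
  assumes id: "\<And>y. tail a 1 (Suc N) y + tail b 1 (Suc N) y =
      ((y - real d + real (Suc N)) gchoose (Suc N)) + ((y - real d + real N) gchoose N) +
      ((y + real N) gchoose (Suc N)) - 2"
    and ad: "d \<le> a (Suc N)" and d: "d \<ge> 1" and j: "1 \<le> j" "j \<le> N"
  shows "(\<Sum>i=j..N. (- 1) ^ Suc (i - j) * real ((a i choose Suc (i - j)) + (b i choose Suc (i - j)))) =
     2 * (- 1) ^ (Suc (N - j)) * real ((d - 1) choose (Suc (N - j))) - 2"
proof -
  have id': "tail a 1 (Suc N) y + tail b 1 (Suc N) y =
      ((y - real d + real (Suc N)) gchoose (Suc N)) + ((y - real d + real (Suc N - 1)) gchoose (Suc N - 1)) +
      ((y + real (Suc N - 1)) gchoose (Suc N)) - 2" for y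
    using id[of y] by simp
  have "tail a (Suc N) (Suc N) 0 + tail b (Suc N) (Suc N) 0 = - real d"
    using tail_sum_identity[OF id', of "Suc N" 0 0] by simp
  then have "real (a (Suc N)) + real (b (Suc N)) = real d" by (simp add: tail_def)
  then have a: "a (Suc N) = d" and b: "b (Suc N) = 0" using ad by linarith+
  define m where "m = Suc (N - j)"
  have m: "j + m = Suc N" using j by (simp add: m_def)
  have sj: "Suc N - j = m" using m by simp
  \<comment> \<open>The contribution of \<open>b (Suc N) = 0\<close> at
    \<open>y = 0\<close>.\<close>
  have m0: "(real m gchoose Suc m) = 0"
    by (metis binomial_gbinomial binomial_eq_0 lessI of_nat_0)
  have tN: "tail c j (Suc N) 0 = tail c j N 0 + ((0 - real (c (Suc N)) + real m) gchoose Suc m)" for c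
    using j by (simp add: tail_def sj del: of_nat_diff of_nat_Suc)
  have "tail a j N 0 + tail b j N 0 + ((0 - real d + real m) gchoose Suc m) =
      ((0 - real d + real m + 1) gchoose Suc m) + ((0 - real d + real m) gchoose m) - 2"
    using tail_sum_identity[OF id' m j(1), of 0] unfolding tN a b by (simp add: m0)
  then have "tail a j N 0 + tail b j N 0 = 2 * ((0 - real d + real m) gchoose m) - 2"
    using gbinomial_Suc_Suc[of "0 - real d + real m" m] by simp
  also have "((0 - real d + real m) gchoose m) = (- 1) ^ m * real ((d - 1) choose m)"
    using gbinomial_negated_upper[of "0 - real d + real m" m] d
    by (simp add: binomial_gbinomial of_nat_diff)
  finally show ?thesis by (simp add: tail_zero m_def algebra_simps flip: sum.distrib)
qed

section \<open>Convexity and superadditivity of binomial coefficients, and the recursion\<close>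

lemma binomial_convex: "t \<le> d \<Longrightarrow> 2 * (d choose k) \<le> ((d + t) choose k) + ((d - t) choose k)"
proof (induction t)
  case 0
  then show ?case by simp
next
  case (Suc t)
  then have "2 * (d choose k) \<le> ((d + t) choose k) + ((d - t) choose k)" by simp
  moreover have "((d + t) choose k) + ((d - t) choose k) \<le> ((d + Suc t) choose k) + ((d - Suc t) choose k)"
  proof (cases k)
    case (Suc l)
    have "d - t = Suc (d - Suc t)" using Suc.prems by simp
    then have "(d - t) choose k = ((d - Suc t) choose l) + ((d - Suc t) choose k)"
      by (simp add: \<open>k = Suc l\<close>)
    moreover have "(d - Suc t) choose l \<le> (d + t) choose l" by (rule binomial_right_mono) simp
    ultimately show ?thesis by (simp add: \<open>k = Suc l\<close>)
  qed simp
  ultimately show ?case by (rule order_trans)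
qed

lemma binomial_superadditive: "k \<ge> 1 \<Longrightarrow> (a choose k) + (b choose k) \<le> ((a + b) choose k)"
proof (induction b)
  case 0
  then show ?case by (cases k) auto
next
  case (Suc b)
  then obtain l where k: "k = Suc l" by (cases k) auto
  have "b choose l \<le> (a + b) choose l" by (rule binomial_right_mono) simp
  then show ?case using Suc by (simp add: k)
qed

text \<open>The alternating sum is solved for its term \<open>i = j\<close>. Terms with
  \<open>i - j\<close> even then enter with a negative sign. Among them \<open>i = j + 2\<close> is
  discarded, because its size would spoil the growth estimate; the others may be overestimated by
  positive terms.\<close>

lemma dube_recursion:
  assumes id: "\<And>j. 1 \<le> j \<Longrightarrow> j \<le> N \<Longrightarrow>
     (\<Sum>i=j..N. (- 1) ^ Suc (i - j) * real ((a i choose Suc (i - j)) + (b i choose Suc (i - j)))) =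
     2 * (- 1) ^ (Suc (N - j)) * real ((d - 1) choose (Suc (N - j))) - 2"
    and d: "d \<ge> 1" "d \<le> a N" and j: "1 \<le> j" "j < N"
  shows "a N + b N = 2 * d"
    "real (a j + b j) \<le> 2 + (\<Sum>i=Suc j..N. if i = j + 2 then 0 else real ((a i + b i) choose Suc (i - j)))"
proof -
  from id[of N] j d have "real (a N + b N) = real (2 * d)" by (simp add: of_nat_diff)
  then show N: "a N + b N = 2 * d" by linarith
  define m where "m = Suc (N - j)"
  define T where "T i = real ((a i choose Suc (i - j)) + (b i choose Suc (i - j)))" for i
  \<comment> \<open>The right side of the identity carries the sign of the term \<open>i = N\<close>
    and is absorbed into it, so that signs can be discussed term by term.\<close>
  define U where "U i = (- 1) ^ Suc (i - j) * T i -
     (if i = N then 2 * (- 1) ^ m * real ((d - 1) choose m) else 0)" for i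
  have "(\<Sum>i=j..N. (- 1) ^ Suc (i - j) * T i) = - T j + (\<Sum>i=Suc j..N. (- 1) ^ Suc (i - j) * T i)"
    using j by (simp add: sum.atLeast_Suc_atMost)
  with id[of j] j
  have "- T j + (\<Sum>i=Suc j..N. (- 1) ^ Suc (i - j) * T i) = 2 * (- 1) ^ m * real ((d - 1) choose m) - 2"
    by (simp add: T_def m_def)
  moreover have "(\<Sum>i=Suc j..N. U i) = (\<Sum>i=Suc j..N. (- 1) ^ Suc (i - j) * T i) - 2 * (- 1) ^ m * real ((d - 1) choose m)"
    using j by (simp add: U_def sum_subtractf)
  ultimately have T: "T j = 2 + (\<Sum>i=Suc j..N. U i)" by linarith
  \<comment> \<open>\<open>a N\<close> and \<open>b N\<close> lie symmetrically around
    \<open>d\<close>, so convexity bounds the sum of their binomial coefficients below by twice the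
    value at \<open>d\<close>. Hence the correction never reverses the sign of the term
    \<open>i = N\<close>.\<close>
  have TN: "2 * real ((d - 1) choose m) \<le> T N"
  proof -
    have "2 * ((d - 1) choose m) \<le> 2 * (d choose m)"
      by (simp add: binomial_right_mono)
    also have "\<dots> \<le> ((d + (a N - d)) choose m) + ((d - (a N - d)) choose m)"
      by (rule binomial_convex) (use N d in linarith)
    also have "d - (a N - d) = b N" using N d by linarith
    also have "d + (a N - d) = a N" using N d by linarith
    finally show ?thesis unfolding T_def m_def using of_nat_mono by fastforce
  qed
  have U: "U i \<le> (if i = j + 2 then 0 else real ((a i + b i) choose Suc (i - j)))" if i: "i \<in> {Suc j..N}" for i
  proof -
    have T0: "T i \<ge> 0" by (simp add: T_def)
    have Ti: "T i \<le> real ((a i + b i) choose Suc (i - j))"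
      unfolding T_def using binomial_superadditive[of "Suc (i - j)" "a i" "b i"] by (metis One_nat_def Suc_le_mono le0 of_nat_mono)
    show ?thesis
    proof (cases "even (Suc (i - j))")
      case True
      then have "i \<noteq> j + 2" by auto
      moreover have "U i \<le> T i" using True by (auto simp: U_def m_def)
      ultimately show ?thesis using Ti by simp
    next
      case False
      then have "U i \<le> 0" using T0 TN by (auto simp: U_def m_def)
      then show ?thesis by (simp add: order_trans)
    qed
  qed
  have "real (a j + b j) = T j" by (simp add: T_def)
  also have "\<dots> \<le> 2 + (\<Sum>i=Suc j..N. if i = j + 2 then 0 else real ((a i + b i) choose Suc (i - j)))"
    unfolding T using U by (intro add_left_mono sum_mono) auto
  finally show "real (a j + b j) \<le> 2 + (\<Sum>i=Suc j..N. if i = j + 2 then 0 else real ((a i + b i) choose Suc (i - j)))" .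
qed

section \<open>The numerical bound\<close>

text \<open>The reason why distant terms stay small: for \<open>i = j + s\<close>, the power
  \<open>s + 1\<close> of \<open>B i\<close> in \<open>dube_growth\<close> is compared with its
  power \<open>2 ^ (s - 1)\<close>, which equals \<open>B (Suc j)\<close>. The inequality fails for
  \<open>s = 2\<close>, hence the removal of \<open>i = j + 2\<close> from the recursion.\<close>

lemma Suc_le_two_power: "s \<ge> 3 \<Longrightarrow> Suc s \<le> 2 ^ (s - 1)"
  by (induction s rule: dec_induct) (auto simp: power_eq_if)

text \<open>The value at \<open>t = 0\<close> is 16/24, and consecutive values have the quotient
  \<open>2 / (t + 5)\<close>, which is at most 2/5.\<close>

lemma two_power_over_fact: "2 ^ (t + 4) / fact (t + 4) \<le> (2 / 3) * (2 / 5 :: real) ^ t"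
proof (induction t)
  case 0
  then show ?case by (simp add: fact_numeral)
next
  case (Suc t)
  have "(fact (Suc t + 4) :: real) = (real t + 5) * fact (t + 4)"
    using fact_Suc[of "t + 4", where 'a = real] by (simp add: algebra_simps)
  moreover have "(2::real) ^ (Suc t + 4) = 2 * 2 ^ (t + 4)" by (simp flip: power_Suc)
  ultimately have "2 ^ (Suc t + 4) / (fact (Suc t + 4) :: real) =
      (2 / (real t + 5)) * (2 ^ (t + 4) / fact (t + 4))" by simp
  also have "\<dots> \<le> (2 / 5) * ((2 / 3) * (2 / 5 :: real) ^ t)"
    by (intro mult_mono Suc) (auto simp: field_simps)
  finally show ?case by simp
qed

lemma geometric_two_fifths: "(\<Sum>t<n. (2 / 5 :: real) ^ t) \<le> 5 / 3"
proof -
  have "(\<Sum>t<n. (2 / 5 :: real) ^ t) = ((2 / 5) ^ n - 1) / (2 / 5 - 1)"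
    by (rule geometric_sum) simp
  also have "\<dots> = (1 - (2 / 5) ^ n) * (5 / 3)" by (simp add: divide_simps)
  also have "\<dots> \<le> 1 * (5 / 3)" by (intro mult_right_mono) auto
  finally show ?thesis by simp
qed

lemma choose_le_pow_fact: "real (n choose k) \<le> real n ^ k / fact k"
proof -
  have "real ((n choose k) * fact k) \<le> real (n ^ k)"
    using binomial_fact_pow of_nat_mono by blast
  then show ?thesis by (simp add: field_simps)
qed

lemma choose_two_real: "real (n choose 2) = real n * (real n - 1) / 2"
  by (induction n) (auto simp: numeral_2_eq_2 field_simps)

text \<open>The summand \<open>- 1\<close> strengthens the induction: with
  \<open>X = B (Suc j)\<close> the quadratic term is at most
  \<open>2 * X\<^sup>2 - 3 * X + 1\<close>, and the surplus \<open>- 3 * X\<close> pays for the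
  constant 2 and for all distant terms, whose sum is at most \<open>10 / 9 * X\<close>.\<close>

lemma dube_growth:
  fixes D :: "nat \<Rightarrow> nat" and d :: nat and E :: real
  defines "E \<equiv> (real d)\<^sup>2 / 2 + real d"
  assumes d: "d \<ge> 1" and DN: "D N = 2 * d"
    and rec: "\<And>j. 1 \<le> j \<Longrightarrow> j < N \<Longrightarrow>
      real (D j) \<le> 2 + (\<Sum>i=Suc j..N. if i = j + 2 then 0 else real (D i choose Suc (i - j)))"
    and "1 \<le> j" "j \<le> N"
  shows "real (D j) \<le> 2 * E ^ 2 ^ (N - j) - 1"
  using assms(5,6)
proof (induction "N - j" arbitrary: j rule: less_induct)
  case less
  have d1: "real d \<ge> 1" using d by simp
  then have d2: "(real d)\<^sup>2 \<ge> 1" by (rule one_le_power)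
  have E: "E \<ge> 3 / 2" using d1 d2 unfolding E_def by argo
  show ?case
  proof (cases "j = N")
    case True
    then show ?thesis using DN d2 by (simp add: E_def)
  next
    case False
    with less.prems have j: "1 \<le> j" "j < N" by auto
    define B where "B i = E ^ 2 ^ (N - i)" for i
    define X where "X = B (Suc j)"
    have B1: "B i \<ge> 1" for i unfolding B_def by (rule one_le_power) (use E in simp)
    have IH: "real (D i) \<le> 2 * B i - 1" if "i \<in> {Suc j..N}" for i
    proof -
      have "N - i < N - j" using that j by auto
      then show ?thesis using less.hyps[of i] that j by (simp add: B_def)
    qed
    have X1: "X \<ge> 1" using B1 X_def by simp
    have "N - j = Suc (N - Suc j)" using j by simp
    then have "B j = X ^ 2" by (simp add: B_def X_def mult.commute flip: power_mult)
    have first: "real (D (Suc j) choose 2) \<le> 2 * X\<^sup>2 - 3 * X + 1"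
    proof (cases "D (Suc j) = 0")
      case True
      have "0 \<le> (2 * X - 1) * (X - 1)" using X1 by simp
      then show ?thesis using True by (simp add: algebra_simps power2_eq_square binomial_eq_0)
    next
      case False
      have D: "real (D (Suc j)) \<le> 2 * X - 1" using IH[of "Suc j"] j by (simp add: X_def)
      have "real (D (Suc j) choose 2) = real (D (Suc j)) * (real (D (Suc j)) - 1) / 2"
        by (rule choose_two_real)
      also have "\<dots> \<le> (2 * X - 1) * (2 * X - 1 - 1) / 2"
        by (intro divide_right_mono mult_mono) (use D False X1 in auto)
      also have "\<dots> = 2 * X\<^sup>2 - 3 * X + 1" by (simp add: field_simps power2_eq_square)
      finally show ?thesis .
    qed
    have far: "real (D (j + 3 + t) choose Suc (3 + t)) \<le> X * ((2 / 3) * (2 / 5) ^ t)"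
      if t: "j + 3 + t \<le> N" for t
    proof -
      let ?i = "j + 3 + t"
      have Di: "real (D ?i) \<le> 2 * B ?i" using IH[of ?i] t by simp
      have "real (D ?i choose Suc (3 + t)) \<le> real (D ?i) ^ Suc (3 + t) / fact (Suc (3 + t))"
        by (rule choose_le_pow_fact)
      also have "\<dots> \<le> (2 * B ?i) ^ Suc (3 + t) / fact (Suc (3 + t))"
        by (intro divide_right_mono power_mono Di) auto
      also have "\<dots> = B ?i ^ Suc (3 + t) * (2 ^ (t + 4) / fact (t + 4))"
        by (simp add: power_mult_distrib add.commute numeral_eq_Suc)
      also have "\<dots> \<le> X * ((2 / 3) * (2 / 5) ^ t)"
      proof (intro mult_mono two_power_over_fact)
        have "B ?i ^ Suc (3 + t) \<le> B ?i ^ 2 ^ (3 + t - 1)"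
          by (intro power_increasing Suc_le_two_power B1) auto
        also have "\<dots> = E ^ (2 ^ (N - ?i) * 2 ^ (3 + t - 1))" by (simp add: B_def power_mult)
        also have "(2::nat) ^ (N - ?i) * 2 ^ (3 + t - 1) = 2 ^ (N - Suc j)"
          unfolding power_add[symmetric] by (rule arg_cong[of _ _ "\<lambda>k. 2 ^ k"]) (use t in simp)
        finally show "B ?i ^ Suc (3 + t) \<le> X" by (simp add: X_def B_def)
      qed (use X1 in auto)
      finally show ?thesis .
    qed
    show ?thesis
    proof (cases "N = Suc j")
      case True
      have "real (D j) \<le> 2 + real (D (Suc j) choose 2)"
        using rec[OF j] True by (simp add: numeral_2_eq_2)
      also have "\<dots> \<le> 2 * X\<^sup>2 - 1" using first E True by (simp add: X_def B_def)
      finally show ?thesis using \<open>B j = X ^ 2\<close> by (simp add: B_def)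
    next
      case False
      then have N2: "j + 2 \<le> N" using j by simp
      \<comment> \<open>With distant terms present, \<open>17 / 9 * X \<ge> 4\<close> is required.
        \<open>E \<ge> 3 / 2\<close> alone would not do, but here \<open>X\<close> is at least the
        square of \<open>E\<close>.\<close>
      have "X \<ge> E ^ 2 ^ 1" unfolding X_def B_def
        by (intro power_increasing) (use N2 E in auto)
      moreover have "E ^ 2 \<ge> (3 / 2) ^ 2" by (rule power_mono) (use E in auto)
      ultimately have X: "X \<ge> 9 / 4" by (simp add: power2_eq_square)
      have split: "{Suc j..N} = insert (Suc j) (insert (j + 2) {j + 3..N})" using N2 by auto
      have "(\<Sum>i=Suc j..N. if i = j + 2 then 0 else real (D i choose Suc (i - j))) =
        real (D (Suc j) choose 2) + (\<Sum>i=j+3..N. if i = j + 2 then 0 else real (D i choose Suc (i - j)))"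
        unfolding split by (simp add: numeral_2_eq_2)
      also have "(\<Sum>i=j+3..N. if i = j + 2 then 0 else real (D i choose Suc (i - j))) =
         (\<Sum>i=j+3..N. real (D i choose Suc (i - j)))"
        by (rule sum.cong) auto
      also have "\<dots> = (\<Sum>t<N - (j + 2). real (D (j + 3 + t) choose Suc (3 + t)))"
        by (rule sum.reindex_bij_witness[of _ "\<lambda>t. j + 3 + t" "\<lambda>i. i - (j + 3)"]) (auto simp: Suc_diff_le)
      also have "\<dots> \<le> (\<Sum>t<N - (j + 2). X * ((2 / 3) * (2 / 5) ^ t))"
        by (intro sum_mono far) auto
      also have "\<dots> = X * (2 / 3) * (\<Sum>t<N - (j + 2). (2 / 5) ^ t)"
        by (simp add: sum_distrib_left mult.assoc)
      also have "\<dots> \<le> X * (2 / 3) * (5 / 3)"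
        by (intro mult_left_mono geometric_two_fifths) (use X1 in auto)
      finally have "real (D j) \<le> 2 + ((2 * X\<^sup>2 - 3 * X + 1) + X * (2 / 3) * (5 / 3))"
        using rec[OF j] first by linarith
      also have "\<dots> \<le> 2 * X\<^sup>2 - 1" using X by simp
      finally show ?thesis using \<open>B j = X ^ 2\<close> by (simp add: B_def)
    qed
  qed
qed

section \<open>From cone families to the numerical bound\<close>

lemma cone_card_real:
  assumes "c \<le> z" "j \<ge> 1"
  shows "real (cone_card j c z) = (real z - real c + real (j - 1)) gchoose (j - 1)"
proof -
  have "z - c + j - 1 = z - c + (j - 1)" using assms by simp
  then have "real (cone_card j c z) = real ((z - c + (j - 1)) choose (j - 1))"
    using assms by (simp add: cone_card_def)
  also have "\<dots> = (real z - real c + real (j - 1)) gchoose (j - 1)"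
  proof -
    have "real (z - c + (j - 1)) = real z - real c + real (j - 1)" using assms by linarith
    then show ?thesis by (simp only: binomial_gbinomial)
  qed
  finally show ?thesis .
qed

lemma cone_sum_real:
  assumes b: "\<And>j. 1 \<le> j \<Longrightarrow> j \<le> n \<Longrightarrow> b (Suc j) \<le> b j" and z: "b 1 \<le> z"
  shows "real (\<Sum>j=1..n. \<Sum>c=b (Suc j)..<b j. cone_card j c z) =
    ((real z - real (b (Suc n)) + real n) gchoose n) - 1 - tail b 1 n (real z)"
proof -
  have le: "b j \<le> b 1" if "1 \<le> j" "j \<le> n" for j
    using decreasing_chain[of n b 1 j] b that by simp
  have "real (\<Sum>j=1..n. \<Sum>c=b (Suc j)..<b j. cone_card j c z) =
     (\<Sum>j=1..n. \<Sum>c=b (Suc j)..<b j. (real z - real c + real (j - 1)) gchoose (j - 1))"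
    unfolding of_nat_sum
  proof (intro sum.cong refl cone_card_real)
    fix j c assume "j \<in> {1..n}" "c \<in> {b (Suc j)..<b j}"
    then show "c \<le> z" "1 \<le> j" using le[of j] z by auto
  qed
  also have "\<dots> = ((real z - real (b (Suc n)) + real n) gchoose n) - 1 - tail b 1 n (real z)"
    by (rule hilbert_polynomial) (use b in auto)
  finally show ?thesis .
qed

text \<open>\<open>P\<close> stands for the cones of the generators after the first,
  \<open>Q\<close> for those of the complement of the leading monomial ideal. The homogenizing
  variable allows dimensions up to \<open>Suc N\<close>, but the constants at \<open>Suc N\<close>
  are determined outright, so the recursion begins at \<open>N\<close>.\<close>

theorem dube_bound_standard:
  assumes N: "N \<ge> 1" and d: "d \<ge> 1"
    and P: "standard d P" "\<forall>t\<in>#P. snd t \<le> Suc N"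
    and Q: "standard 0 Q" "\<forall>t\<in>#Q. snd t \<le> Suc N"
    and hilb: "\<And>z. (z + d + N) choose N = ((z + N) choose N) + hilb P (z + d) + hilb Q (z + d)"
    and t: "t \<in># Q"
  shows "real (fst t + 1) \<le> 2 * ((real d)\<^sup>2 / 2 + real d) ^ 2 ^ (N - 1)"
proof -
  let ?n = "Suc N"
  define S where "S b z = (\<Sum>j=1..?n. \<Sum>c=b (Suc j)..<b j. cone_card j c z)" for b z
  obtain a Y where a: "a (Suc ?n) = d" "\<And>j. 1 \<le> j \<Longrightarrow> j \<le> ?n \<Longrightarrow> a (Suc j) \<le> a j"
      "finite {z. Y z \<noteq> (0::nat)}" and hP: "\<And>z. hilb P z = Y z + S a z"
    using macaulay_constants[OF P] unfolding S_def by auto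
  obtain b Z where b: "b (Suc ?n) = 0" "\<And>j. 1 \<le> j \<Longrightarrow> j \<le> ?n \<Longrightarrow> b (Suc j) \<le> b j"
      "finite {z. Z z \<noteq> (0::nat)}" and hQ: "\<And>z. hilb Q z = Z z + S b z"
      and top: "\<forall>t\<in>#Q. fst t < b 1 \<or> (\<exists>a'\<ge>fst t. Z a' > 0)"
    using macaulay_constants[OF Q] unfolding S_def by blast
  have Sa: "real (S a z) = ((real z - real d + real ?n) gchoose ?n) - 1 - tail a 1 ?n (real z)"
    if "a 1 \<le> z" for z
    using cone_sum_real[of ?n a z] a that unfolding S_def by simp
  have Sb: "real (S b z) = ((real z + real ?n) gchoose ?n) - 1 - tail b 1 ?n (real z)"
    if "b 1 \<le> z" for z
    using cone_sum_real[of ?n b z] b that unfolding S_def by simp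
  have ad: "d \<le> a j" if "1 \<le> j" "j \<le> Suc ?n" for j
    using decreasing_chain[of ?n a j "Suc ?n"] a that by simp
  let ?R = "\<lambda>y. ((y - real d + real ?n) gchoose ?n) + ((y - real d + real N) gchoose N) +
      ((y + real N) gchoose ?n) - 2"
  \<comment> \<open>Beyond \<open>a 1\<close> and \<open>b 1\<close> all cones of positive dimension
    are counted by their polynomials, so the number of cones of dimension 0 is the discrepancy
    between these polynomials.\<close>
  have key: "real (Y z + Z z) = tail a 1 ?n (real z) + tail b 1 ?n (real z) - ?R (real z)"
    if z: "a 1 \<le> z" "b 1 \<le> z" for z
  proof -
    have dz: "d \<le> z" using ad[of 1] z by simp
    have "real ((z + N) choose N) = real ((z - d + N) choose N) + real (hilb P z) + real (hilb Q z)"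
      using hilb[of "z - d"] dz by simp
    moreover have "real ((z + N) choose N) = ((real z + real N) gchoose N)"
      by (simp add: binomial_gbinomial)
    moreover have "real ((z - d + N) choose N) = ((real z - real d + real N) gchoose N)"
    proof -
      have "real (z - d + N) = real z - real d + real N" using dz by linarith
      then show ?thesis by (simp only: binomial_gbinomial)
    qed
    moreover have "((real z + real ?n) gchoose ?n) = ((real z + real N) gchoose N) + ((real z + real N) gchoose ?n)"
      using gbinomial_Suc_Suc[of "real z + real N" N] by (simp add: add_ac)
    ultimately show ?thesis using Sa[OF z(1)] Sb[OF z(2)] hP[of z] hQ[of z] by simp
  qed
  obtain m where m: "\<forall>z\<in>{z. Y z \<noteq> 0} \<union> {z. Z z \<noteq> 0}. z \<le> m"
      using finite_nat_set_iff_bounded_le a(3) b(3) by (metis finite_Un)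
  have id: "tail a 1 ?n y + tail b 1 ?n y = ?R y" for y
  proof (rule polynomial_fun_eqI[where f = "\<lambda>y. tail a 1 ?n y + tail b 1 ?n y" and g = ?R])
    show "polynomial_fun (\<lambda>y. tail a 1 ?n y + tail b 1 ?n y)"
      by (intro polynomial_fun_add polynomial_fun_tail)
    have "polynomial_fun (\<lambda>y. ((y + (real ?n - real d)) gchoose ?n) + ((y + (real N - real d)) gchoose N) +
      ((y + real N) gchoose ?n) - 2)"
      by (intro polynomial_fun_add polynomial_fun_diff polynomial_fun_gbinomial polynomial_fun_const)
    then show "polynomial_fun ?R" by (simp add: algebra_simps)
    fix z assume z: "max (Suc m) (max (a 1) (b 1)) \<le> z"
    then have "Y z = 0 \<and> Z z = 0" using m by (metis (mono_tags) UnCI max.bounded_iff mem_Collect_eq not_less_eq_eq)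
    then show "tail a 1 ?n (real z) + tail b 1 ?n (real z) = ?R (real z)"
      using key[of z] z by simp
  qed
  \<comment> \<open>The polynomial identity leaves no discrepancy from
    \<open>max (a 1) (b 1)\<close> on, and \<open>Y z\<close>, \<open>Z z\<close> are natural
    numbers with sum 0.\<close>
  have zero: "Z z = 0" if "a 1 \<le> z" "b 1 \<le> z" for z
    using key[OF that] id[of "real z"] by simp
  have alt: "(\<Sum>i=j..N. (- 1) ^ Suc (i - j) * real ((a i choose Suc (i - j)) + (b i choose Suc (i - j)))) =
     2 * (- 1) ^ (Suc (N - j)) * real ((d - 1) choose (Suc (N - j))) - 2" if "1 \<le> j" "j \<le> N" for j
    by (rule alternating_identity[OF id]) (use ad[of ?n] d that in auto)
  have aN: "d \<le> a N" using ad[of N] N by simp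
  have DN: "a N + b N = 2 * d"
    using alt[of N] N d by (simp add: of_nat_diff)
  have "real (a 1 + b 1) \<le> 2 * ((real d)\<^sup>2 / 2 + real d) ^ 2 ^ (N - 1) - 1"
    by (rule dube_growth[of d "\<lambda>i. a i + b i"]) (use d DN N dube_recursion(2)[OF alt d aN] in auto)
  moreover have "fst t < a 1 + b 1"
  proof -
    consider "fst t < b 1" | a' where "a' \<ge> fst t" "Z a' > 0" using top t by auto
    then show ?thesis
    proof cases
      case 2
      then have "\<not> (a 1 \<le> a' \<and> b 1 \<le> a')" using zero by force
      then show ?thesis using 2 by linarith
    qed simp
  qed
  ultimately show ?thesis by linarith
qed

section \<open>Cone decompositions of monomial ideals\<close>

definition mons :: "'i set \<Rightarrow> ('i \<Rightarrow> nat) set" where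
  "mons V = {\<alpha>. \<forall>i. i \<notin> V \<longrightarrow> \<alpha> i = 0}"

text \<open>Forget the variable \<open>x\<close> and lift a finite dominating set of the projection
  to \<open>F0\<close>; its exponents of \<open>x\<close> are bounded by some \<open>m\<close>.
  Elements with a larger exponent of \<open>x\<close> lie above a member of \<open>F0\<close>, and
  each of the finitely many slices with exponent up to \<open>m\<close> receives a finite set of its
  own.\<close>

lemma dickson:
  assumes "finite V" "A \<subseteq> mons V"
  shows "\<exists>F. finite F \<and> F \<subseteq> A \<and> (\<forall>\<alpha>\<in>A. \<exists>g\<in>F. g \<le> \<alpha>)"
  using assms
proof (induction V arbitrary: A rule: finite_induct)
  case empty
  then have "A \<subseteq> {\<lambda>_. 0}" by (auto simp: mons_def)
  then have "finite A" by (rule finite_subset) simp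
  then show ?case by blast
next
  case (insert x V)
  define p where "p = (\<lambda>\<alpha>::'a \<Rightarrow> nat. \<alpha>(x := 0))"
  have lift: "\<exists>F. finite F \<and> F \<subseteq> B \<and> (\<forall>\<alpha>\<in>B. \<exists>g\<in>F. p g \<le> p \<alpha>)" if "B \<subseteq> A" for B
  proof -
    have "p ` B \<subseteq> mons V" using that insert.prems by (auto simp: mons_def p_def)
    from insert.IH[OF this] obtain F' where F': "finite F'" "F' \<subseteq> p ` B" "\<forall>\<alpha>\<in>p ` B. \<exists>g\<in>F'. g \<le> \<alpha>"
      by blast
    from finite_subset_image[OF F'(1,2)] obtain F where F: "F \<subseteq> B" "finite F" "F' = p ` F" by blast
    have "\<exists>g\<in>F. p g \<le> p \<alpha>" if "\<alpha> \<in> B" for \<alpha>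
      using bspec[OF F'(3) imageI[OF that]] unfolding F(3) by auto
    then show ?thesis using F by (intro exI[of _ F]) auto
  qed
  obtain F0 where F0: "finite F0" "F0 \<subseteq> A" "\<forall>\<alpha>\<in>A. \<exists>g\<in>F0. p g \<le> p \<alpha>" using lift[of A] by blast
  obtain m where m: "\<forall>g\<in>F0. g x \<le> m"
    using F0(1) finite_nat_set_iff_bounded_le[of "(\<lambda>g. g x) ` F0"] by auto
  define A' where "A' c = {\<alpha>\<in>A. \<alpha> x = c}" for c
  have "\<forall>c. \<exists>F. finite F \<and> F \<subseteq> A' c \<and> (\<forall>\<alpha>\<in>A' c. \<exists>g\<in>F. p g \<le> p \<alpha>)"
    by (intro allI lift) (simp add: A'_def)
  then have "\<exists>F. \<forall>c. finite (F c) \<and> F c \<subseteq> A' c \<and> (\<forall>\<alpha>\<in>A' c. \<exists>g\<in>F c. p g \<le> p \<alpha>)"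
    by (rule choice)
  then obtain F where F: "\<forall>c. finite (F c) \<and> F c \<subseteq> A' c \<and> (\<forall>\<alpha>\<in>A' c. \<exists>g\<in>F c. p g \<le> p \<alpha>)" ..
  have le: "g \<le> \<alpha>" if "p g \<le> p \<alpha>" "g x \<le> \<alpha> x" for g \<alpha>
    using that by (auto simp: p_def le_fun_def split: if_splits)
  define G where "G = F0 \<union> (\<Union>c\<le>m. F c)"
  have "finite G" unfolding G_def using F0(1) F by simp
  moreover have "G \<subseteq> A"
  proof
    fix g assume "g \<in> G"
    then consider "g \<in> F0" | c where "g \<in> F c" by (auto simp: G_def)
    then show "g \<in> A"
    proof cases
      case 2
      then have "g \<in> A' c" using F[rule_format, of c] by auto
      then show ?thesis by (simp add: A'_def)
    qed (use F0(2) in auto)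
  qed
  moreover have "\<exists>g\<in>G. g \<le> \<alpha>" if \<alpha>: "\<alpha> \<in> A" for \<alpha>
  proof (cases "\<alpha> x \<le> m")
    case True
    have "\<alpha> \<in> A' (\<alpha> x)" using \<alpha> by (simp add: A'_def)
    then obtain g where g: "g \<in> F (\<alpha> x)" "p g \<le> p \<alpha>" using F[rule_format, of "\<alpha> x"] by auto
    then have "g \<in> A' (\<alpha> x)" using F[rule_format, of "\<alpha> x"] by auto
    then have "g x = \<alpha> x" by (simp add: A'_def)
    then have "g \<le> \<alpha>" using le[OF g(2)] by simp
    moreover have "g \<in> G" using g(1) True unfolding G_def by auto
    ultimately show ?thesis ..
  next
    case False
    obtain g where g: "g \<in> F0" "p g \<le> p \<alpha>" using F0(3) \<alpha> by blast
    then have "g x \<le> \<alpha> x" using m False by force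
    then show ?thesis using g le unfolding G_def by auto
  qed
  ultimately show ?case by blast
qed

section \<open>Cones of monomials and their cardinalities\<close>

definition cone :: "('i \<Rightarrow> nat) \<Rightarrow> 'i set \<Rightarrow> ('i \<Rightarrow> nat) set" where
  "cone h u = {\<alpha>. h \<le> \<alpha> \<and> (\<forall>i. i \<notin> u \<longrightarrow> \<alpha> i = h i)}"

lemma cone_empty [simp]: "cone h {} = {h}"
  by (auto simp: cone_def)

lemma cone_base: "h \<in> cone h u"
  by (simp add: cone_def)

lemma cone_subset_mons: "h \<in> mons V \<Longrightarrow> u \<subseteq> V \<Longrightarrow> cone h u \<subseteq> mons V"
  by (auto simp: cone_def mons_def)

lemma cone_zero: "cone (\<lambda>_. 0) V = mons V"
  by (auto simp: cone_def mons_def le_fun_def)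

lemma cone_split:
  assumes "x \<in> u"
  shows "cone h u = cone h (u - {x}) \<union> cone (h(x := Suc (h x))) u"
    and "cone h (u - {x}) \<inter> cone (h(x := Suc (h x))) u = {}"
proof -
  have upd: "\<alpha> \<in> cone (h(x := Suc (h x))) u \<longleftrightarrow> \<alpha> \<in> cone h u \<and> \<alpha> x \<noteq> h x" for \<alpha>
  proof
    assume \<alpha>: "\<alpha> \<in> cone (h(x := Suc (h x))) u"
    then have "(h(x := Suc (h x))) i \<le> \<alpha> i" for i by (simp add: cone_def le_fun_def)
    then have "h i \<le> \<alpha> i \<and> Suc (h x) \<le> \<alpha> x" for i
      by (metis Suc_leD fun_upd_other fun_upd_same)
    then show "\<alpha> \<in> cone h u \<and> \<alpha> x \<noteq> h x"
      using \<alpha> assms by (auto simp: cone_def le_fun_def Suc_le_eq)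
  next
    assume "\<alpha> \<in> cone h u \<and> \<alpha> x \<noteq> h x"
    then show "\<alpha> \<in> cone (h(x := Suc (h x))) u"
      using assms by (auto simp: cone_def le_fun_def Suc_le_eq order_less_le)
  qed
  have diff: "\<alpha> \<in> cone h (u - {x}) \<longleftrightarrow> \<alpha> \<in> cone h u \<and> \<alpha> x = h x" for \<alpha>
    by (auto simp: cone_def)
  show "cone h (u - {x}) \<inter> cone (h(x := Suc (h x))) u = {}"
    "cone h u = cone h (u - {x}) \<union> cone (h(x := Suc (h x))) u"
    using upd diff by blast+
qed

definition size_on :: "'i set \<Rightarrow> ('i \<Rightarrow> nat) \<Rightarrow> nat" where
  "size_on V \<alpha> = (\<Sum>i\<in>V. \<alpha> i)"

lemma size_on_upd:
  "finite V \<Longrightarrow> x \<in> V \<Longrightarrow> size_on V (h(x := Suc (h x))) = Suc (size_on V h)"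
  by (simp add: size_on_def sum.remove[of V x])

lemma size_on_mono: "\<alpha> \<le> \<beta> \<Longrightarrow> size_on V \<alpha> \<le> size_on V \<beta>"
  by (simp add: size_on_def le_fun_def sum_mono)

lemma size_on_mono_strict:
  assumes "finite V" "\<alpha> \<le> \<beta>" "\<beta> \<in> mons V" "size_on V \<beta> \<le> size_on V \<alpha>"
  shows "\<alpha> = \<beta>"
proof (rule ccontr)
  assume "\<alpha> \<noteq> \<beta>"
  then obtain i where i: "\<alpha> i < \<beta> i" using assms(2) by (metis le_fun_def le_neq_implies_less ext)
  then have "i \<in> V" using assms(3) by (auto simp: mons_def)
  then have "size_on V \<alpha> < size_on V \<beta>"
    unfolding size_on_def using assms(1,2) i by (intro sum_strict_mono_ex1) (auto simp: le_fun_def)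
  then show False using assms(4) by simp
qed

lemma finite_mons_size: "finite V \<Longrightarrow> finite {\<alpha>\<in>mons V. size_on V \<alpha> \<le> z}"
proof -
  assume V: "finite V"
  have "{\<alpha>\<in>mons V. size_on V \<alpha> \<le> z} \<subseteq> {\<alpha>. \<forall>i. (i \<in> V \<longrightarrow> \<alpha> i \<in> {..z}) \<and> (i \<notin> V \<longrightarrow> \<alpha> i = 0)}"
    using V member_le_sum[of _ V] by (auto simp: mons_def size_on_def intro: order_trans)
  then show ?thesis by (rule finite_subset) (rule finite_set_of_finite_funs, use V in auto)
qed

lemma finite_cone_size:
  "finite V \<Longrightarrow> h \<in> mons V \<Longrightarrow> u \<subseteq> V \<Longrightarrow> finite {\<alpha>\<in>cone h u. size_on V \<alpha> = z}"
  using cone_subset_mons[of h V u] by (intro finite_subset[OF _ finite_mons_size[of V z]]) auto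

text \<open>\<open>cone_split\<close> on sets mirrors \<open>cone_card_Suc\<close> on numbers. The
  inner induction raises the apex until its degree exceeds \<open>z\<close>.\<close>

lemma card_cone:
  assumes V: "finite V" and "u \<subseteq> V" "h \<in> mons V"
  shows "card {\<alpha>\<in>cone h u. size_on V \<alpha> = z} = cone_card (card u) (size_on V h) z"
proof -
  have "finite u" using assms finite_subset by blast
  then show ?thesis using assms(2,3)
  proof (induction u arbitrary: h rule: finite_induct)
    case empty
    have "{\<alpha>\<in>cone h {}. size_on V \<alpha> = z} = (if z = size_on V h then {h} else {})" by auto
    then show ?case by (auto simp: cone_card_def)
  next
    case (insert x u)
    from insert.prems show ?case
    proof (induction "Suc z - size_on V h" arbitrary: h rule: less_induct)
      case less
      let ?h = "h(x := Suc (h x))"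
      have x: "x \<in> V" and u: "u \<subseteq> V" and h: "h \<in> mons V" using less.prems by auto
      have h': "?h \<in> mons V" using h x by (auto simp: mons_def)
      show ?case
      proof (cases "z < size_on V h")
        case True
        have "{\<alpha>\<in>cone h (insert x u). size_on V \<alpha> = z} = {}"
          using True size_on_mono[of h _ V] by (auto simp: cone_def) (metis leD)
        then show ?thesis using True by (simp only: card.empty) (simp add: cone_card_def)
      next
        case False
        have s: "{\<alpha>\<in>cone h (insert x u). size_on V \<alpha> = z} =
           {\<alpha>\<in>cone h u. size_on V \<alpha> = z} \<union> {\<alpha>\<in>cone ?h (insert x u). size_on V \<alpha> = z}"
          using cone_split(1)[of x "insert x u" h] insert.hyps(2) by auto
        have "card {\<alpha>\<in>cone h (insert x u). size_on V \<alpha> = z} =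
          card {\<alpha>\<in>cone h u. size_on V \<alpha> = z} + card {\<alpha>\<in>cone ?h (insert x u). size_on V \<alpha> = z}"
          unfolding s
        proof (rule card_Un_disjoint)
          show "finite {\<alpha>\<in>cone h u. size_on V \<alpha> = z}" using finite_cone_size[OF V h u] .
          show "finite {\<alpha>\<in>cone ?h (insert x u). size_on V \<alpha> = z}"
            using finite_cone_size[OF V h', of "insert x u"] x u by simp
          show "{\<alpha>\<in>cone h u. size_on V \<alpha> = z} \<inter> {\<alpha>\<in>cone ?h (insert x u). size_on V \<alpha> = z} = {}"
            using cone_split(2)[of x "insert x u" h] insert.hyps(2) by auto
        qed
        also have "card {\<alpha>\<in>cone h u. size_on V \<alpha> = z} = cone_card (card u) (size_on V h) z"
          using insert.IH[OF u h] .
        also have "card {\<alpha>\<in>cone ?h (insert x u). size_on V \<alpha> = z} =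
           cone_card (card (insert x u)) (size_on V ?h) z"
          by (rule less.hyps) (use False x u h' size_on_upd[OF V x] in auto)
        finally show ?thesis
          using insert.hyps by (simp add: size_on_upd[OF V x] cone_card_Suc[of _ "size_on V h"])
      qed
    qed
  qed
qed

text \<open>Dube's splitting procedure: a cone that meets \<open>M\<close> without having its apex
  in \<open>M\<close> is cut along a variable outside a largest set \<open>s\<close> of directions
  at \<open>h\<close> avoiding \<open>M\<close>. The third conclusion limits the dimensions of the
  pieces and the fourth gives a large enough piece in the apex degree; together they keep the union
  of both halves standard. The fifth ties minimal generators of \<open>M\<close> to degrees of
  cones.\<close>

lemma cone_decomposition:
  fixes M F :: "('i \<Rightarrow> nat) set"
  assumes V: "finite V" and F: "finite F" "\<And>\<alpha>. \<alpha> \<in> M \<Longrightarrow> \<exists>g\<in>F. g \<le> \<alpha>" "F \<subseteq> M"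
    and M: "M \<subseteq> mons V" "\<And>\<alpha> \<beta>. \<alpha> \<in> M \<Longrightarrow> \<beta> \<in> mons V \<Longrightarrow> \<alpha> \<le> \<beta> \<Longrightarrow> \<beta> \<in> M"
    and "h \<in> mons V" "u \<subseteq> V"
  shows "\<exists>P. (\<forall>z. card {\<alpha>\<in>cone h u - M. size_on V \<alpha> = z} = hilb P z) \<and>
    standard (size_on V h) P \<and>
    (\<forall>t\<in>#P. \<exists>s\<subseteq>u. card s = snd t \<and> cone h s \<inter> M = {}) \<and>
    (\<forall>s\<subseteq>u. cone h s \<inter> M = {} \<longrightarrow> (\<exists>k\<ge>card s. (size_on V h, k) \<in># P)) \<and>
    (\<forall>g\<in>cone h u \<inter> M. g \<noteq> h \<longrightarrow> (\<forall>\<beta>\<in>M. \<beta> \<le> g \<longrightarrow> \<beta> = g) \<longrightarrow>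
        (\<exists>t\<in>#P. size_on V g \<le> fst t + 1))"
    (is "\<exists>P. ?Q h u P")
proof -
  \<comment> \<open>Termination measure: the amount by which \<open>h\<close> falls short of the
    generators. Truncated subtraction ignores coordinates in which a generator is already
    reached.\<close>
  define \<mu> where "\<mu> h = (\<Sum>g\<in>F. \<Sum>i\<in>V. g i - h i)" for h
  from assms(7,8) show ?thesis
  proof (induction "card u + \<mu> h" arbitrary: h u rule: less_induct)
    case less
    note h = less.prems(1) and u = less.prems(2)
    have finu: "finite u" using u V finite_subset by blast
    have coneV: "cone h u \<subseteq> mons V" using cone_subset_mons[OF h u] .
    consider "h \<in> M" | "cone h u \<inter> M = {}" | "h \<notin> M" "cone h u \<inter> M \<noteq> {}" by blast
    then show ?case
    proof cases
      case 1
      have "cone h u \<subseteq> M" using coneV M(2)[OF 1] by (auto simp: cone_def)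
      then have e: "{\<alpha>\<in>cone h u - M. size_on V \<alpha> = z} = {}" for z by auto
      have "?Q h u {#}" unfolding e using 1 cone_base[of h] by (auto simp: standard_def cone_def)
      then show ?thesis by (rule exI[of _ "{#}"])
    next
      case 2
      then have e: "{\<alpha>\<in>cone h u - M. size_on V \<alpha> = z} = {\<alpha>\<in>cone h u. size_on V \<alpha> = z}" for z by auto
      have "?Q h u {#(size_on V h, card u)#}"
        unfolding e using 2 card_cone[OF V u h] card_mono[OF finu] by (auto simp: standard_def)
      then show ?thesis by (rule exI[of _ "{#(size_on V h, card u)#}"])
    next
      case 3
      define C where "C = {s. s \<subseteq> u \<and> cone h s \<inter> M = {}}"
      have "finite (card ` C)" using finu by (auto simp: C_def)
      moreover have "{} \<in> C" using 3 by (simp add: C_def)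
      ultimately have "Max (card ` C) \<in> card ` C" by (intro Max_in) auto
      then obtain s where s1: "s \<in> C" "card s = Max (card ` C)" by (metis imageE)
      have s: "s \<in> C" "\<And>s'. s' \<in> C \<Longrightarrow> card s' \<le> card s"
        using s1 Max_ge[OF \<open>finite (card ` C)\<close>] by auto
      then have su: "s \<subseteq> u" "cone h s \<inter> M = {}" by (auto simp: C_def)
      have "s \<noteq> u" using su(2) 3(2) by (cases "s = u") simp_all
      then obtain x where x: "x \<in> u" "x \<notin> s" using su(1) by auto
      have xV: "x \<in> V" using x u by auto
      define h1 where "h1 = h(x := Suc (h x))"
      note split = cone_split[OF x(1), of h, folded h1_def]
      have h': "h1 \<in> mons V" using h xV by (auto simp: mons_def h1_def)
      have size': "size_on V h1 = Suc (size_on V h)" unfolding h1_def by (rule size_on_upd[OF V xV])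
      have fins: "finite s" using su finu finite_subset by blast
      \<comment> \<open>By maximality of \<open>s\<close>, the direction \<open>x\<close> leads into
        \<open>M\<close>. A generator \<open>g\<close> below \<alpha> must exceed \<open>h\<close>
        at \<open>x\<close>: otherwise resetting the exponent of \<alpha> at \<open>x\<close> to
        \<open>h x\<close> would give an element of \<open>M\<close> in \<open>cone h s\<close>.
        Hence raising \<open>h\<close> at \<open>x\<close> lowers the measure.\<close>
      have "insert x s \<notin> C" using s(2)[of "insert x s"] x fins by auto
      then obtain \<alpha> where \<alpha>: "\<alpha> \<in> cone h (insert x s)" "\<alpha> \<in> M" using su x by (auto simp: C_def)
      obtain g where g: "g \<in> F" "g \<le> \<alpha>" using F(2) \<alpha>(2) by blast
      have gx: "h x < g x"
      proof (rule ccontr)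
        assume "\<not> h x < g x"
        then have "g \<le> \<alpha>(x := h x)" using g(2) by (auto simp: le_fun_def)
        moreover have "\<alpha>(x := h x) \<in> cone h s" using \<alpha>(1) by (auto simp: cone_def le_fun_def)
        moreover have "\<alpha>(x := h x) \<in> mons V" using \<alpha>(2) M(1) xV by (auto simp: mons_def)
        ultimately show False using M(2)[of g] g(1) F(3) su(2) by blast
      qed
      have "\<mu> h1 < \<mu> h"
        unfolding \<mu>_def
      proof (rule sum_strict_mono_ex1[OF F(1)])
        show "\<forall>g\<in>F. (\<Sum>i\<in>V. g i - h1 i) \<le> (\<Sum>i\<in>V. g i - h i)"
          by (intro ballI sum_mono) (auto simp: h1_def)
        have "(\<Sum>i\<in>V. g i - h1 i) < (\<Sum>i\<in>V. g i - h i)"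
          using gx xV by (intro sum_strict_mono_ex1[OF V]) (auto simp: h1_def)
        then show "\<exists>g\<in>F. (\<Sum>i\<in>V. g i - h1 i) < (\<Sum>i\<in>V. g i - h i)" using g(1) by blast
      qed
      then have "\<exists>P. ?Q h1 u P" by (intro less.hyps h' u) (simp only: add_less_cancel_left)
      then obtain P1 where P1: "?Q h1 u P1" ..
      have "card (u - {x}) < card u" by (rule card_Diff1_less[OF finu x(1)])
      then have "\<exists>P. ?Q h (u - {x}) P" by (intro less.hyps h) (use u in auto)
      then obtain P0 where P0: "?Q h (u - {x}) P0" ..
      note P0' = P0[THEN conjunct1] P0[THEN conjunct2, THEN conjunct1]
        P0[THEN conjunct2, THEN conjunct2, THEN conjunct1]
        P0[THEN conjunct2, THEN conjunct2, THEN conjunct2, THEN conjunct1]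
        P0[THEN conjunct2, THEN conjunct2, THEN conjunct2, THEN conjunct2]
      note P1' = P1[THEN conjunct1] P1[THEN conjunct2, THEN conjunct1]
        P1[THEN conjunct2, THEN conjunct2, THEN conjunct1]
        P1[THEN conjunct2, THEN conjunct2, THEN conjunct2, THEN conjunct1]
        P1[THEN conjunct2, THEN conjunct2, THEN conjunct2, THEN conjunct2]
      have sux: "s \<subseteq> u - {x}" using su x by auto
      \<comment> \<open>Raising the exponent of \<open>x\<close> does not leave \<open>M\<close>, so
        a set of directions that avoids \<open>M\<close> at \<open>h1\<close> avoids it at
        \<open>h\<close> as well.\<close>
      have down: "cone h s' \<inter> M = {}" if s': "s' \<subseteq> u" "cone h1 s' \<inter> M = {}" for s'
      proof (rule ccontr)
        assume "cone h s' \<inter> M \<noteq> {}"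
        then obtain \<beta> where \<beta>: "\<beta> \<in> cone h s'" "\<beta> \<in> M" by blast
        have "\<beta>(x := Suc (\<beta> x)) \<in> cone h1 s'" using \<beta>(1) by (auto simp: cone_def le_fun_def h1_def)
        moreover have "\<beta>(x := Suc (\<beta> x)) \<in> mons V" using \<beta>(2) M(1) xV by (auto simp: mons_def)
        moreover have "\<beta> \<le> \<beta>(x := Suc (\<beta> x))" by (auto simp: le_fun_def)
        ultimately show False using M(2)[OF \<beta>(2)] s'(2) by blast
      qed
      \<comment> \<open>\<open>s\<close> survives in the half without \<open>x\<close> and has the
        largest cardinality, so that half alone supplies a piece in the apex degree dominating every
        avoiding set.\<close>
      have top: "\<exists>k\<ge>card s'. (size_on V h, k) \<in># P0" if "s' \<subseteq> u" "cone h s' \<inter> M = {}" for s'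
      proof -
        have "\<exists>k\<ge>card s. (size_on V h, k) \<in># P0" using P0'(4) sux su(2) by simp
        then obtain k where "k \<ge> card s" "(size_on V h, k) \<in># P0" by blast
        moreover have "card s' \<le> card s" using s(2)[of s'] that by (simp add: C_def)
        ultimately show ?thesis using order_trans by blast
      qed
      have 1: "\<forall>z. card {\<alpha>\<in>cone h u - M. size_on V \<alpha> = z} = hilb (P0 + P1) z"
      proof
        fix z
        have s: "{\<alpha>\<in>cone h u - M. size_on V \<alpha> = z} =
           {\<alpha>\<in>cone h (u - {x}) - M. size_on V \<alpha> = z} \<union> {\<alpha>\<in>cone h1 u - M. size_on V \<alpha> = z}"
          using split(1) by auto
        have "card {\<alpha>\<in>cone h u - M. size_on V \<alpha> = z} =
          card {\<alpha>\<in>cone h (u - {x}) - M. size_on V \<alpha> = z} + card {\<alpha>\<in>cone h1 u - M. size_on V \<alpha> = z}"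
          unfolding s
        proof (rule card_Un_disjoint)
          show "finite {\<alpha>\<in>cone h (u - {x}) - M. size_on V \<alpha> = z}"
            using u by (intro finite_subset[OF _ finite_cone_size[OF V h, of "u - {x}" z]]) auto
          show "finite {\<alpha>\<in>cone h1 u - M. size_on V \<alpha> = z}"
            using u by (intro finite_subset[OF _ finite_cone_size[OF V h', of u z]]) auto
          show "{\<alpha>\<in>cone h (u - {x}) - M. size_on V \<alpha> = z} \<inter> {\<alpha>\<in>cone h1 u - M. size_on V \<alpha> = z} = {}"
            using split(2) by auto
        qed
        then show "card {\<alpha>\<in>cone h u - M. size_on V \<alpha> = z} = hilb (P0 + P1) z"
          using P0'(1) P1'(1) by simp
      qed
      have 2: "standard (size_on V h) (P0 + P1)"
        unfolding standard_def
      proof clarify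
        fix a k :: nat assume ak: "(a, k) \<in># P0 + P1" "0 < k"
        show "size_on V h \<le> a \<and> (\<forall>e. size_on V h \<le> e \<and> e \<le> a \<longrightarrow> (\<exists>k'\<ge>k. (e, k') \<in># P0 + P1))"
        proof (cases "(a, k) \<in># P0")
          case True
          have "standard (size_on V h) P0" using P0'(2) .
          from standardD[OF this True ak(2)] show ?thesis by auto
        next
          case False
          then have k1: "(a, k) \<in># P1" using ak by simp
          have st: "standard (Suc (size_on V h)) P1" using P1'(2) size' by simp
          have "\<exists>s\<subseteq>u. card s = snd (a, k) \<and> cone h1 s \<inter> M = {}" using bspec[OF P1'(3) k1] by simp
          then obtain s' where s': "s' \<subseteq> u" "card s' = k" "cone h1 s' \<inter> M = {}" by auto
          \<comment> \<open>The second half starts one degree higher; the degree of \<open>h\<close>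
            itself is served by the first half.\<close>
          have "\<exists>k'\<ge>k. (e, k') \<in># P0 + P1" if e: "size_on V h \<le> e" "e \<le> a" for e
          proof (cases "e = size_on V h")
            case True
            then show ?thesis using top[OF s'(1) down[OF s'(1,3)]] s'(2) by auto
          next
            case False
            then show ?thesis using standardD(2)[OF st k1 ak(2), of e] e by auto
          qed
          then show ?thesis using standardD(1)[OF st k1 ak(2)] by simp
        qed
      qed
      have 3: "\<forall>t\<in>#P0 + P1. \<exists>s\<subseteq>u. card s = snd t \<and> cone h s \<inter> M = {}"
      proof
        fix t assume t: "t \<in># P0 + P1"
        show "\<exists>s\<subseteq>u. card s = snd t \<and> cone h s \<inter> M = {}"
        proof (cases "t \<in># P0")
          case True
          then have "\<exists>s\<subseteq>u - {x}. card s = snd t \<and> cone h s \<inter> M = {}" by (rule bspec[OF P0'(3)])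
          then show ?thesis by auto
        next
          case False
          then have "\<exists>s\<subseteq>u. card s = snd t \<and> cone h1 s \<inter> M = {}" using bspec[OF P1'(3), of t] t by simp
          then show ?thesis using down by blast
        qed
      qed
      have 4: "\<forall>s\<subseteq>u. cone h s \<inter> M = {} \<longrightarrow> (\<exists>k\<ge>card s. (size_on V h, k) \<in># P0 + P1)"
      proof (intro allI impI)
        fix s' assume "s' \<subseteq> u" "cone h s' \<inter> M = {}"
        from top[OF this] obtain k where "card s' \<le> k" "(size_on V h, k) \<in># P0" by blast
        then show "\<exists>k\<ge>card s'. (size_on V h, k) \<in># P0 + P1" by auto
      qed
      have 5: "\<forall>g\<in>cone h u \<inter> M. g \<noteq> h \<longrightarrow> (\<forall>\<beta>\<in>M. \<beta> \<le> g \<longrightarrow> \<beta> = g) \<longrightarrow>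
        (\<exists>t\<in>#P0 + P1. size_on V g \<le> fst t + 1)"
      proof (intro ballI impI)
        fix g assume g: "g \<in> cone h u \<inter> M" "g \<noteq> h" "\<forall>\<beta>\<in>M. \<beta> \<le> g \<longrightarrow> \<beta> = g"
        consider "g \<in> cone h (u - {x})" | "g \<in> cone h1 u" "g \<noteq> h1" | "g = h1"
          using split(1) g(1) by blast
        then show "\<exists>t\<in>#P0 + P1. size_on V g \<le> fst t + 1"
        proof cases
          case 1
          have "\<exists>t\<in>#P0. size_on V g \<le> fst t + 1" using P0'(5) g 1 by simp
          then show ?thesis by auto
        next
          case 2
          have "\<exists>t\<in>#P1. size_on V g \<le> fst t + 1" using P1'(5) g 2 by simp
          then show ?thesis by auto
        next
          case 3
          \<comment> \<open>Source of the \<open>+ 1\<close>: \<open>h1\<close> is an apex, hence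
            excluded from the induction hypothesis of its half, but it lies one degree above
            \<open>h\<close>, where the first half has a piece because \<open>h\<close> is not in
            \<open>M\<close>.\<close>
          obtain k where "(size_on V h, k) \<in># P0" using top[of "{}"] \<open>h \<notin> M\<close> by auto
          then show ?thesis using 3 size' by (intro bexI[of _ "(size_on V h, k)"]) auto
        qed
      qed
      show ?thesis by (intro exI[of _ "P0 + P1"] conjI 1 2 3 4 5)
    qed
  qed
qed

text \<open>The procedure is started at the apex 0 with all directions free. The alternative
  \<open>g = (\<lambda>_. 0)\<close> covers the ideal of all monomials, whose complement has no
  cones.\<close>

lemma monomial_ideal_decomposition:
  fixes M :: "('i \<Rightarrow> nat) set"
  assumes V: "finite V"
    and M: "M \<subseteq> mons V" "\<And>\<alpha> \<beta>. \<alpha> \<in> M \<Longrightarrow> \<beta> \<in> mons V \<Longrightarrow> \<alpha> \<le> \<beta> \<Longrightarrow> \<beta> \<in> M"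
  obtains P where "\<And>z. card {\<alpha>\<in>mons V - M. size_on V \<alpha> = z} = hilb P z"
    "standard 0 P" "\<forall>t\<in>#P. snd t \<le> card V"
    "\<And>\<alpha>. \<alpha> \<in> M \<Longrightarrow> \<exists>g\<in>M. g \<le> \<alpha> \<and> (g = (\<lambda>_. 0) \<or> (\<exists>t\<in>#P. size_on V g \<le> fst t + 1))"
proof -
  obtain F where F: "finite F" "F \<subseteq> M" "\<forall>\<alpha>\<in>M. \<exists>g\<in>F. g \<le> \<alpha>" using dickson[OF V M(1)] by blast
  have 0: "(\<lambda>_. 0) \<in> mons V" "size_on V (\<lambda>_. 0) = 0" by (auto simp: mons_def size_on_def)
  have "\<exists>P. (\<forall>z. card {\<alpha>\<in>mons V - M. size_on V \<alpha> = z} = hilb P z) \<and>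
    standard 0 P \<and>
    (\<forall>t\<in>#P. \<exists>s\<subseteq>V. card s = snd t \<and> mons s \<inter> M = {}) \<and>
    (\<forall>s\<subseteq>V. mons s \<inter> M = {} \<longrightarrow> (\<exists>k\<ge>card s. (0, k) \<in># P)) \<and>
    (\<forall>g\<in>mons V \<inter> M. g \<noteq> (\<lambda>_. 0) \<longrightarrow> (\<forall>\<beta>\<in>M. \<beta> \<le> g \<longrightarrow> \<beta> = g) \<longrightarrow>
        (\<exists>t\<in>#P. size_on V g \<le> fst t + 1))"
    by (rule cone_decomposition[OF V F(1) bspec[OF F(3)] F(2) M(1) _ 0(1) order_refl,
          unfolded cone_zero 0(2)]) (assumption | rule M(2))+
  then obtain P where P: "\<forall>z. card {\<alpha>\<in>mons V - M. size_on V \<alpha> = z} = hilb P z"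
    "standard 0 P" "\<forall>t\<in>#P. \<exists>s\<subseteq>V. card s = snd t \<and> mons s \<inter> M = {}"
    "\<forall>g\<in>mons V \<inter> M. g \<noteq> (\<lambda>_. 0) \<longrightarrow> (\<forall>\<beta>\<in>M. \<beta> \<le> g \<longrightarrow> \<beta> = g) \<longrightarrow>
        (\<exists>t\<in>#P. size_on V g \<le> fst t + 1)"
    by (elim exE conjE)
  show ?thesis
  proof (rule that[OF spec[OF P(1)] P(2)])
    show "\<forall>t\<in>#P. snd t \<le> card V"
    proof
      fix t assume "t \<in># P"
      then obtain s where "s \<subseteq> V" "card s = snd t" using P(3) by blast
      then show "snd t \<le> card V" using card_mono[OF V, of s] by simp
    qed
    fix \<alpha> assume \<alpha>: "\<alpha> \<in> M"
    obtain g where g: "g \<in> M" "g \<le> \<alpha>" "\<And>\<beta>. \<beta> \<in> M \<and> \<beta> \<le> \<alpha> \<Longrightarrow> size_on V g \<le> size_on V \<beta>"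
      using ex_has_least_nat[of "\<lambda>g. g \<in> M \<and> g \<le> \<alpha>" \<alpha> "size_on V"] \<alpha> by auto
    have "\<beta> = g" if \<beta>: "\<beta> \<in> M" "\<beta> \<le> g" for \<beta>
    proof (rule size_on_mono_strict[OF V \<beta>(2)])
      show "g \<in> mons V" using g(1) M(1) by auto
      show "size_on V g \<le> size_on V \<beta>" using g(3)[of \<beta>] \<beta> order_trans[OF \<beta>(2) g(2)] by simp
    qed
    then have "g = (\<lambda>_. 0) \<or> (\<exists>t\<in>#P. size_on V g \<le> fst t + 1)"
      using bspec[OF P(4), of g] g(1) M(1) by auto
    then show "\<exists>g\<in>M. g \<le> \<alpha> \<and> (g = (\<lambda>_. 0) \<or> (\<exists>t\<in>#P. size_on V g \<le> fst t + 1))"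
      using g(1,2) by (intro bexI[of _ g] conjI)
  qed
qed

section \<open>Leading monomials in algebras of solvable type\<close>

abbreviation exp_add :: "(nat \<Rightarrow> nat) \<Rightarrow> (nat \<Rightarrow> nat) \<Rightarrow> nat \<Rightarrow> nat"  (infixl \<open>\<oplus>\<close> 65) where
  "\<alpha> \<oplus> \<beta> \<equiv> \<lambda>i. \<alpha> i + \<beta> i"

definition unit_exp :: "nat \<Rightarrow> nat \<Rightarrow> nat" where
  "unit_exp i = (\<lambda>k. if k = i then 1 else 0)"

lemma exps_zero: "(\<lambda>i. 0) \<in> exps N"
  by (simp add: exps_def)

lemma exps_add: "\<alpha> \<in> exps N \<Longrightarrow> \<beta> \<in> exps N \<Longrightarrow> \<alpha> \<oplus> \<beta> \<in> exps N"
  by (simp add: exps_def)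

lemma exps_unit: "i \<in> {1..N} \<Longrightarrow> unit_exp i \<in> exps N"
  by (auto simp: exps_def unit_exp_def)

lemma exps_minus: "\<alpha> \<in> exps N \<Longrightarrow> (\<lambda>i. \<alpha> i - \<beta> i) \<in> exps N"
  by (simp add: exps_def)

lemma unit_add_diff: "0 < \<alpha> i \<Longrightarrow> unit_exp i \<oplus> (\<lambda>k. \<alpha> k - unit_exp i k) = \<alpha>"
  by (auto simp: unit_exp_def)

lemma total_deg_zero: "total_deg N (\<lambda>i. 0) = 0"
  by (simp add: total_deg_def)

lemma total_deg_add: "total_deg N (\<alpha> \<oplus> \<beta>) = total_deg N \<alpha> + total_deg N \<beta>"
  by (simp add: total_deg_def sum.distrib)

lemma total_deg_unit: "i \<in> {1..N} \<Longrightarrow> total_deg N (unit_exp i) = 1"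
  by (simp add: total_deg_def unit_exp_def)

lemma finite_total_deg: "finite {\<alpha>\<in>exps N. total_deg N \<alpha> \<le> e}"
proof -
  have "{\<alpha>\<in>exps N. total_deg N \<alpha> \<le> e} \<subseteq>
      {\<alpha>. \<forall>i. (i \<in> {1..N} \<longrightarrow> \<alpha> i \<in> {..e}) \<and> (i \<notin> {1..N} \<longrightarrow> \<alpha> i = 0)}"
    using member_le_sum[of _ "{1..N}"] by (auto simp: exps_def total_deg_def intro: order_trans)
  then show ?thesis by (rule finite_subset) (rule finite_set_of_finite_funs, auto)
qed

text \<open>\<open>monom\<close> multiplies powers in increasing order of the index, so the
  generator of smallest index is the one that splits off on the left.\<close>

lemma exps_min_index:
  assumes "\<alpha> \<in> exps N" "\<alpha> \<noteq> (\<lambda>i. 0)"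
  obtains i \<beta> where "i \<in> {1..N}" "\<alpha> = unit_exp i \<oplus> \<beta>" "\<beta> \<in> exps N" "\<And>k. k < i \<Longrightarrow> \<beta> k = 0"
    "\<And>k. k < i \<Longrightarrow> \<alpha> k = 0" "0 < \<alpha> i"
proof -
  obtain j where "\<alpha> j \<noteq> 0" using assms(2) by auto
  then have pos: "\<exists>j. 0 < \<alpha> j" by auto
  define i where "i = (LEAST j. 0 < \<alpha> j)"
  have i: "0 < \<alpha> i" unfolding i_def using pos by (rule LeastI_ex)
  have below: "\<alpha> k = 0" if "k < i" for k using not_less_Least that unfolding i_def by auto
  show thesis
  proof (rule that)
    show "i \<in> {1..N}" using i assms(1) by (auto simp: exps_def)
    show "\<alpha> = unit_exp i \<oplus> (\<lambda>k. \<alpha> k - unit_exp i k)" using unit_add_diff[of \<alpha> i] i by simp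
    show "(\<lambda>k. \<alpha> k - unit_exp i k) \<in> exps N" by (rule exps_minus) (rule assms(1))
  qed (use i below in auto)
qed

context K_algebra
begin

lemma span_mult:
  assumes "f \<in> span A" "g \<in> span B" "subspace W" "\<And>a b. a \<in> A \<Longrightarrow> b \<in> B \<Longrightarrow> a * b \<in> W"
  shows "f * g \<in> W"
proof -
  have right: "a * g \<in> W" if a: "a \<in> A" for a
    using assms(2)
  proof (induction rule: span_induct_alt)
    case base
    then show ?case using subspace_0[OF assms(3)] by simp
  next
    case (step c b y)
    then show ?case using assms(3,4) a
      by (simp add: distrib_left scale_mult_right subspace_add subspace_scale)
  qed
  show ?thesis using assms(1)
  proof (induction rule: span_induct_alt)
    case base
    then show ?case using subspace_0[OF assms(3)] by simp
  next
    case (step c a y)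
    then show ?case using assms(3) right
      by (simp add: distrib_right scale_mult_left subspace_add subspace_scale)
  qed
qed

end

locale degree_compatible_algebra = quadric_solvable_algebra +
  assumes degree_compatible: "degree_compatible N ord"
begin

section \<open>The strict monomial order\<close>

definition below :: "(nat \<Rightarrow> nat) \<Rightarrow> (nat \<Rightarrow> nat) \<Rightarrow> bool"  (infix \<open>\<prec>\<close> 50) where
  "\<alpha> \<prec> \<beta> \<longleftrightarrow> \<alpha> \<in> exps N \<and> \<beta> \<in> exps N \<and> (\<alpha>, \<beta>) \<in> ord \<and> \<alpha> \<noteq> \<beta>"

lemma linear: "linear_order_on (exps N) ord"
  using monomial_ordering by (simp add: monomial_ordering_def)

lemma below_irrefl: "\<not> \<alpha> \<prec> \<alpha>"
  by (simp add: below_def)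

lemma below_trans: "\<alpha> \<prec> \<beta> \<Longrightarrow> \<beta> \<prec> \<gamma> \<Longrightarrow> \<alpha> \<prec> \<gamma>"
  using linear unfolding below_def order_on_defs by (meson antisymD transD)

lemma below_total: "\<alpha> \<in> exps N \<Longrightarrow> \<beta> \<in> exps N \<Longrightarrow> \<alpha> \<prec> \<beta> \<or> \<alpha> = \<beta> \<or> \<beta> \<prec> \<alpha>"
  using linear unfolding below_def order_on_defs total_on_def by blast

lemma below_add:
  assumes "\<alpha> \<prec> \<beta>" "\<gamma> \<in> exps N"
  shows "\<alpha> \<oplus> \<gamma> \<prec> \<beta> \<oplus> \<gamma>" "\<gamma> \<oplus> \<alpha> \<prec> \<gamma> \<oplus> \<beta>"
proof -
  have "(\<alpha> \<oplus> \<gamma>, \<beta> \<oplus> \<gamma>) \<in> ord"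
    using assms monomial_ordering unfolding below_def monomial_ordering_def by blast
  moreover have "\<alpha> \<oplus> \<gamma> \<noteq> \<beta> \<oplus> \<gamma>" using assms unfolding below_def by (auto simp: fun_eq_iff)
  ultimately show *: "\<alpha> \<oplus> \<gamma> \<prec> \<beta> \<oplus> \<gamma>" using assms exps_add unfolding below_def by blast
  then show "\<gamma> \<oplus> \<alpha> \<prec> \<gamma> \<oplus> \<beta>" by (simp add: add.commute)
qed

lemma below_unit_add: "i \<in> {1..N} \<Longrightarrow> \<beta> \<in> exps N \<Longrightarrow> \<beta> \<prec> unit_exp i \<oplus> \<beta>"
proof -
  assume i: "i \<in> {1..N}" and \<beta>: "\<beta> \<in> exps N"
  have "((\<lambda>i. 0), unit_exp i) \<in> ord"
    using monomial_ordering exps_unit[OF i] unfolding monomial_ordering_def by blast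
  moreover have "(\<lambda>i. 0) \<noteq> unit_exp i" by (simp add: unit_exp_def fun_eq_iff)
  ultimately have "(\<lambda>i. 0) \<prec> unit_exp i"
    using exps_zero exps_unit[OF i] by (simp add: below_def)
  from below_add(1)[OF this \<beta>] show ?thesis by simp
qed

lemma below_total_deg:
  assumes "\<alpha> \<prec> \<beta>"
  shows "total_deg N \<alpha> \<le> total_deg N \<beta>"
proof (rule ccontr)
  assume "\<not> ?thesis"
  then have "(\<beta>, \<alpha>) \<in> ord"
    using degree_compatible assms unfolding degree_compatible_def below_def by simp
  then have "\<beta> \<prec> \<alpha>" using assms by (auto simp: below_def)
  then show False using below_trans[OF assms] below_irrefl by blast
qed

lemma finite_below: "finite {\<alpha>. \<alpha> \<prec> \<beta>}"
  by (rule finite_subset[OF _ finite_total_deg[of N "total_deg N \<beta>"]])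
    (use below_total_deg in \<open>auto simp: below_def\<close>)

text \<open>Degree-compatibility leaves only finitely many exponents below a given one; their number
  serves as the induction measure.\<close>

lemma below_induct [consumes 1, case_names less]:
  assumes "\<gamma> \<in> exps N"
    and step: "\<And>\<gamma>. \<gamma> \<in> exps N \<Longrightarrow> (\<And>\<gamma>'. \<gamma>' \<prec> \<gamma> \<Longrightarrow> P \<gamma>') \<Longrightarrow> P \<gamma>"
  shows "P \<gamma>"
  using assms(1)
proof (induction "card {\<alpha>. \<alpha> \<prec> \<gamma>}" arbitrary: \<gamma> rule: less_induct)
  case less
  show ?case
  proof (rule step[OF less.prems])
    fix \<gamma>' assume \<gamma>': "\<gamma>' \<prec> \<gamma>"
    have "{\<alpha>. \<alpha> \<prec> \<gamma>'} \<subset> {\<alpha>. \<alpha> \<prec> \<gamma>}" using below_trans[OF _ \<gamma>'] below_irrefl \<gamma>' by auto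
    then have "card {\<alpha>. \<alpha> \<prec> \<gamma>'} < card {\<alpha>. \<alpha> \<prec> \<gamma>}" by (rule psubset_card_mono[OF finite_below])
    then show "P \<gamma>'" using less.hyps \<gamma>' by (simp add: below_def)
  qed
qed

lemma below_max:
  assumes "finite A" "A \<subseteq> exps N" "A \<noteq> {}"
  obtains \<alpha> where "\<alpha> \<in> A" "\<And>\<beta>. \<beta> \<in> A \<Longrightarrow> \<beta> \<noteq> \<alpha> \<Longrightarrow> \<beta> \<prec> \<alpha>"
proof -
  have "\<exists>\<alpha>\<in>A. \<forall>\<beta>\<in>A. \<beta> \<noteq> \<alpha> \<longrightarrow> \<beta> \<prec> \<alpha>"
    using assms(1,3,2)
  proof (induction A rule: finite_ne_induct)
    case (singleton a)
    then show ?case by simp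
  next
    case (insert a A)
    then obtain \<alpha> where \<alpha>: "\<alpha> \<in> A" "\<forall>\<beta>\<in>A. \<beta> \<noteq> \<alpha> \<longrightarrow> \<beta> \<prec> \<alpha>" by auto
    have "a \<prec> \<alpha> \<or> a = \<alpha> \<or> \<alpha> \<prec> a" using below_total insert.prems \<alpha>(1) by auto
    then show ?case
    proof (elim disjE)
      assume "\<alpha> \<prec> a"
      then have "\<beta> \<prec> a" if "\<beta> \<in> A" for \<beta>
        using \<alpha>(2) that below_trans by (cases "\<beta> = \<alpha>") auto
      then show ?case by auto
    qed (use \<alpha> in auto)
  qed
  then show thesis using that by blast
qed

section \<open>Coefficients, supports and leading monomials\<close>

lemma basis: "inj_on monom (exps N)" "independent (monom ` exps N)" "span (monom ` exps N) = UNIV"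
  using solvable_type by (auto simp: solvable_type_def monomial_basis_def)

lemma coeff_add: "coeff (f + g) \<alpha> = coeff f \<alpha> + coeff g \<alpha>"
  using basis by (simp add: coeff_def representation_add)

lemma coeff_diff: "coeff (f - g) \<alpha> = coeff f \<alpha> - coeff g \<alpha>"
  using basis by (simp add: coeff_def representation_diff)

lemma coeff_scale: "coeff (c *s f) \<alpha> = c * coeff f \<alpha>"
  using basis by (simp add: coeff_def representation_scale)

lemma coeff_zero: "coeff 0 \<alpha> = 0"
  by (simp add: coeff_def representation_zero)

lemma coeff_sum: "coeff (\<Sum>v\<in>A. h v) \<alpha> = (\<Sum>v\<in>A. coeff (h v) \<alpha>)"
  by (induction A rule: infinite_finite_induct) (auto simp: coeff_zero coeff_add)

lemma coeff_monom: "\<alpha> \<in> exps N \<Longrightarrow> \<beta> \<in> exps N \<Longrightarrow> coeff (monom \<alpha>) \<beta> = (if \<alpha> = \<beta> then 1 else 0)"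
  using basis(1,2) by (auto simp: coeff_def representation_basis inj_on_eq_iff)

lemma coeff_span:
  assumes "f \<in> span (monom ` A)" "A \<subseteq> exps N" "\<alpha> \<in> exps N" "coeff f \<alpha> \<noteq> 0"
  shows "\<alpha> \<in> A"
proof -
  have "representation (monom ` exps N) f = representation (monom ` A) f"
    by (rule representation_extend) (use basis assms in auto)
  then have "representation (monom ` A) f (monom \<alpha>) \<noteq> 0" using assms(4) by (simp add: coeff_def)
  then have "monom \<alpha> \<in> monom ` A" by (rule representation_ne_zero)
  then show ?thesis using basis(1) assms(2,3) by (auto simp: inj_on_eq_iff subset_iff)
qed

lemma supp_span: "f \<in> span (monom ` A) \<Longrightarrow> A \<subseteq> exps N \<Longrightarrow> supp f \<subseteq> A"
  using coeff_span by (auto simp: supp_def)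

lemma finite_supp: "finite (supp f)"
proof -
  have "monom ` supp f \<subseteq> {b. representation (monom ` exps N) f b \<noteq> 0}"
    by (auto simp: supp_def coeff_def)
  then have "finite (monom ` supp f)" by (rule finite_subset) (rule finite_representation)
  moreover have "inj_on monom (supp f)"
    using basis(1) by (rule inj_on_subset) (auto simp: supp_def)
  ultimately show ?thesis by (rule finite_imageD)
qed

lemma in_span_supp: "f \<in> span (monom ` supp f)"
proof -
  let ?r = "representation (monom ` exps N) f"
  have "f = (\<Sum>b | ?r b \<noteq> 0. ?r b *s b)"
    by (rule sum_nonzero_representation_eq[symmetric]) (use basis in auto)
  also have "\<dots> \<in> span (monom ` supp f)"
  proof (intro span_sum span_scale span_base)
    fix b assume b: "b \<in> {b. ?r b \<noteq> 0}"
    then have "b \<in> monom ` exps N" using representation_ne_zero by blast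
    then show "b \<in> monom ` supp f" using b by (auto simp: supp_def coeff_def)
  qed
  finally show ?thesis .
qed

lemma supp_eq_empty: "supp f = {} \<longleftrightarrow> f = 0"
proof
  assume "supp f = {}"
  then show "f = 0" using in_span_supp[of f] by simp
qed (simp add: supp_def coeff_zero)

lemma lm_props:
  assumes "f \<noteq> 0"
  shows "lm f \<in> supp f" "\<beta> \<in> supp f \<Longrightarrow> \<beta> \<noteq> lm f \<Longrightarrow> \<beta> \<prec> lm f"
proof -
  have sub: "supp f \<subseteq> exps N" by (auto simp: supp_def)
  obtain \<alpha> where \<alpha>: "\<alpha> \<in> supp f" "\<And>\<beta>. \<beta> \<in> supp f \<Longrightarrow> \<beta> \<noteq> \<alpha> \<Longrightarrow> \<beta> \<prec> \<alpha>"
    using below_max[OF finite_supp sub] assms supp_eq_empty by blast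
  have refl: "(\<alpha>, \<alpha>) \<in> ord" using linear \<alpha>(1) sub unfolding order_on_defs refl_on_def by blast
  have "lm f = \<alpha>"
    unfolding lm_def
  proof (rule the_equality)
    show "\<alpha> \<in> supp f \<and> (\<forall>\<beta>\<in>supp f. (\<beta>, \<alpha>) \<in> ord)"
      using \<alpha> refl by (metis below_def)
    fix \<gamma> assume \<gamma>: "\<gamma> \<in> supp f \<and> (\<forall>\<beta>\<in>supp f. (\<beta>, \<gamma>) \<in> ord)"
    then have "(\<alpha>, \<gamma>) \<in> ord" using \<alpha>(1) by blast
    moreover have "(\<gamma>, \<alpha>) \<in> ord" using \<alpha>(2)[of \<gamma>] \<gamma> refl by (auto simp: below_def)
    ultimately show "\<gamma> = \<alpha>" using linear unfolding order_on_defs by (meson antisymD)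
  qed
  then show "lm f \<in> supp f" "\<beta> \<in> supp f \<Longrightarrow> \<beta> \<noteq> lm f \<Longrightarrow> \<beta> \<prec> lm f" using \<alpha> by auto
qed

lemma lm_exps: "f \<noteq> 0 \<Longrightarrow> lm f \<in> exps N"
  using lm_props(1) by (auto simp: supp_def)

section \<open>Leading terms up to a nonzero scalar\<close>

definition lower :: "(nat \<Rightarrow> nat) \<Rightarrow> 'b set" where
  "lower \<gamma> = span (monom ` {\<beta>. \<beta> \<prec> \<gamma>})"

text \<open>A relation rather than the function \<open>lm\<close>: the scalar stays existentially
  quantified, as every exchange of generators multiplies it by an unknown constant, and it implies
  that \<open>f\<close> is nonzero.\<close>

definition lead :: "'b \<Rightarrow> (nat \<Rightarrow> nat) \<Rightarrow> bool" where
  "lead f \<gamma> \<longleftrightarrow> \<gamma> \<in> exps N \<and> (\<exists>c g. c \<noteq> 0 \<and> g \<in> lower \<gamma> \<and> f = c *s monom \<gamma> + g)"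

lemma subspace_lower: "subspace (lower \<gamma>)"
  by (simp add: lower_def)

lemma lower_mono: "\<alpha> \<prec> \<beta> \<Longrightarrow> lower \<alpha> \<subseteq> lower \<beta>"
  unfolding lower_def by (intro span_mono image_mono) (use below_trans in auto)

lemma monom_lower: "\<alpha> \<prec> \<beta> \<Longrightarrow> monom \<alpha> \<in> lower \<beta>"
  unfolding lower_def by (intro span_base) auto

lemma lead_lower: "lead f \<alpha> \<Longrightarrow> \<alpha> \<prec> \<beta> \<Longrightarrow> f \<in> lower \<beta>"
  unfolding lead_def using lower_mono[of \<alpha> \<beta>] monom_lower[of \<alpha> \<beta>]
  by (auto intro!: subspace_add subspace_scale subspace_lower)

lemma lead_monom: "\<gamma> \<in> exps N \<Longrightarrow> lead (monom \<gamma>) \<gamma>"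
  unfolding lead_def by (intro conjI exI[of _ 1] exI[of _ 0]) (auto simp: subspace_0[OF subspace_lower])

lemma lead_add_lower:
  assumes "lead f \<gamma>" "g \<in> lower \<gamma>" "c \<noteq> 0"
  shows "lead (c *s f + g) \<gamma>"
proof -
  obtain b h where bh: "\<gamma> \<in> exps N" "b \<noteq> 0" "h \<in> lower \<gamma>" "f = b *s monom \<gamma> + h"
    using assms(1) by (auto simp: lead_def)
  have "c *s f + g = (c * b) *s monom \<gamma> + (c *s h + g)"
    by (simp add: bh(4) scale_right_distrib add.assoc)
  moreover have "c *s h + g \<in> lower \<gamma>"
    using bh(3) assms(2) by (intro subspace_add subspace_scale subspace_lower)
  ultimately show ?thesis using bh(1,2) assms(3) unfolding lead_def by (metis mult_eq_0_iff)
qed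

lemma lead_lm:
  assumes "f \<noteq> 0"
  shows "lead f (lm f)"
proof -
  let ?c = "coeff f (lm f)"
  define g where "g = f - ?c *s monom (lm f)"
  have "supp g \<subseteq> {\<beta>. \<beta> \<prec> lm f}"
  proof
    fix \<beta> assume "\<beta> \<in> supp g"
    then have "\<beta> \<in> exps N" "coeff f \<beta> - ?c * (if lm f = \<beta> then 1 else 0) \<noteq> 0"
      using lm_exps[OF assms] by (auto simp: supp_def g_def coeff_diff coeff_scale coeff_monom)
    then have "\<beta> \<noteq> lm f" "\<beta> \<in> supp f" by (auto simp: supp_def split: if_splits)
    then show "\<beta> \<in> {\<beta>. \<beta> \<prec> lm f}" using lm_props(2)[OF assms] by simp
  qed
  then have "span (monom ` supp g) \<subseteq> lower (lm f)" unfolding lower_def by (intro span_mono image_mono)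
  then have "g \<in> lower (lm f)" using in_span_supp by blast
  moreover have "?c \<noteq> 0" using lm_props(1)[OF assms] by (simp add: supp_def)
  ultimately show ?thesis
    unfolding lead_def using lm_exps[OF assms] by (intro conjI exI[of _ ?c] exI[of _ g]) (auto simp: g_def)
qed

lemma coeff_lower: "g \<in> lower \<gamma> \<Longrightarrow> \<alpha> \<in> exps N \<Longrightarrow> coeff g \<alpha> \<noteq> 0 \<Longrightarrow> \<alpha> \<prec> \<gamma>"
  using coeff_span[of g "{\<beta>. \<beta> \<prec> \<gamma>}" \<alpha>] by (auto simp: lower_def below_def)

lemma lead_imp_lm:
  assumes "lead f \<gamma>"
  shows "f \<noteq> 0" "lm f = \<gamma>"
proof -
  obtain c g where g: "\<gamma> \<in> exps N" "c \<noteq> 0" "g \<in> lower \<gamma>" "f = c *s monom \<gamma> + g"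
    using assms by (auto simp: lead_def)
  have c: "coeff f \<alpha> = (if \<gamma> = \<alpha> then c else 0) + coeff g \<alpha>" if "\<alpha> \<in> exps N" for \<alpha>
    using that g by (simp add: coeff_add coeff_scale coeff_monom)
  have "coeff g \<gamma> = 0" using coeff_lower[OF g(3,1)] below_irrefl by blast
  then have s: "\<gamma> \<in> supp f" using c g(1,2) by (simp add: supp_def)
  then show nz: "f \<noteq> 0" using supp_eq_empty by auto
  show "lm f = \<gamma>"
  proof (rule ccontr)
    assume ne: "lm f \<noteq> \<gamma>"
    then have 1: "\<gamma> \<prec> lm f" using lm_props(2)[OF nz s] by auto
    have "coeff f (lm f) \<noteq> 0" using lm_props(1)[OF nz] by (simp add: supp_def)
    then have "coeff g (lm f) \<noteq> 0" using c[OF lm_exps[OF nz]] ne by simp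
    then have "lm f \<prec> \<gamma>" using coeff_lower[OF g(3) lm_exps[OF nz]] by simp
    then show False using 1 below_trans below_irrefl by blast
  qed
qed

section \<open>Leading exponents of products\<close>

lemma monom_zero: "monom (\<lambda>i. 0) = 1"
  unfolding monom_def by (induction "[1..<Suc N]") (auto simp: map_replicate_const)

lemma monom_unit_add:
  assumes i: "i \<in> {1..N}" and \<alpha>: "\<And>k. k < i \<Longrightarrow> \<alpha> k = 0"
  shows "monom (unit_exp i \<oplus> \<alpha>) = x i * monom \<alpha>"
proof -
  have "[1..<Suc N] = [1..<i] @ [i..<Suc N]" using i using upt_add_eq_append[of 1 i "Suc N - i"] by simp
  also have "[i..<Suc N] = i # [Suc i..<Suc N]" using i by (simp add: upt_conv_Cons)
  finally have u: "[1..<Suc N] = [1..<i] @ i # [Suc i..<Suc N]" .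
  have one: "prod_list (map (\<lambda>k. x k ^ \<beta> k) [1..<i]) = 1" if "\<And>k. k < i \<Longrightarrow> \<beta> k = 0" for \<beta>
  proof -
    have "map (\<lambda>k. x k ^ \<beta> k) [1..<i] = map (\<lambda>k. 1) [1..<i]" using that by (intro map_cong) auto
    then show ?thesis by (simp add: map_replicate_const)
  qed
  have rest: "map (\<lambda>k. x k ^ (unit_exp i k + \<alpha> k)) [Suc i..<Suc N] = map (\<lambda>k. x k ^ \<alpha> k) [Suc i..<Suc N]"
    by (intro map_cong) (auto simp: unit_exp_def)
  have "prod_list (map (\<lambda>k. x k ^ (unit_exp i k + \<alpha> k)) [1..<i]) = 1"
    by (rule one) (use \<alpha> in \<open>auto simp: unit_exp_def\<close>)
  moreover have "prod_list (map (\<lambda>k. x k ^ \<alpha> k) [1..<i]) = 1" by (rule one) (use \<alpha> in auto)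
  moreover have "x i ^ (unit_exp i i + \<alpha> i) = x i * x i ^ \<alpha> i" by (simp add: unit_exp_def)
  ultimately show ?thesis unfolding monom_def u map_append list.map prod_list.append prod_list.Cons rest
    by (simp only: mult_1_left mult.assoc)
qed

lemma commutation_lower:
  assumes "1 \<le> i" "i < j" "j \<le> N"
  obtains c p where "c \<noteq> 0" "p \<in> lower (unit_exp i \<oplus> unit_exp j)" "x j * x i = c *s (x i * x j) + p"
proof -
  let ?\<gamma> = "\<lambda>k. if k = i \<or> k = j then 1 else 0 :: nat"
  have \<gamma>: "?\<gamma> = unit_exp i \<oplus> unit_exp j" using assms by (auto simp: unit_exp_def)
  have \<gamma>e: "?\<gamma> \<in> exps N" using assms by (auto simp: exps_def)
  obtain c p where cp: "commutation i j c p" using solvable_type assms unfolding solvable_type_def by blast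
  have "p \<in> lower ?\<gamma>"
  proof (cases "p = 0")
    case True
    then show ?thesis using subspace_0[OF subspace_lower] by simp
  next
    case False
    then have "lm p \<prec> ?\<gamma>" using cp lm_exps[OF False] \<gamma>e by (auto simp: commutation_def lm_less_def below_def)
    then show ?thesis by (rule lead_lower[OF lead_lm[OF False]])
  qed
  then show thesis using that cp unfolding \<gamma> commutation_def by blast
qed

text \<open>The induction statement for products, indexed by the expected leading exponent \<gamma>,
  so that all ways of splitting a generator off \<gamma> are proved together by induction along the
  order.\<close>

definition shifts :: "(nat \<Rightarrow> nat) \<Rightarrow> bool" where
  "shifts \<gamma> \<longleftrightarrow> (\<forall>j\<in>{1..N}. \<forall>\<alpha>\<in>exps N. unit_exp j \<oplus> \<alpha> = \<gamma> \<longrightarrow> lead (x j * monom \<alpha>) \<gamma>)"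

lemma x_mult_lower:
  assumes "\<And>\<gamma>'. \<gamma>' \<prec> unit_exp j \<oplus> \<beta> \<Longrightarrow> shifts \<gamma>'" "j \<in> {1..N}" "g \<in> lower \<beta>" "\<beta> \<in> exps N"
  shows "x j * g \<in> lower (unit_exp j \<oplus> \<beta>)"
proof (rule span_mult[of "x j" "{x j}" g "monom ` {\<alpha>. \<alpha> \<prec> \<beta>}"])
  fix a b assume "a \<in> {x j}" "b \<in> monom ` {\<alpha>. \<alpha> \<prec> \<beta>}"
  then obtain \<alpha> where \<alpha>: "a = x j" "b = monom \<alpha>" "\<alpha> \<prec> \<beta>" by auto
  have "unit_exp j \<oplus> \<alpha> \<prec> unit_exp j \<oplus> \<beta>" using below_add(2)[OF \<alpha>(3) exps_unit[OF assms(2)]] .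
  moreover from this have "lead (x j * monom \<alpha>) (unit_exp j \<oplus> \<alpha>)"
    using assms(1,2) \<alpha>(3) unfolding shifts_def below_def by blast
  ultimately show "a * b \<in> lower (unit_exp j \<oplus> \<beta>)" using lead_lower \<alpha> by simp
qed (use assms in \<open>auto simp: span_base subspace_lower lower_def[symmetric]\<close>)

text \<open>The proof of \<open>shifts\<close> meets products with the remainders of commutation
  relations. Products of arbitrary monomials must therefore be controlled by the instances already
  available; the left factor is dismantled one generator at a time.\<close>

lemma monom_mult_if_shifts:
  assumes "\<delta> \<in> exps N" "\<epsilon> \<in> exps N" "shifts (\<delta> \<oplus> \<epsilon>)" "\<And>\<gamma>. \<gamma> \<prec> \<delta> \<oplus> \<epsilon> \<Longrightarrow> shifts \<gamma>"
  shows "lead (monom \<delta> * monom \<epsilon>) (\<delta> \<oplus> \<epsilon>)"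
  using assms
proof (induction "total_deg N \<delta>" arbitrary: \<delta> rule: less_induct)
  case less
  show ?case
  proof (cases "\<delta> = (\<lambda>i. 0)")
    case True
    then show ?thesis using less.prems lead_monom by (simp add: monom_zero)
  next
    case False
    obtain i \<delta>' where i: "i \<in> {1..N}" "\<delta> = unit_exp i \<oplus> \<delta>'" "\<delta>' \<in> exps N" "\<And>k. k < i \<Longrightarrow> \<delta>' k = 0"
      using exps_min_index[OF less.prems(1) False] by blast
    let ?\<beta> = "\<delta>' \<oplus> \<epsilon>"
    have \<beta>: "?\<beta> \<in> exps N" using i less.prems exps_add by blast
    have eq: "\<delta> \<oplus> \<epsilon> = unit_exp i \<oplus> ?\<beta>" by (simp add: i(2) add.assoc)
    have lt: "?\<beta> \<prec> \<delta> \<oplus> \<epsilon>" unfolding eq by (rule below_unit_add[OF i(1) \<beta>])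
    have "total_deg N \<delta>' < total_deg N \<delta>" using i(1) unfolding i(2) total_deg_add by (simp add: total_deg_unit)
    then have "lead (monom \<delta>' * monom \<epsilon>) ?\<beta>"
      by (rule less.hyps) (use i(3) less.prems(2,4) lt below_trans[OF _ lt] in auto)
    then obtain c g where cg: "c \<noteq> 0" "g \<in> lower ?\<beta>" "monom \<delta>' * monom \<epsilon> = c *s monom ?\<beta> + g"
      by (auto simp: lead_def)
    have "monom \<delta> * monom \<epsilon> = x i * (monom \<delta>' * monom \<epsilon>)"
      using monom_unit_add[of i \<delta>', OF i(1,4)] unfolding i(2) by (simp add: mult.assoc)
    also have "\<dots> = c *s (x i * monom ?\<beta>) + x i * g"
      unfolding cg(3) by (simp add: distrib_left scale_mult_right)
    finally have m: "monom \<delta> * monom \<epsilon> = c *s (x i * monom ?\<beta>) + x i * g" .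
    have "lead (x i * monom ?\<beta>) (\<delta> \<oplus> \<epsilon>)"
      using less.prems(3) i(1) \<beta> eq unfolding shifts_def by metis
    moreover have "x i * g \<in> lower (\<delta> \<oplus> \<epsilon>)"
      unfolding eq by (rule x_mult_lower) (use less.prems(4) eq i(1) cg \<beta> in auto)
    ultimately show ?thesis unfolding m using cg(1) by (intro lead_add_lower)
  qed
qed

text \<open>If an index \<open>i < j\<close> occurs in \<alpha>, the commutation relation moves
  \<open>x j\<close> past \<open>x i\<close>. In the main term \<open>x j\<close> meets a monomial
  with smaller product exponent, where the induction applies; in the remainder every product
  exponent is below \<gamma>.\<close>

lemma shifts: "\<gamma> \<in> exps N \<Longrightarrow> shifts \<gamma>"
proof (induction \<gamma> rule: below_induct)
  case (less \<gamma>)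
  show ?case
    unfolding shifts_def
  proof (intro ballI impI)
    fix j \<alpha> assume j: "j \<in> {1..N}" and \<alpha>: "\<alpha> \<in> exps N" and \<gamma>: "unit_exp j \<oplus> \<alpha> = \<gamma>"
    show "lead (x j * monom \<alpha>) \<gamma>"
    proof (cases "\<forall>k<j. \<alpha> k = 0")
      case True
      then show ?thesis using monom_unit_add[OF j, of \<alpha>] \<gamma> lead_monom[OF less(1)] by simp
    next
      case False
      then have "\<alpha> \<noteq> (\<lambda>i. 0)" by auto
      then obtain i \<beta> where i: "i \<in> {1..N}" "\<alpha> = unit_exp i \<oplus> \<beta>" "\<beta> \<in> exps N"
          "\<And>k. k < i \<Longrightarrow> \<beta> k = 0" "\<And>k. k < i \<Longrightarrow> \<alpha> k = 0" "0 < \<alpha> i"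
        using exps_min_index[OF \<alpha>] by blast
      have ij: "i < j" using False i(5) by (meson leI order_less_le_trans)
      obtain c p where cp: "c \<noteq> 0" "p \<in> lower (unit_exp i \<oplus> unit_exp j)" "x j * x i = c *s (x i * x j) + p"
        using commutation_lower[of i j] i(1) j ij by auto
      let ?\<beta> = "unit_exp j \<oplus> \<beta>"
      have \<beta>: "?\<beta> \<in> exps N" using exps_add[OF exps_unit[OF j] i(3)] .
      have eq: "\<gamma> = unit_exp i \<oplus> ?\<beta>" unfolding \<gamma>[symmetric] i(2) by (auto simp: add_ac)
      have lt: "?\<beta> \<prec> \<gamma>" unfolding eq by (rule below_unit_add[OF i(1) \<beta>])
      have "lead (x j * monom \<beta>) ?\<beta>" using less(2)[OF lt] j i(3) unfolding shifts_def by blast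
      then obtain b g where bg: "b \<noteq> 0" "g \<in> lower ?\<beta>" "x j * monom \<beta> = b *s monom ?\<beta> + g"
        by (auto simp: lead_def)
      \<comment> \<open>No index below \<open>i\<close> occurs in \<open>?\<beta>\<close>, so a
        factor \<open>x i\<close> on the left is already in normal order.\<close>
      have mi: "x i * monom ?\<beta> = monom \<gamma>"
        unfolding eq by (rule monom_unit_add[symmetric, OF i(1)]) (use i(4) ij in \<open>auto simp: unit_exp_def\<close>)
      have "x j * monom \<alpha> = (x j * x i) * monom \<beta>"
        using monom_unit_add[of i \<beta>, OF i(1,4)] unfolding i(2) by (simp add: mult.assoc)
      also have "\<dots> = c *s (x i * (x j * monom \<beta>)) + p * monom \<beta>"
        unfolding cp(3) by (simp add: distrib_right scale_mult_left mult.assoc)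
      also have "x i * (x j * monom \<beta>) = b *s monom \<gamma> + x i * g"
        unfolding bg(3) by (simp add: distrib_left scale_mult_right mi)
      finally have m: "x j * monom \<alpha> = c *s (b *s monom \<gamma> + x i * g) + p * monom \<beta>" .
      have "x i * g \<in> lower \<gamma>"
        unfolding eq by (rule x_mult_lower) (use less(2) eq i(1) bg \<beta> in auto)
      moreover have "p * monom \<beta> \<in> lower \<gamma>"
      proof (rule span_mult[of p "monom ` {\<delta>. \<delta> \<prec> unit_exp i \<oplus> unit_exp j}" "monom \<beta>" "{monom \<beta>}"])
        fix u v assume "u \<in> monom ` {\<delta>. \<delta> \<prec> unit_exp i \<oplus> unit_exp j}" "v \<in> {monom \<beta>}"
        then obtain \<delta> where \<delta>: "u = monom \<delta>" "v = monom \<beta>" "\<delta> \<prec> unit_exp i \<oplus> unit_exp j" by auto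
        have "\<delta> \<oplus> \<beta> \<prec> (unit_exp i \<oplus> unit_exp j) \<oplus> \<beta>" by (rule below_add(1)[OF \<delta>(3) i(3)])
        then have lt: "\<delta> \<oplus> \<beta> \<prec> \<gamma>" unfolding eq by (simp add: add.assoc)
        have "lead (monom \<delta> * monom \<beta>) (\<delta> \<oplus> \<beta>)"
          by (rule monom_mult_if_shifts)
            (use \<delta>(3) i(3) less(2) lt below_trans[OF _ lt] in \<open>auto simp: below_def\<close>)
        then show "u * v \<in> lower \<gamma>" using lead_lower lt \<delta> by simp
      qed (use cp(2) in \<open>auto simp: span_base subspace_lower lower_def[symmetric]\<close>)
      ultimately show ?thesis
        unfolding m using lead_monom[OF less(1)] cp(1) bg(1) by (intro lead_add_lower)
    qed
  qed
qed

lemma monom_mult: "\<alpha> \<in> exps N \<Longrightarrow> \<beta> \<in> exps N \<Longrightarrow> lead (monom \<alpha> * monom \<beta>) (\<alpha> \<oplus> \<beta>)"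
  by (rule monom_mult_if_shifts) (use exps_add shifts in \<open>auto simp: below_def\<close>)

lemma lead_mult:
  assumes "lead f \<alpha>" "lead g \<beta>"
  shows "lead (f * g) (\<alpha> \<oplus> \<beta>)"
proof -
  obtain a f' where f: "\<alpha> \<in> exps N" "a \<noteq> 0" "f' \<in> lower \<alpha>" "f = a *s monom \<alpha> + f'"
    using assms(1) by (auto simp: lead_def)
  obtain b g' where g: "\<beta> \<in> exps N" "b \<noteq> 0" "g' \<in> lower \<beta>" "g = b *s monom \<beta> + g'"
    using assms(2) by (auto simp: lead_def)
  have mono: "monom \<alpha>' * monom \<beta>' \<in> lower (\<alpha> \<oplus> \<beta>)"
    if "\<alpha>' \<in> exps N" "\<beta>' \<in> exps N" "\<alpha>' \<oplus> \<beta>' \<prec> \<alpha> \<oplus> \<beta>" for \<alpha>' \<beta>'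
    using lead_lower[OF monom_mult[OF that(1,2)] that(3)] .
  have 1: "monom \<alpha> * g' \<in> lower (\<alpha> \<oplus> \<beta>)"
  proof (rule span_mult[of "monom \<alpha>" "{monom \<alpha>}" g' "monom ` {\<beta>'. \<beta>' \<prec> \<beta>}"])
    fix u v assume "u \<in> {monom \<alpha>}" "v \<in> monom ` {\<beta>'. \<beta>' \<prec> \<beta>}"
    then show "u * v \<in> lower (\<alpha> \<oplus> \<beta>)" using mono below_add(2) f(1) by (auto simp: below_def)
  qed (use g(3) in \<open>auto simp: span_base subspace_lower lower_def[symmetric]\<close>)
  have g2: "g \<in> span (monom ` insert \<beta> {\<beta>'. \<beta>' \<prec> \<beta>})"
  proof -
    have "lower \<beta> \<subseteq> span (monom ` insert \<beta> {\<beta>'. \<beta>' \<prec> \<beta>})"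
      unfolding lower_def by (intro span_mono) auto
    then show ?thesis unfolding g(4) using g(3) by (intro span_add[OF span_scale[OF span_base]]) auto
  qed
  have 2: "f' * g \<in> lower (\<alpha> \<oplus> \<beta>)"
  proof (rule span_mult[OF _ g2])
    show "f' \<in> span (monom ` {\<alpha>'. \<alpha>' \<prec> \<alpha>})" using f(3) by (simp add: lower_def)
    fix u v assume "u \<in> monom ` {\<alpha>'. \<alpha>' \<prec> \<alpha>}" "v \<in> monom ` insert \<beta> {\<beta>'. \<beta>' \<prec> \<beta>}"
    then obtain \<alpha>' \<beta>' where uv: "u = monom \<alpha>'" "v = monom \<beta>'" "\<alpha>' \<prec> \<alpha>" "\<beta>' = \<beta> \<or> \<beta>' \<prec> \<beta>" by auto
    then have e: "\<alpha>' \<in> exps N" "\<beta>' \<in> exps N" using g(1) by (auto simp: below_def)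
    have "\<alpha>' \<oplus> \<beta>' \<prec> \<alpha> \<oplus> \<beta>'" by (rule below_add(1)[OF uv(3) e(2)])
    moreover have "\<alpha> \<oplus> \<beta>' = \<alpha> \<oplus> \<beta> \<or> \<alpha> \<oplus> \<beta>' \<prec> \<alpha> \<oplus> \<beta>" using uv(4) below_add(2)[OF _ f(1)] by auto
    ultimately have "\<alpha>' \<oplus> \<beta>' \<prec> \<alpha> \<oplus> \<beta>" using below_trans by metis
    then show "u * v \<in> lower (\<alpha> \<oplus> \<beta>)" using mono e uv by simp
  qed (rule subspace_lower)
  have "f * g = (a * b) *s (monom \<alpha> * monom \<beta>) + (a *s (monom \<alpha> * g') + f' * g)"
    unfolding f(4) g(4)
    by (simp add: distrib_left distrib_right scale_mult_left scale_mult_right scale_right_distrib add.assoc mult.commute)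
  moreover have "a *s (monom \<alpha> * g') + f' * g \<in> lower (\<alpha> \<oplus> \<beta>)"
    using 1 2 by (intro subspace_add subspace_scale subspace_lower)
  ultimately show ?thesis using lead_add_lower[OF monom_mult[OF f(1) g(1)]] f(2) g(2) by simp
qed

lemma lm_mult:
  assumes "f \<noteq> 0" "g \<noteq> 0"
  shows "f * g \<noteq> 0" "lm (f * g) = lm f \<oplus> lm g"
  using lead_imp_lm[OF lead_mult[OF lead_lm lead_lm]] assms by auto

end

section \<open>Filtrations and Hilbert functions\<close>

text \<open>Index 0 is outside \<open>{1..N}\<close> and plays the homogenizing variable. Deleting
  its exponent amounts to setting this variable to 1.\<close>

definition dehom :: "(nat \<Rightarrow> nat) \<Rightarrow> nat \<Rightarrow> nat" where
  "dehom \<gamma> = \<gamma>(0 := 0)"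

lemma dehom_exps: "\<gamma> \<in> mons {0..N} \<Longrightarrow> dehom \<gamma> \<in> exps N"
  by (auto simp: dehom_def mons_def exps_def)

lemma size_on_dehom: "size_on {0..N} \<gamma> = \<gamma> 0 + total_deg N (dehom \<gamma>)"
proof -
  have "{0..N} = insert 0 {1..N}" by auto
  moreover have "(\<Sum>i=1..N. \<gamma> i) = (\<Sum>i=1..N. dehom \<gamma> i)" by (rule sum.cong) (auto simp: dehom_def)
  ultimately show ?thesis by (simp add: size_on_def total_deg_def)
qed

lemma bij_betw_dehom:
  "bij_betw dehom {\<gamma>\<in>mons {0..N}. size_on {0..N} \<gamma> = e} {\<alpha>\<in>exps N. total_deg N \<alpha> \<le> e}"
proof (rule bij_betw_byWitness[where f' = "\<lambda>\<alpha>. \<alpha>(0 := e - total_deg N \<alpha>)"])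
  have d: "dehom (\<alpha>(0 := c)) = \<alpha>" if "\<alpha> \<in> exps N" for \<alpha> c
    using that by (auto simp: dehom_def exps_def)
  show "\<forall>\<gamma>\<in>{\<gamma>\<in>mons {0..N}. size_on {0..N} \<gamma> = e}. (dehom \<gamma>)(0 := e - total_deg N (dehom \<gamma>)) = \<gamma>"
    by (auto simp: size_on_dehom) (simp add: dehom_def)
  show "\<forall>\<alpha>\<in>{\<alpha>\<in>exps N. total_deg N \<alpha> \<le> e}. dehom (\<alpha>(0 := e - total_deg N \<alpha>)) = \<alpha>"
    using d by simp
  show "dehom ` {\<gamma>\<in>mons {0..N}. size_on {0..N} \<gamma> = e} \<subseteq> {\<alpha>\<in>exps N. total_deg N \<alpha> \<le> e}"
    using dehom_exps by (auto simp: size_on_dehom)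
  show "(\<lambda>\<alpha>. \<alpha>(0 := e - total_deg N \<alpha>)) ` {\<alpha>\<in>exps N. total_deg N \<alpha> \<le> e}
      \<subseteq> {\<gamma>\<in>mons {0..N}. size_on {0..N} \<gamma> = e}"
    using d by (auto simp: size_on_dehom) (auto simp: mons_def exps_def)
qed

lemma card_total_deg: "card {\<alpha>\<in>exps N. total_deg N \<alpha> \<le> e} = (e + N) choose N"
proof -
  have "card {\<alpha>\<in>exps N. total_deg N \<alpha> \<le> e} = card {\<gamma>\<in>cone (\<lambda>_. 0) {0..N}. size_on {0..N} \<gamma> = e}"
    using bij_betw_same_card[OF bij_betw_dehom[of N e]] by (simp add: cone_zero)
  also have "\<dots> = cone_card (Suc N) (size_on {0..N} (\<lambda>_. 0)) e"
    using card_cone[of "{0..N}" "{0..N}" "\<lambda>_. 0" e] by (simp add: mons_def)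
  finally show ?thesis by (simp add: cone_card_def size_on_def)
qed

lemma left_ideal_hull: "left_ideal (left_ideal hull S)"
  by (rule hull_in) (auto simp: left_ideal_def)

context degree_compatible_algebra
begin

section \<open>The degree filtration\<close>

definition filt :: "nat \<Rightarrow> 'b set" where
  "filt e = span (monom ` {\<alpha>\<in>exps N. total_deg N \<alpha> \<le> e})"

lemma subspace_filt: "subspace (filt e)"
  by (simp add: filt_def)

lemma monom_filt: "\<alpha> \<in> exps N \<Longrightarrow> total_deg N \<alpha> \<le> e \<Longrightarrow> monom \<alpha> \<in> filt e"
  unfolding filt_def by (intro span_base) auto

lemma filt_mono: "a \<le> b \<Longrightarrow> filt a \<subseteq> filt b"
  unfolding filt_def by (intro span_mono) auto

lemma lower_filt: "total_deg N \<gamma> \<le> e \<Longrightarrow> lower \<gamma> \<subseteq> filt e"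
  unfolding filt_def lower_def
  by (intro span_mono image_mono) (use below_total_deg in \<open>fastforce simp: below_def\<close>)

lemma lead_filt: "lead f \<gamma> \<Longrightarrow> total_deg N \<gamma> \<le> e \<Longrightarrow> f \<in> filt e"
  unfolding lead_def using lower_filt monom_filt
  by (auto intro!: subspace_add subspace_scale subspace_filt)

lemma in_filt_lm: "f \<noteq> 0 \<Longrightarrow> f \<in> filt (total_deg N (lm f))"
  using lead_filt[OF lead_lm] by simp

lemma lm_filt: "f \<in> filt e \<Longrightarrow> f \<noteq> 0 \<Longrightarrow> total_deg N (lm f) \<le> e"
  using supp_span[of f "{\<alpha>\<in>exps N. total_deg N \<alpha> \<le> e}"] lm_props(1)[of f] by (auto simp: filt_def)

lemma one_filt: "1 \<in> filt e"
  using monom_filt[OF exps_zero] by (simp add: monom_zero total_deg_zero)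

lemma filt_mult: "f \<in> filt a \<Longrightarrow> g \<in> filt b \<Longrightarrow> f * g \<in> filt (a + b)"
proof (rule span_mult[of f _ g])
  assume "f \<in> filt a" "g \<in> filt b"
  then show "f \<in> span (monom ` {\<alpha>\<in>exps N. total_deg N \<alpha> \<le> a})"
    "g \<in> span (monom ` {\<alpha>\<in>exps N. total_deg N \<alpha> \<le> b})" by (simp_all add: filt_def)
  fix u v assume "u \<in> monom ` {\<alpha>\<in>exps N. total_deg N \<alpha> \<le> a}" "v \<in> monom ` {\<alpha>\<in>exps N. total_deg N \<alpha> \<le> b}"
  then show "u * v \<in> filt (a + b)" using lead_filt[OF monom_mult] by (auto simp: total_deg_add)
qed (rule subspace_filt)

lemma filt_Union: "\<exists>e. f \<in> filt e"
proof (cases "f = 0")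
  case True
  then show ?thesis using subspace_0[OF subspace_filt] by blast
next
  case False
  then show ?thesis using in_filt_lm by blast
qed

lemma word_filt: "set w \<subseteq> {1..N} \<Longrightarrow> prod_list (map x w) \<in> filt (length w)"
proof (induction w)
  case Nil
  then show ?case using one_filt by simp
next
  case (Cons i w)
  have "x i = monom (unit_exp i)"
    using monom_unit_add[of i "\<lambda>_. 0"] Cons.prems by (simp add: monom_zero)
  then have "x i \<in> filt 1" using monom_filt[of "unit_exp i" 1] exps_unit[of i N] total_deg_unit[of i N] Cons.prems by simp
  then show ?case using filt_mult[of "x i" 1 "prod_list (map x w)" "length w"] Cons by simp
qed

lemma monom_word:
  assumes "\<alpha> \<in> exps N"
  obtains w where "set w \<subseteq> {1..N}" "length w = total_deg N \<alpha>" "monom \<alpha> = prod_list (map x w)"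
proof -
  have "\<exists>w. set w \<subseteq> {1..N} \<and> length w = total_deg N \<alpha> \<and> monom \<alpha> = prod_list (map x w)"
    using assms
  proof (induction "total_deg N \<alpha>" arbitrary: \<alpha> rule: less_induct)
    case less
    show ?case
    proof (cases "\<alpha> = (\<lambda>i. 0)")
      case True
      then show ?thesis by (intro exI[of _ "[]"]) (simp add: monom_zero total_deg_zero)
    next
      case False
      obtain i \<beta> where i: "i \<in> {1..N}" "\<alpha> = unit_exp i \<oplus> \<beta>" "\<beta> \<in> exps N" "\<And>k. k < i \<Longrightarrow> \<beta> k = 0"
        using exps_min_index[OF less.prems False] by blast
      have t: "total_deg N \<alpha> = Suc (total_deg N \<beta>)"
        unfolding i(2) total_deg_add using total_deg_unit[OF i(1)] by simp
      then obtain w where "set w \<subseteq> {1..N}" "length w = total_deg N \<beta>" "monom \<beta> = prod_list (map x w)"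
        using less.hyps[of \<beta>] i(3) by auto
      then show ?thesis
        using t i(1) monom_unit_add[of i \<beta>, OF i(1,4)] i(2) by (intro exI[of _ "i # w"]) simp
    qed
  qed
  then show thesis using that by blast
qed

text \<open>Translates \<open>deg\<close>, which is defined by words, into the filtration by ordered
  monomials. Rewriting a word never raises the degree because the ordering respects it.\<close>

lemma filt_words: "filt e = span {prod_list (map x w) |w. set w \<subseteq> {1..N} \<and> length w \<le> e}"
proof (rule equalityI)
  have "monom \<alpha> \<in> {prod_list (map x w) |w. set w \<subseteq> {1..N} \<and> length w \<le> e}"
    if \<alpha>: "\<alpha> \<in> exps N" "total_deg N \<alpha> \<le> e" for \<alpha>
  proof -
    obtain w where "set w \<subseteq> {1..N}" "length w = total_deg N \<alpha>" "monom \<alpha> = prod_list (map x w)"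
      by (rule monom_word[OF \<alpha>(1)])
    then show ?thesis using \<alpha>(2) by auto
  qed
  then show "filt e \<subseteq> span {prod_list (map x w) |w. set w \<subseteq> {1..N} \<and> length w \<le> e}"
    unfolding filt_def by (intro span_mono) auto
  have "{prod_list (map x w) |w. set w \<subseteq> {1..N} \<and> length w \<le> e} \<subseteq> filt e"
    using word_filt filt_mono by blast
  then show "span {prod_list (map x w) |w. set w \<subseteq> {1..N} \<and> length w \<le> e} \<subseteq> filt e"
    by (rule span_minimal) (rule subspace_filt)
qed

lemma deg_le_iff: "deg f \<le> e \<longleftrightarrow> f \<in> filt e"
proof
  assume "deg f \<le> e"
  moreover have "f \<in> filt (deg f)"
    unfolding deg_def filt_words[symmetric] by (rule LeastI_ex) (rule filt_Union)
  ultimately show "f \<in> filt e" using filt_mono by blast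
next
  assume "f \<in> filt e"
  then show "deg f \<le> e" unfolding deg_def filt_words[symmetric] by (rule Least_le)
qed

section \<open>Dimensions and leading monomials\<close>

definition lms :: "'b set \<Rightarrow> (nat \<Rightarrow> nat) set" where
  "lms W = lm ` (W - {0})"

lemma lms_filt: "W \<subseteq> filt e \<Longrightarrow> lms W \<subseteq> {\<alpha>\<in>exps N. total_deg N \<alpha> \<le> e}"
  using lm_exps lm_filt by (auto simp: lms_def)

text \<open>In a vanishing combination, the coefficient at the largest leading exponent involved
  comes from a single element.\<close>

lemma independent_lm:
  assumes "0 \<notin> B" "inj_on lm B"
  shows "independent B"
proof
  assume "dependent B"
  then obtain t u where t: "finite t" "t \<subseteq> B" "(\<Sum>v\<in>t. u v *s v) = 0" "\<exists>v\<in>t. u v \<noteq> 0"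
    unfolding dependent_explicit by blast
  define s where "s = {v\<in>t. u v \<noteq> 0}"
  have s: "finite s" "s \<subseteq> B" "s \<noteq> {}" using t by (auto simp: s_def)
  have "v \<noteq> 0" if "v \<in> s" for v using that s(2) assms(1) by auto
  then have "lm ` s \<subseteq> exps N" using lm_exps by auto
  then obtain \<alpha> where \<alpha>: "\<alpha> \<in> lm ` s" "\<And>\<beta>. \<beta> \<in> lm ` s \<Longrightarrow> \<beta> \<noteq> \<alpha> \<Longrightarrow> \<beta> \<prec> \<alpha>"
    using below_max[of "lm ` s"] s by auto
  obtain v where v: "v \<in> s" "\<alpha> = lm v" using \<alpha>(1) by blast
  have v0: "v \<noteq> 0" using v(1) s(2) assms(1) by auto
  have other: "coeff w \<alpha> = 0" if w: "w \<in> s" "w \<noteq> v" for w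
  proof (rule ccontr)
    assume "coeff w \<alpha> \<noteq> 0"
    then have \<alpha>w: "\<alpha> \<in> supp w" using lm_exps[OF v0] by (simp add: supp_def v(2))
    have ne: "lm w \<noteq> \<alpha>" using w v s(2) assms(2) by (metis inj_on_eq_iff subsetD)
    have "w \<noteq> 0" using w s(2) assms(1) by auto
    then have "\<alpha> \<prec> lm w" using lm_props(2) \<alpha>w ne by metis
    moreover have "lm w \<prec> \<alpha>" using \<alpha>(2) w(1) ne by auto
    ultimately show False using below_trans below_irrefl by blast
  qed
  have "0 = coeff (\<Sum>v\<in>t. u v *s v) \<alpha>" using t(3) by (simp add: coeff_zero)
  also have "\<dots> = (\<Sum>w\<in>t. u w * coeff w \<alpha>)" by (simp add: coeff_sum coeff_scale)
  also have "\<dots> = (\<Sum>w\<in>s. u w * coeff w \<alpha>)"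
    by (rule sum.mono_neutral_right) (use t(1) in \<open>auto simp: s_def\<close>)
  also have "\<dots> = u v * coeff v \<alpha>"
    using s(1) v(1) other by (subst sum.remove[of s v]) auto
  also have "\<dots> \<noteq> 0" using v lm_props(1)[OF v0] by (simp add: s_def supp_def)
  finally show False by simp
qed

lemma lm_reduce:
  assumes "f \<noteq> 0" "g \<noteq> 0" "lm f = lm g"
  obtains c where "f - c *s g = 0 \<or> lm (f - c *s g) \<prec> lm f"
proof -
  let ?c = "coeff f (lm f) / coeff g (lm f)"
  let ?h = "f - ?c *s g"
  have "coeff g (lm f) \<noteq> 0" using lm_props(1)[OF assms(2)] assms(3) by (simp add: supp_def)
  then have z: "coeff ?h (lm f) = 0" by (simp add: coeff_diff coeff_scale)
  have "lm ?h \<prec> lm f" if "?h \<noteq> 0"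
  proof -
    have h: "lm ?h \<in> exps N" "coeff ?h (lm ?h) \<noteq> 0" using lm_props(1)[OF that] by (auto simp: supp_def)
    then have "coeff f (lm ?h) \<noteq> 0 \<or> coeff g (lm ?h) \<noteq> 0" by (auto simp: coeff_diff coeff_scale)
    then have "lm ?h \<in> supp f \<or> lm ?h \<in> supp g" using h(1) by (simp add: supp_def)
    moreover have "lm ?h \<noteq> lm f" using z h(2) by metis
    ultimately show ?thesis using lm_props(2)[OF assms(1)] lm_props(2)[OF assms(2)] assms(3) by metis
  qed
  then show thesis using that by blast
qed

text \<open>One representative per leading exponent forms a basis: subtracting a multiple of the
  representative lowers the leading exponent, and induction along the order finishes.\<close>

lemma dim_eq_card_lms:
  assumes W: "subspace W" "W \<subseteq> filt e"
  shows "dim W = card (lms W)"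
proof -
  define b where "b \<alpha> = (SOME f. f \<in> W - {0} \<and> lm f = \<alpha>)" for \<alpha>
  have b: "b \<alpha> \<in> W - {0}" "lm (b \<alpha>) = \<alpha>" if "\<alpha> \<in> lms W" for \<alpha>
  proof -
    have "\<exists>f. f \<in> W - {0} \<and> lm f = \<alpha>" using that by (auto simp: lms_def)
    then have "b \<alpha> \<in> W - {0} \<and> lm (b \<alpha>) = \<alpha>" unfolding b_def by (rule someI_ex)
    then show "b \<alpha> \<in> W - {0}" "lm (b \<alpha>) = \<alpha>" by auto
  qed
  have inj: "inj_on b (lms W)" using b(2) by (metis inj_onI)
  show ?thesis
  proof (rule dim_unique)
    show "b ` lms W \<subseteq> W" using b(1) by auto
    show "independent (b ` lms W)"
      by (rule independent_lm) (use b in \<open>auto simp: inj_on_def\<close>)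
    show "card (b ` lms W) = card (lms W)" by (rule card_image[OF inj])
    have "\<forall>f\<in>W. f \<noteq> 0 \<longrightarrow> lm f = \<gamma> \<longrightarrow> f \<in> span (b ` lms W)" if "\<gamma> \<in> exps N" for \<gamma>
      using that
    proof (induction \<gamma> rule: below_induct)
      case (less \<gamma>)
      show ?case
      proof (intro ballI impI)
        fix f assume f: "f \<in> W" "f \<noteq> 0" "lm f = \<gamma>"
        then have \<gamma>: "\<gamma> \<in> lms W" by (auto simp: lms_def)
        obtain c where c: "f - c *s b \<gamma> = 0 \<or> lm (f - c *s b \<gamma>) \<prec> lm f"
          using lm_reduce[of f "b \<gamma>"] f b[OF \<gamma>] by auto
        have "f - c *s b \<gamma> \<in> W" using f(1) b(1)[OF \<gamma>] by (auto intro!: subspace_diff subspace_scale W(1))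
        then have "f - c *s b \<gamma> \<in> span (b ` lms W)"
          using c less(2) f(3) span_zero by metis
        moreover have "c *s b \<gamma> \<in> span (b ` lms W)" using \<gamma> by (intro span_scale span_base) auto
        ultimately have "(f - c *s b \<gamma>) + c *s b \<gamma> \<in> span (b ` lms W)" by (rule span_add)
        then show "f \<in> span (b ` lms W)" by simp
      qed
    qed
    note in_span = this
    show "W \<subseteq> span (b ` lms W)"
    proof
      fix f assume "f \<in> W"
      then show "f \<in> span (b ` lms W)"
        using in_span[OF lm_exps, of f] span_zero by (cases "f = 0") auto
    qed
  qed
qed

text \<open>\<open>W e\<close> stands for the degree \<open>e\<close> part of a homogeneous left ideal of the homogenization,
  with the homogenizing variable set to 1.\<close>

definition graded :: "(nat \<Rightarrow> 'b set) \<Rightarrow> bool" where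
  "graded W \<longleftrightarrow> (\<forall>e. subspace (W e) \<and> W e \<subseteq> filt e) \<and>
     (\<forall>k e. \<forall>r\<in>filt k. \<forall>w\<in>W e. r * w \<in> W (k + e))"

lemma gradedD:
  assumes "graded W"
  shows "subspace (W e)" "W e \<subseteq> filt e" "r \<in> filt k \<Longrightarrow> w \<in> W e \<Longrightarrow> r * w \<in> W (k + e)"
  using assms by (auto simp: graded_def)

text \<open>The leading monomials of the homogenization. The degree of \<gamma> selects the space in
  which \<open>dehom \<gamma>\<close> must be leading; an exponent may be absent in low degrees and
  appear only later, which the coordinate at index 0 records.\<close>

definition mono_ideal :: "(nat \<Rightarrow> 'b set) \<Rightarrow> (nat \<Rightarrow> nat) set" where
  "mono_ideal W = {\<gamma>\<in>mons {0..N}. dehom \<gamma> \<in> lms (W (size_on {0..N} \<gamma>))}"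

lemma mono_ideal_up:
  assumes W: "graded W" and \<alpha>: "\<alpha> \<in> mono_ideal W" and \<beta>: "\<beta> \<in> mons {0..N}" and le: "\<alpha> \<le> \<beta>"
  shows "\<beta> \<in> mono_ideal W"
proof -
  let ?s = "size_on {0..N}"
  define \<delta> where "\<delta> = (\<lambda>i. \<beta> i - \<alpha> i)"
  have \<beta>eq: "\<beta> = \<delta> \<oplus> \<alpha>" using le by (auto simp: \<delta>_def le_fun_def)
  have \<delta>: "\<delta> \<in> mons {0..N}" using \<beta> by (simp add: \<delta>_def mons_def)
  have s: "?s \<beta> = ?s \<delta> + ?s \<alpha>" unfolding \<beta>eq by (simp add: size_on_def sum.distrib)
  have "dehom \<alpha> \<in> lm ` (W (?s \<alpha>) - {0})" using \<alpha> by (simp add: mono_ideal_def lms_def)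
  then obtain f where "dehom \<alpha> = lm f" "f \<in> W (?s \<alpha>) - {0}" by (rule imageE)
  then have f: "f \<in> W (?s \<alpha>)" "f \<noteq> 0" "lm f = dehom \<alpha>" by auto
  have d: "dehom \<delta> \<in> exps N" using dehom_exps[OF \<delta>] .
  \<comment> \<open>The exponent of \<delta> at index 0 acts as slack in the degree bound for the
    multiplier.\<close>
  have "monom (dehom \<delta>) \<in> filt (?s \<delta>)" by (rule monom_filt[OF d]) (simp add: size_on_dehom)
  then have in_W: "monom (dehom \<delta>) * f \<in> W (?s \<beta>)" unfolding s using gradedD(3)[OF W] f(1) by blast
  have "lead (monom (dehom \<delta>) * f) (dehom \<delta> \<oplus> dehom \<alpha>)"
    using lead_mult[OF lead_monom[OF d] lead_lm[OF f(2)]] f(3) by simp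
  moreover have "dehom \<delta> \<oplus> dehom \<alpha> = dehom \<beta>" by (auto simp: dehom_def \<beta>eq)
  ultimately have "monom (dehom \<delta>) * f \<noteq> 0" "lm (monom (dehom \<delta>) * f) = dehom \<beta>"
    using lead_imp_lm by auto
  then show ?thesis using in_W \<beta> by (auto simp: mono_ideal_def lms_def image_iff intro!: bexI[of _ "monom (dehom \<delta>) * f"])
qed

lemma card_mono_ideal_compl:
  "card {\<gamma>\<in>mons {0..N} - mono_ideal W. size_on {0..N} \<gamma> = e} =
     card ({\<alpha>\<in>exps N. total_deg N \<alpha> \<le> e} - lms (W e))"
proof -
  have "bij_betw dehom {\<gamma>\<in>mons {0..N} - mono_ideal W. size_on {0..N} \<gamma> = e}
     ({\<alpha>\<in>exps N. total_deg N \<alpha> \<le> e} - lms (W e))"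
  proof (rule bij_betw_subset[OF bij_betw_dehom[of N e]])
    show "dehom ` {\<gamma>\<in>mons {0..N} - mono_ideal W. size_on {0..N} \<gamma> = e} =
       {\<alpha>\<in>exps N. total_deg N \<alpha> \<le> e} - lms (W e)" (is "dehom ` ?A = _")
    proof -
      have "?A = {\<gamma>\<in>{\<gamma>\<in>mons {0..N}. size_on {0..N} \<gamma> = e}. dehom \<gamma> \<notin> lms (W e)}"
        by (auto simp: mono_ideal_def)
      then have "dehom ` ?A = dehom ` {\<gamma>\<in>mons {0..N}. size_on {0..N} \<gamma> = e} - lms (W e)" by auto
      then show ?thesis using bij_betw_dehom[of N e] by (simp add: bij_betw_def)
    qed
  qed auto
  then show ?thesis by (rule bij_betw_same_card)
qed

lemma subspace_adjoin:
  assumes W: "subspace W"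
  shows "subspace {w + r * f |w r. w \<in> W \<and> r \<in> filt e}"
  unfolding subspace_def
proof (intro conjI ballI allI)
  show "0 \<in> {w + r * f |w r. w \<in> W \<and> r \<in> filt e}"
    using subspace_0[OF W] subspace_0[OF subspace_filt]
    by (intro CollectI exI[of _ 0]) auto
  fix u v assume "u \<in> {w + r * f |w r. w \<in> W \<and> r \<in> filt e}" "v \<in> {w + r * f |w r. w \<in> W \<and> r \<in> filt e}"
  then obtain w1 r1 w2 r2 where "u = w1 + r1 * f" "v = w2 + r2 * f" "w1 \<in> W" "w2 \<in> W" "r1 \<in> filt e" "r2 \<in> filt e"
    by blast
  then show "u + v \<in> {w + r * f |w r. w \<in> W \<and> r \<in> filt e}"
    using subspace_add[OF W] subspace_add[OF subspace_filt]
    by (intro CollectI exI[of _ "w1 + w2"] exI[of _ "r1 + r2"]) (auto simp: distrib_right)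
next
  fix c u assume "u \<in> {w + r * f |w r. w \<in> W \<and> r \<in> filt e}"
  then obtain w r where "u = w + r * f" "w \<in> W" "r \<in> filt e" by blast
  then show "c *s u \<in> {w + r * f |w r. w \<in> W \<and> r \<in> filt e}"
    using subspace_scale[OF W] subspace_scale[OF subspace_filt]
    by (intro CollectI exI[of _ "c *s w"] exI[of _ "c *s r"]) (auto simp: scale_right_distrib scale_mult_left)
qed

text \<open>Adjoining \<open>f\<close> adds the multiples \<open>r * f\<close> of the normal forms \<open>r\<close> modulo the
  colon ideal \<open>J\<close>, without further relations.\<close>

lemma dim_adjoin:
  fixes f :: 'b
  assumes W: "subspace W" and WF: "W \<subseteq> filt e'"
    and J: "J = {r\<in>filt e. r * f \<in> W}" and W': "W' = {w + r * f |w r. w \<in> W \<and> r \<in> filt e}"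
  shows "dim W' = dim W + card ({\<alpha>\<in>exps N. total_deg N \<alpha> \<le> e} - lms J)"
proof -
  let ?T = "{\<alpha>\<in>exps N. total_deg N \<alpha> \<le> e}"
  obtain B where B: "B \<subseteq> W" "independent B" "W \<subseteq> span B" "card B = dim W" by (rule basis_exists)
  have spB: "span B = W" using B(1,3) span_minimal[OF B(1) W] by auto
  have finB: "finite B"
  proof -
    have "B \<subseteq> span (monom ` {\<alpha>\<in>exps N. total_deg N \<alpha> \<le> e'})" using B(1) WF by (auto simp: filt_def)
    from independent_span_bound[OF finite_imageI[OF finite_total_deg] B(2) this] show ?thesis by simp
  qed
  have J_nz: "r \<notin> J" if "r \<noteq> 0" "r \<in> span (monom ` A)" "A \<subseteq> ?T - lms J" for r A
  proof
    assume "r \<in> J"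
    then have "lm r \<in> lms J" using that(1) by (auto simp: lms_def)
    moreover have "lm r \<in> A" using supp_span[OF that(2)] that(3) lm_props(1)[OF that(1)] by auto
    ultimately show False using that(3) by auto
  qed
  have times_span: "v \<in> (\<lambda>r. r * f) ` span (monom ` A)" if "v \<in> span ((\<lambda>\<alpha>. monom \<alpha> * f) ` A)" for v A
    using that
  proof (induction rule: span_induct_alt)
    case base
    show ?case using span_zero by (intro image_eqI[of _ _ 0]) auto
  next
    case (step c y z)
    then obtain \<alpha> r where "\<alpha> \<in> A" "y = monom \<alpha> * f" "r \<in> span (monom ` A)" "z = r * f" by auto
    moreover from this have "c *s monom \<alpha> + r \<in> span (monom ` A)"
      using span_add[OF span_scale[OF span_base[of "monom \<alpha>" "monom ` A"]]] by blast
    ultimately show ?case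
      by (intro image_eqI[of _ _ "c *s monom \<alpha> + r"]) (simp_all add: distrib_right scale_mult_left)
  qed
  have indep: "independent (B \<union> (\<lambda>\<alpha>. monom \<alpha> * f) ` A) \<and> card (B \<union> (\<lambda>\<alpha>. monom \<alpha> * f) ` A) = card B + card A"
    if "finite A" "A \<subseteq> ?T - lms J" for A
    using that
  proof (induction A rule: finite_induct)
    case empty
    then show ?case using B(2) by simp
  next
    case (insert \<alpha> A)
    let ?C = "B \<union> (\<lambda>\<alpha>. monom \<alpha> * f) ` A"
    have IH: "independent ?C" "card ?C = card B + card A" using insert by auto
    have \<alpha>: "\<alpha> \<in> exps N" "total_deg N \<alpha> \<le> e" "\<alpha> \<notin> lms J" using insert.prems by auto
    \<comment> \<open>A dependence would put a nonzero element into \<open>J\<close> whose exponents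
      stay in \<open>insert \<alpha> A\<close>, a set from which the leading exponents of
      \<open>J\<close> were removed.\<close>
    have notin: "monom \<alpha> * f \<notin> span ?C"
    proof
      assume "monom \<alpha> * f \<in> span ?C"
      then obtain w v where wv: "monom \<alpha> * f = w + v" "w \<in> span B" "v \<in> span ((\<lambda>\<alpha>. monom \<alpha> * f) ` A)"
        by (auto simp: span_Un)
      obtain s where s: "s \<in> span (monom ` A)" "v = s * f" using times_span[OF wv(3)] by auto
      let ?r = "monom \<alpha> - s"
      have r1: "?r \<in> span (monom ` insert \<alpha> A)"
      proof -
        have "span (monom ` A) \<subseteq> span (monom ` insert \<alpha> A)" by (intro span_mono) auto
        moreover have "monom \<alpha> \<in> span (monom ` insert \<alpha> A)" by (rule span_base) simp
        ultimately show ?thesis using s(1) span_diff by blast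
      qed
      have r2: "?r * f \<in> W" using wv s spB by (simp add: left_diff_distrib)
      have r3: "?r \<in> filt e"
      proof -
        have "span (monom ` A) \<subseteq> filt e" unfolding filt_def using insert.prems by (intro span_mono) auto
        then show ?thesis using s(1) monom_filt[OF \<alpha>(1,2)] by (intro subspace_diff subspace_filt) auto
      qed
      have r4: "?r \<noteq> 0"
      proof
        assume "?r = 0"
        then have "coeff s \<alpha> \<noteq> 0" using coeff_monom[OF \<alpha>(1,1)] by simp
        moreover have "A \<subseteq> exps N" using insert.prems by auto
        ultimately have "\<alpha> \<in> A" using coeff_span[of s A \<alpha>] s(1) \<alpha>(1) by simp
        then show False using insert.hyps by simp
      qed
      have "?r \<in> J" unfolding J using r2 r3 by simp
      then show False using J_nz[OF r4 r1 insert.prems] by simp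
    qed
    have new: "monom \<alpha> * f \<notin> ?C" using notin span_base[of "monom \<alpha> * f" ?C] by blast
    have eq: "B \<union> (\<lambda>\<alpha>. monom \<alpha> * f) ` insert \<alpha> A = insert (monom \<alpha> * f) ?C" by simp
    have "finite ?C" using finB insert.hyps by simp
    then have "card (insert (monom \<alpha> * f) ?C) = Suc (card ?C)" using new by (rule card_insert_disjoint)
    then show ?case
      unfolding eq using independent_insertI[OF notin IH(1)] IH(2) insert.hyps by simp
  qed
  define A where "A = ?T - lms J"
  have finA: "finite A" unfolding A_def using finite_total_deg by auto
  let ?C = "B \<union> (\<lambda>\<alpha>. monom \<alpha> * f) ` A"
  have C: "independent ?C" "card ?C = card B + card A" using indep[OF finA] by (auto simp: A_def)
  have W_W': "w \<in> W'" if "w \<in> W" for w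
    unfolding W' using that subspace_0[OF subspace_filt]
    by (intro CollectI exI[of _ w] exI[of _ 0]) auto
  have rf: "r * f \<in> W'" if "r \<in> filt e" for r
    unfolding W' using that subspace_0[OF W] by (intro CollectI exI[of _ 0] exI[of _ r]) auto
  have span_C: "W \<subseteq> span ?C" using spB span_mono[of B ?C] by auto
  \<comment> \<open>An exponent that is leading in \<open>J\<close> is reduced: up to a scalar, its
    multiple of \<open>f\<close> is an element of \<open>W\<close> minus multiples of
    \<open>f\<close> by smaller monomials.\<close>
  have mf: "monom \<alpha> * f \<in> span ?C" if "\<alpha> \<in> exps N" "total_deg N \<alpha> \<le> e" for \<alpha>
    using that(1,2)
  proof (induction \<alpha> rule: below_induct)
    case (less \<alpha>)
    have low: "g * f \<in> span ?C" if "g \<in> lower \<alpha>" for g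
    proof (rule span_mult[of g "monom ` {\<beta>. \<beta> \<prec> \<alpha>}" f "{f}"])
      fix u v assume "u \<in> monom ` {\<beta>. \<beta> \<prec> \<alpha>}" "v \<in> {f}"
      then show "u * v \<in> span ?C"
        using less(2) below_total_deg less.prems order_trans by blast
    qed (use that in \<open>auto simp: lower_def span_base\<close>)
    show ?case
    proof (cases "\<alpha> \<in> A")
      case True
      then show ?thesis by (intro span_base) auto
    next
      case False
      then obtain r where r: "r \<in> J" "r \<noteq> 0" "lm r = \<alpha>" using less by (auto simp: A_def lms_def)
      obtain c g where cg: "c \<noteq> 0" "g \<in> lower \<alpha>" "r = c *s monom \<alpha> + g"
        using lead_lm[OF r(2)] r(3) by (auto simp: lead_def)
      have "r * f \<in> span ?C" using r(1) span_C J by auto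
      moreover have "c *s (monom \<alpha> * f) = r * f - g * f"
        by (simp add: cg(3) distrib_right scale_mult_left)
      ultimately have "c *s (monom \<alpha> * f) \<in> span ?C" using low[OF cg(2)] span_diff by simp
      then have "inverse c *s (c *s (monom \<alpha> * f)) \<in> span ?C" by (rule span_scale)
      then show ?thesis using cg(1) by simp
    qed
  qed
  have "dim W' = card ?C"
  proof (rule dim_unique[OF _ _ C(1) refl])
    show "?C \<subseteq> W'" using B(1) W_W' rf monom_filt by (auto simp: A_def)
    show "W' \<subseteq> span ?C"
    proof
      fix u assume "u \<in> W'"
      then obtain w r where u: "u = w + r * f" "w \<in> W" "r \<in> filt e" unfolding W' by blast
      have "r * f \<in> span ?C"
        by (rule span_mult[of r "monom ` ?T" f "{f}"]) (use u(3) mf in \<open>auto simp: filt_def span_base\<close>)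
      then show "u \<in> span ?C" using u span_C span_add by auto
    qed
  qed
  then show ?thesis using C(2) B(4) by (simp add: A_def)
qed

end

section \<open>The degree bound\<close>

text \<open>Colon families are graded by the degree of the multiplier \<open>r\<close>, while the
  product \<open>r * f\<close> is placed \<open>d\<close> degrees higher.\<close>

definition shift :: "nat \<Rightarrow> (nat \<times> nat) multiset \<Rightarrow> (nat \<times> nat) multiset" where
  "shift d P = image_mset (\<lambda>(a, k). (d + a, k)) P"

lemma hilb_shift: "hilb (shift d P) (d + e) = hilb P e"
proof -
  have "cone_card k (d + a) (d + e) = cone_card k a e" for k a by (auto simp: cone_card_def)
  then show ?thesis by (induction P) (auto simp: shift_def)
qed

lemma in_shift: "(b, k) \<in># shift d P \<longleftrightarrow> (\<exists>a. b = d + a \<and> (a, k) \<in># P)"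
  by (force simp: shift_def)

lemma standard_shift:
  assumes "standard 0 P"
  shows "standard d (shift d P)"
  unfolding standard_def
proof clarify
  fix b k :: nat assume b: "(b, k) \<in># shift d P" "0 < k"
  then obtain a where a: "b = d + a" "(a, k) \<in># P" by (auto simp: in_shift)
  have "\<exists>k'\<ge>k. (e, k') \<in># shift d P" if e: "d \<le> e" "e \<le> b" for e
  proof -
    have "e - d \<le> a" using e a(1) by simp
    then obtain k' where "k' \<ge> k" "(e - d, k') \<in># P"
      using standardD(2)[OF assms a(2) b(2), of "e - d"] by auto
    then show ?thesis using e(1) by (intro exI[of _ k']) (auto simp: in_shift intro!: exI[of _ "e - d"])
  qed
  then show "d \<le> b \<and> (\<forall>e. d \<le> e \<and> e \<le> b \<longrightarrow> (\<exists>k'\<ge>k. (e, k') \<in># shift d P))"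
    using a(1) by auto
qed

context degree_compatible_algebra
begin

section \<open>Adjoining generators one at a time\<close>

lemma mult_adjoin:
  assumes W: "graded W" and e: "d \<le> e" and r: "r \<in> filt k"
    and u: "u \<in> {w + s * f |w s. w \<in> W e \<and> s \<in> filt (e - d)}"
  shows "r * u \<in> {w + s * f |w s. w \<in> W (k + e) \<and> s \<in> filt (k + e - d)}"
proof -
  obtain w s where u: "u = w + s * f" "w \<in> W e" "s \<in> filt (e - d)" using u by blast
  have "r * s \<in> filt (k + e - d)" using filt_mult[OF r u(3)] e by simp
  moreover have "r * w \<in> W (k + e)" by (rule gradedD(3)[OF W r u(2)])
  ultimately show ?thesis unfolding u(1) by (auto simp: distrib_left mult.assoc[symmetric])
qed

lemma graded_adjoin:
  assumes W: "graded W" "\<And>e. e < d \<Longrightarrow> W e = {0}" and f: "f \<in> filt d"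
    and I: "left_ideal I" "\<And>e. W e \<subseteq> I" "f \<in> I"
  obtains W' J where "graded W'" "\<And>e. e < d \<Longrightarrow> W' e = {0}" "\<And>e. W' e \<subseteq> I"
    "\<And>e. W e \<subseteq> W' e" "f \<in> W' d" "graded J" "\<And>e. J e = {r\<in>filt e. r * f \<in> W (d + e)}"
    "\<And>e. dim (W' (d + e)) = dim (W (d + e)) + card ({\<alpha>\<in>exps N. total_deg N \<alpha> \<le> e} - lms (J e))"
proof -
  define J where "J e = {r\<in>filt e. r * f \<in> W (d + e)}" for e
  define A where "A e = {w + r * f |w r. w \<in> W e \<and> r \<in> filt (e - d)}" for e
  \<comment> \<open>For \<open>e < d\<close> truncated subtraction gives \<open>e - d = 0\<close>,
    and \<open>A e\<close> would contain scalar multiples of \<open>f\<close>; these degrees are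
    therefore set to zero.\<close>
  define W' where "W' e = (if e < d then {0} else A e)" for e
  have subW: "subspace (W e)" for e by (rule gradedD(1)[OF W(1)])
  have J: "graded J"
    unfolding graded_def
  proof (intro conjI allI ballI)
    fix e
    show "J e \<subseteq> filt e" by (auto simp: J_def)
    show "subspace (J e)"
      unfolding subspace_def J_def
      using subspace_0[OF subspace_filt] subspace_0[OF subW] subspace_add[OF subspace_filt]
        subspace_add[OF subW] subspace_scale[OF subspace_filt] subspace_scale[OF subW]
      by (simp add: distrib_right scale_mult_left)
  next
    fix k e r s assume r: "r \<in> filt k" and s: "s \<in> J e"
    have "r * s \<in> filt (k + e)" using filt_mult[OF r, of s e] s by (simp add: J_def)
    moreover have "r * (s * f) \<in> W (k + (d + e))" using gradedD(3)[OF W(1) r, of "s * f" "d + e"] s by (simp add: J_def)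
    ultimately show "r * s \<in> J (k + e)" by (simp add: J_def mult.assoc add_ac)
  qed
  have subA: "subspace (A e)" for e unfolding A_def by (rule subspace_adjoin[OF subW])
  have subW': "subspace (W' e)" for e unfolding W'_def using subA subspace_single_0 by simp
  have "graded W'"
    unfolding graded_def
  proof (intro conjI allI ballI)
    fix e
    show "subspace (W' e)" by (rule subW')
    show "W' e \<subseteq> filt e"
    proof (cases "e < d")
      case True
      then show ?thesis using subspace_0[OF subspace_filt] by (simp add: W'_def)
    next
      case False
      have "w + r * f \<in> filt e" if "w \<in> W e" "r \<in> filt (e - d)" for w r
      proof (rule subspace_add[OF subspace_filt])
        show "w \<in> filt e" using that(1) gradedD(2)[OF W(1)] by auto
        show "r * f \<in> filt e" using filt_mult[OF that(2) f] False by simp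
      qed
      then show ?thesis using False by (auto simp: W'_def A_def)
    qed
  next
    fix k e r w assume r: "r \<in> filt k" and w: "w \<in> W' e"
    show "r * w \<in> W' (k + e)"
    proof (cases "e < d")
      case True
      then show ?thesis using w subspace_0[OF subW'] by (simp add: W'_def[of e])
    next
      case False
      then have "w \<in> A e" using w by (simp add: W'_def)
      then have "r * w \<in> A (k + e)" unfolding A_def using mult_adjoin[OF W(1) _ r] False by simp
      then show ?thesis using False by (simp add: W'_def)
    qed
  qed
  moreover have "W' e = {0}" if "e < d" for e using that by (simp add: W'_def)
  moreover have "W' e \<subseteq> I" for e
    using I by (auto simp: W'_def A_def left_ideal_def subset_iff)
  moreover have "W e \<subseteq> W' e" for e
  proof (cases "e < d")
    case False
    have "w \<in> A e" if "w \<in> W e" for w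
      unfolding A_def using that subspace_0[OF subspace_filt]
      by (intro CollectI exI[of _ w] exI[of _ 0]) simp
    then show ?thesis using False by (auto simp: W'_def)
  qed (use W(2) subspace_0[OF subW'] in auto)
  moreover have "f \<in> W' d"
  proof -
    have "\<exists>w r. f = w + r * f \<and> w \<in> W d \<and> r \<in> filt 0"
      using one_filt[of 0] subspace_0[OF subW, of d] by (intro exI[of _ 0] exI[of _ 1]) simp
    then show ?thesis by (simp add: W'_def A_def)
  qed
  moreover have "dim (W' (d + e)) = dim (W (d + e)) + card ({\<alpha>\<in>exps N. total_deg N \<alpha> \<le> e} - lms (J e))" for e
  proof (rule dim_adjoin[OF subW gradedD(2)[OF W(1)]])
    show "J e = {r\<in>filt e. r * f \<in> W (d + e)}" by (simp add: J_def)
    show "W' (d + e) = {w + r * f |w r. w \<in> W (d + e) \<and> r \<in> filt e}" by (simp add: W'_def A_def)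
  qed
  ultimately show thesis using that[of W' J] J J_def by blast
qed

text \<open>The first generator is adjoined to the zero family. Its colon ideal vanishes because
  there are no zero divisors, so it contributes all monomials of degree at most \<open>e\<close>.
  Every further generator contributes the complement of a monomial ideal, cut into cones and shifted
  by \<open>d\<close>.\<close>

lemma dube_filtration:
  assumes "finite F" "F \<subseteq> filt d" "f1 \<in> filt d" "f1 \<noteq> 0"
  shows "\<exists>W P. graded W \<and> (\<forall>e<d. W e = {0}) \<and> insert f1 F \<subseteq> W d \<and>
     (\<forall>e. W e \<subseteq> left_ideal hull (insert f1 F)) \<and> standard d P \<and> (\<forall>t\<in>#P. snd t \<le> Suc N) \<and>
     (\<forall>e. dim (W (d + e)) = ((e + N) choose N) + hilb P (d + e))"
  using assms(1,2)
proof (induction F rule: finite_induct)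
  case empty
  let ?I = "left_ideal hull {f1}"
  have I: "left_ideal ?I" "f1 \<in> ?I" using left_ideal_hull hull_inc[of f1 "{f1}"] by auto
  have 0: "graded (\<lambda>_. {0})"
    using subspace_0[OF subspace_filt] by (auto simp: graded_def subspace_single_0)
  obtain W J where W: "graded W" "\<And>e. e < d \<Longrightarrow> W e = {0}" "\<And>e. W e \<subseteq> ?I" "f1 \<in> W d"
      and J: "\<And>e. J e = {r\<in>filt e. r * f1 \<in> {0}}"
      and dim: "\<And>e. dim (W (d + e)) = dim {0} + card ({\<alpha>\<in>exps N. total_deg N \<alpha> \<le> e} - lms (J e))"
    by (rule graded_adjoin[OF 0 refl assms(3) I(1) _ I(2)]) (use I(1) in \<open>auto simp: left_ideal_def\<close>)
  have "J e \<subseteq> {0}" for e using lm_mult(1)[OF _ assms(4)] by (auto simp: J)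
  then have "lms (J e) = {}" for e by (auto simp: lms_def)
  moreover have "dim {0} = 0" by (rule dim_unique[of "{}"]) (auto simp: independent_empty span_zero)
  ultimately have "dim (W (d + e)) = (e + N) choose N" for e by (simp add: dim card_total_deg)
  then show ?case using W by (intro exI[of _ W] exI[of _ "{#}"]) (auto simp: standard_def)
next
  case (insert f F)
  then obtain W P where W: "graded W" "\<And>e. e < d \<Longrightarrow> W e = {0}" "insert f1 F \<subseteq> W d"
     "\<And>e. W e \<subseteq> left_ideal hull (insert f1 F)" and P: "standard d P" "\<forall>t\<in>#P. snd t \<le> Suc N"
     "\<And>e. dim (W (d + e)) = ((e + N) choose N) + hilb P (d + e)" by auto
  let ?I = "left_ideal hull (insert f1 (insert f F))"
  have I: "left_ideal ?I" "f \<in> ?I" using left_ideal_hull hull_inc[of f "insert f1 (insert f F)"] by auto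
  have WI: "W e \<subseteq> ?I" for e
    using W(4)[of e] hull_mono[of "insert f1 F" "insert f1 (insert f F)"] by auto
  have f: "f \<in> filt d" using insert.prems by simp
  obtain W' J where W': "graded W'" "\<And>e. e < d \<Longrightarrow> W' e = {0}" "\<And>e. W' e \<subseteq> ?I" "\<And>e. W e \<subseteq> W' e" "f \<in> W' d"
      and J: "graded J"
      and dim: "\<And>e. dim (W' (d + e)) = dim (W (d + e)) + card ({\<alpha>\<in>exps N. total_deg N \<alpha> \<le> e} - lms (J e))"
    by (rule graded_adjoin[OF W(1,2) f I(1) WI I(2)]) auto
  obtain R where R: "\<And>z. card {\<alpha>\<in>mons {0..N} - mono_ideal J. size_on {0..N} \<alpha> = z} = hilb R z"
    "standard 0 R" "\<forall>t\<in>#R. snd t \<le> card {0..N}"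
    by (rule monomial_ideal_decomposition[of "{0..N}" "mono_ideal J"])
      (use mono_ideal_up[OF J] in \<open>auto simp: mono_ideal_def[of J]\<close>)
  have "dim (W' (d + e)) = ((e + N) choose N) + hilb (P + shift d R) (d + e)" for e
    using dim[of e] P(3)[of e] R(1)[of e, unfolded card_mono_ideal_compl] by (simp add: hilb_shift)
  moreover have "\<forall>t\<in>#P + shift d R. snd t \<le> Suc N"
    using P(2) R(3) by (auto simp: shift_def)
  moreover have "standard d (P + shift d R)"
    by (rule standard_union[OF P(1) standard_shift[OF R(2)]])
  moreover have "insert f1 (insert f F) \<subseteq> W' d" using W(3) W'(4,5) by auto
  ultimately show ?case using W'(1-3) by (intro exI[of _ W'] exI[of _ "P + shift d R"]) auto
qed

text \<open>The constant 1 lies in every \<open>filt k\<close>, so \<open>W\<close> is increasing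
  and its union is a left ideal.\<close>

lemma filtration_exhausts:
  assumes W: "graded W" and S: "S \<subseteq> W d" and f: "f \<in> left_ideal hull S"
  obtains e where "f \<in> W e"
proof -
  have up: "w \<in> W (k + e)" if "w \<in> W e" for w k e
    using gradedD(3)[OF W one_filt that, of k] by simp
  have "left_ideal (\<Union>e. W e)"
    unfolding left_ideal_def
  proof (intro conjI ballI allI)
    show "0 \<in> (\<Union>e. W e)" using subspace_0[OF gradedD(1)[OF W]] by auto
    fix a assume "a \<in> (\<Union>e. W e)"
    then obtain e1 where a: "a \<in> W e1" by auto
    {
      fix b assume "b \<in> (\<Union>e. W e)"
      then obtain e2 where b: "b \<in> W e2" by auto
      have "a \<in> W (e2 + e1)" "b \<in> W (e2 + e1)" using up[OF a, of e2] up[OF b, of e1] by (simp_all add: add.commute)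
      then have "a + b \<in> W (e2 + e1)" by (rule subspace_add[OF gradedD(1)[OF W]])
      then show "a + b \<in> (\<Union>e. W e)" by auto
    }
    fix r
    obtain k where "r \<in> filt k" using filt_Union by blast
    then show "r * a \<in> (\<Union>e. W e)" using gradedD(3)[OF W _ a] by auto
  qed
  then have "left_ideal hull S \<subseteq> (\<Union>e. W e)" using S by (intro hull_minimal) auto
  then show thesis using f that by auto
qed

lemma small_leading_divisor:
  assumes N: "N \<ge> 1" and S: "S \<subseteq> filt d" and f: "f \<in> left_ideal hull S" "f \<noteq> 0"
  obtains h where "h \<in> left_ideal hull S" "h \<noteq> 0" "lm h \<le> lm f"
    "real (total_deg N (lm h)) \<le> 2 * ((real d)\<^sup>2 / 2 + real d) ^ (2 ^ (N - 1))"
proof -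
  let ?D = "2 * ((real d)\<^sup>2 / 2 + real d) ^ (2 ^ (N - 1))"
  have D0: "?D \<ge> 0" by simp
  have "\<not> S \<subseteq> {0}"
  proof
    assume "S \<subseteq> {0}"
    then have "left_ideal hull S \<subseteq> {0}" by (rule hull_minimal) (simp add: left_ideal_def)
    then show False using f by auto
  qed
  then obtain f1 where f1: "f1 \<in> S" "f1 \<noteq> 0" by auto
  show thesis
  proof (cases "d = 0")
    case True
    \<comment> \<open>For \<open>d = 0\<close> the bound is 0: the generators are constants, and a
      nonzero one has leading exponent 0.\<close>
    then have "total_deg N (lm f1) = 0" using lm_filt[of f1 0] S f1 by auto
    then have "lm f1 = (\<lambda>_. 0)" using lm_exps[OF f1(2)] by (auto simp: total_deg_def exps_def fun_eq_iff)
    then show ?thesis using that[of f1] f1 hull_inc[of f1 S left_ideal] D0 \<open>total_deg N (lm f1) = 0\<close>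
      by (simp add: le_fun_def)
  next
    case False
    \<comment> \<open>\<open>S\<close> may be infinite, but \<open>filt d\<close> has finite
      dimension, so a finite subset of \<open>S\<close> spans all of it.\<close>
    obtain F where F: "F \<subseteq> S" "independent F" "S \<subseteq> span F" by (rule maximal_independent_subset)
    have "F \<subseteq> span (monom ` {\<alpha>\<in>exps N. total_deg N \<alpha> \<le> d})" using F(1) S by (auto simp: filt_def)
    from independent_span_bound[OF finite_imageI[OF finite_total_deg] F(2) this] have finF: "finite F" by simp
    have Fd: "F \<subseteq> filt d" "f1 \<in> filt d" using F(1) S f1 by auto
    obtain W P where W: "graded W" "insert f1 F \<subseteq> W d" "\<And>e. W e \<subseteq> left_ideal hull (insert f1 F)"
      and P: "standard d P" "\<forall>t\<in>#P. snd t \<le> Suc N"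
        "\<And>e. dim (W (d + e)) = ((e + N) choose N) + hilb P (d + e)"
      using dube_filtration[OF finF Fd f1(2)] by auto
    have WI: "W e \<subseteq> left_ideal hull S" for e
      using W(3)[of e] hull_mono[of "insert f1 F" S] F(1) f1(1) by auto
    have SW: "S \<subseteq> W d"
      using F(3) span_minimal[of F "W d"] W(2) gradedD(1)[OF W(1)] by auto
    obtain Q where Q: "\<And>z. card {\<alpha>\<in>mons {0..N} - mono_ideal W. size_on {0..N} \<alpha> = z} = hilb Q z"
      "standard 0 Q" "\<forall>t\<in>#Q. snd t \<le> card {0..N}"
      "\<And>\<alpha>. \<alpha> \<in> mono_ideal W \<Longrightarrow> \<exists>g\<in>mono_ideal W. g \<le> \<alpha> \<and>
         (g = (\<lambda>_. 0) \<or> (\<exists>t\<in>#Q. size_on {0..N} g \<le> fst t + 1))"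
      by (rule monomial_ideal_decomposition[of "{0..N}" "mono_ideal W"])
        (use mono_ideal_up[OF W(1)] in \<open>auto simp: mono_ideal_def[of W]\<close>)
    have total: "(z + d + N) choose N = ((z + N) choose N) + hilb P (z + d) + hilb Q (z + d)" for z
    proof -
      let ?T = "{\<alpha>\<in>exps N. total_deg N \<alpha> \<le> d + z}"
      have sub: "lms (W (d + z)) \<subseteq> ?T" by (rule lms_filt[OF gradedD(2)[OF W(1)]])
      have "card ?T = card (lms (W (d + z))) + card (?T - lms (W (d + z)))"
        using card_Diff_subset[OF finite_subset[OF sub finite_total_deg] sub]
          card_mono[OF finite_total_deg sub] by simp
      also have "card (lms (W (d + z))) = ((z + N) choose N) + hilb P (d + z)"
        using dim_eq_card_lms[OF gradedD(1,2)[OF W(1)]] P(3)[of z] by simp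
      also have "card (?T - lms (W (d + z))) = hilb Q (d + z)"
        using Q(1)[of "d + z", unfolded card_mono_ideal_compl] .
      finally show ?thesis by (simp add: card_total_deg add_ac)
    qed
    have bound: "real (fst t + 1) \<le> ?D" if "t \<in># Q" for t
      by (rule dube_bound_standard[OF N _ P(1,2) Q(2) _ total that]) (use False Q(3) in auto)
    obtain e where e: "f \<in> W e" by (rule filtration_exhausts[OF W(1) SW f(1)])
    have le: "total_deg N (lm f) \<le> e" using lm_filt[OF _ f(2)] e gradedD(2)[OF W(1)] by blast
    \<comment> \<open>\<open>lm f\<close> is homogenized in the degree \<open>e\<close> in which
      \<open>f\<close> is found, however large. The bound applies to an element \<open>g\<close> of
      \<open>mono_ideal W\<close> below \<gamma>, independently of \<open>e\<close>.\<close>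
    define \<gamma> where "\<gamma> = (lm f)(0 := e - total_deg N (lm f))"
    have d\<gamma>: "dehom \<gamma> = lm f" using lm_exps[OF f(2)] by (auto simp: \<gamma>_def dehom_def exps_def)
    have s\<gamma>: "size_on {0..N} \<gamma> = e" using le by (simp add: size_on_dehom d\<gamma>) (simp add: \<gamma>_def)
    have "\<gamma> \<in> mons {0..N}" using lm_exps[OF f(2)] by (auto simp: \<gamma>_def mons_def exps_def)
    then have "\<gamma> \<in> mono_ideal W" using e f(2) by (auto simp: mono_ideal_def lms_def s\<gamma> d\<gamma>)
    from Q(4)[OF this] obtain g where g: "g \<in> mono_ideal W" "g \<le> \<gamma>"
        "g = (\<lambda>_. 0) \<or> (\<exists>t\<in>#Q. size_on {0..N} g \<le> fst t + 1)" by blast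
    have sg: "real (size_on {0..N} g) \<le> ?D"
      using g(3)
    proof
      assume "\<exists>t\<in>#Q. size_on {0..N} g \<le> fst t + 1"
      then obtain t where t: "t \<in># Q" "size_on {0..N} g \<le> fst t + 1" by blast
      then have "real (size_on {0..N} g) \<le> real (fst t + 1)" by linarith
      then show ?thesis using bound[OF t(1)] by linarith
    qed (simp add: size_on_def)
    have "dehom g \<in> lm ` (W (size_on {0..N} g) - {0})" using g(1) by (simp add: mono_ideal_def lms_def)
    then obtain h where h: "dehom g = lm h" "h \<in> W (size_on {0..N} g) - {0}" by (rule imageE)
    have "lm h \<le> lm f" using g(2) unfolding h(1)[symmetric] d\<gamma>[symmetric] by (auto simp: dehom_def le_fun_def)
    moreover have "real (total_deg N (lm h)) \<le> ?D" using sg unfolding h(1)[symmetric] by (simp add: size_on_dehom)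
    ultimately show ?thesis using that[of h] h(2) WI by auto
  qed
qed

text \<open>Divisibility closes up: an \<open>h\<close> of small leading degree has
  \<open>lm h\<close> dividing \<open>lm g\<close>, and some \<open>g'\<close> in \<open>G\<close>
  has \<open>lm g'\<close> dividing \<open>lm h\<close>. Reducedness forces \<open>g' = g\<close>,
  so \<open>lm g\<close> is as small as \<open>lm h\<close>; degree-compatibility lets
  \<open>lm g\<close> bound the degree of \<open>g\<close>.\<close>

theorem reduced_groebner_basis_deg:
  assumes N: "N \<ge> 1" and S: "\<forall>f\<in>S. deg f \<le> d"
    and G: "reduced_groebner_basis (left_ideal hull S) G" and g: "g \<in> G"
  shows "real (deg g) \<le> 2 * ((real d)\<^sup>2 / 2 + real d) ^ (2 ^ (N - 1))"
proof -
  have GI: "G \<subseteq> left_ideal hull S"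
    "\<And>f. f \<in> left_ideal hull S \<Longrightarrow> f \<noteq> 0 \<Longrightarrow> \<exists>g\<in>G. g \<noteq> 0 \<and> (\<forall>i\<in>{1..N}. lm g i \<le> lm f i)"
    using G by (auto simp: reduced_groebner_basis_def groebner_basis_def)
  have red: "lc g = 1"
    "\<And>g' \<alpha>. g' \<in> G \<Longrightarrow> g' \<noteq> g \<Longrightarrow> g' \<noteq> 0 \<Longrightarrow> \<alpha> \<in> supp g \<Longrightarrow> \<not> (\<forall>i\<in>{1..N}. lm g' i \<le> \<alpha> i)"
    using G g by (auto simp: reduced_groebner_basis_def)
  have g0: "g \<noteq> 0" using red(1) by (auto simp: lc_def coeff_zero)
  have "S \<subseteq> filt d" using S deg_le_iff by blast
  then obtain h where h: "h \<in> left_ideal hull S" "h \<noteq> 0" "lm h \<le> lm g"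
    "real (total_deg N (lm h)) \<le> 2 * ((real d)\<^sup>2 / 2 + real d) ^ (2 ^ (N - 1))"
    using small_leading_divisor[OF N _ _ g0] g GI(1) by blast
  obtain g' where g': "g' \<in> G" "g' \<noteq> 0" "\<forall>i\<in>{1..N}. lm g' i \<le> lm h i" using GI(2)[OF h(1,2)] by blast
  then have "\<forall>i\<in>{1..N}. lm g' i \<le> lm g i" using h(3) by (auto simp: le_fun_def intro: order_trans)
  then have "g' = g" using red(2)[OF g'(1) _ g'(2) lm_props(1)[OF g0]] by blast
  then have "total_deg N (lm g) \<le> total_deg N (lm h)"
    using g'(3) unfolding total_deg_def by (intro sum_mono) auto
  moreover have "deg g \<le> total_deg N (lm g)" using in_filt_lm[OF g0] by (simp add: deg_le_iff)
  ultimately show ?thesis using h(4) by linarith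
qed

end

theorem corollary5p9:
  fixes scale :: "'k::field \<Rightarrow> 'r::ring_1 \<Rightarrow> 'r"
    and N d :: nat
    and x :: "nat \<Rightarrow> 'r"
    and ord :: "((nat \<Rightarrow> nat) \<times> (nat \<Rightarrow> nat)) set"
    and S I G :: "'r set"
  assumes "N \<ge> 1"
    and "quadric_solvable_algebra scale N x ord"
    and "degree_compatible N ord"
    and "I = left_ideal hull S"
    and "\<forall>f\<in>S. K_algebra_tuple.deg scale N x f \<le> d"
    and "K_algebra_tuple.reduced_groebner_basis scale N x ord I G"
  shows "\<forall>g\<in>G. real (K_algebra_tuple.deg scale N x g)
           \<le> 2 * ((real d)\<^sup>2 / 2 + real d) ^ (2 ^ (N - 1))"
proof -
  interpret degree_compatible_algebra scale N x ord
    using assms(2,3) by (simp add: degree_compatible_algebra_def degree_compatible_algebra_axioms_def)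
  show ?thesis using reduced_groebner_basis_deg[OF assms(1,5)] assms(4,6) by blast
qed

end
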